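(* There exists a graph on six vertices such that the drawing produced by classical multidimensional scaling is not computable in a radical computation tree.
   Context: Classical multidimensional scaling of a connected graph $G$ on $n$ vertices into $d$ dimensions: let $D$ be the $n\times n$ matrix of squared graph-theoretic distances between vertices; double-center it to obtain $B=-\frac12 JDJ$ with $J=I-\frac1n\mathbf{1}\mathbf{1}^T$; factor $B=V\Lambda V^T$ with $V$ orthonormal eigenvectors sorted by eigenvalue (largest first) and $\Lambda$ the diagonal matrix of eigenvalues; the vertex positions are the rows of the first $d$ columns of $V\Lambda^{1/2}$ (here $d=2$, a planar drawing). An algebraic computation tree is a rooted tree whose computation nodes compute a value as the sum, difference, product or quotient of integer constants and values computed at ancestor nodes, and whose decision nodes test whether a computed value is greater than zero and branch. A radical computation tree additionally allows computing the $k$-th root of a previously computed value ($k$ an integer parameter) and complex conjugation. *)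

theory Defs
  imports Complex_Main
begin

definition simple_graph :: "nat \<Rightarrow> (nat \<Rightarrow> nat \<Rightarrow> bool) \<Rightarrow> bool" where
  "simple_graph n E \<longleftrightarrow> (\<forall>u v. E u v \<longrightarrow> u < n \<and> v < n) \<and>
     (\<forall>u v. E u v \<longrightarrow> E v u) \<and> (\<forall>u. \<not> E u u)"

primrec walk :: "(nat \<Rightarrow> nat \<Rightarrow> bool) \<Rightarrow> nat \<Rightarrow> nat \<Rightarrow> nat \<Rightarrow> bool" where
  "walk E 0 u v \<longleftrightarrow> u = v"
| "walk E (Suc k) u v \<longleftrightarrow> (\<exists>w. E u w \<and> walk E k w v)"

definition graph_connected :: "nat \<Rightarrow> (nat \<Rightarrow> nat \<Rightarrow> bool) \<Rightarrow> bool" where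
  "graph_connected n E \<longleftrightarrow> (\<forall>u<n. \<forall>v<n. \<exists>k. walk E k u v)"

definition gdist :: "(nat \<Rightarrow> nat \<Rightarrow> bool) \<Rightarrow> nat \<Rightarrow> nat \<Rightarrow> nat" where
  "gdist E u v = (LEAST k. walk E k u v)"

definition sqdist_matrix :: "(nat \<Rightarrow> nat \<Rightarrow> bool) \<Rightarrow> nat \<Rightarrow> nat \<Rightarrow> real" where
  "sqdist_matrix E i j = (real (gdist E i j))^2"

definition centering :: "nat \<Rightarrow> nat \<Rightarrow> nat \<Rightarrow> real" where
  "centering n i j = (if i = j then 1 else 0) - 1 / real n"

definition mds_B :: "nat \<Rightarrow> (nat \<Rightarrow> nat \<Rightarrow> bool) \<Rightarrow> nat \<Rightarrow> nat \<Rightarrow> real" where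
  "mds_B n E i j = - (1/2) * (\<Sum>k<n. \<Sum>l<n. centering n i k * sqdist_matrix E k l * centering n l j)"

definition mds_eigendecomp ::
  "nat \<Rightarrow> (nat \<Rightarrow> nat \<Rightarrow> bool) \<Rightarrow> (nat \<Rightarrow> nat \<Rightarrow> real) \<Rightarrow> (nat \<Rightarrow> real) \<Rightarrow> bool" where
  "mds_eigendecomp n E V lam \<longleftrightarrow>
     (\<forall>i<n. \<forall>j<n. (\<Sum>k<n. V k i * V k j) = (if i = j then 1 else 0)) \<and>
     (\<forall>i<n. \<forall>j<n. mds_B n E i j = (\<Sum>k<n. V i k * lam k * V j k)) \<and>
     (\<forall>i<n. \<forall>j<n. i \<le> j \<longrightarrow> lam j \<le> lam i)"

definition mds_coord :: "(nat \<Rightarrow> nat \<Rightarrow> real) \<Rightarrow> (nat \<Rightarrow> real) \<Rightarrow> nat \<Rightarrow> nat \<Rightarrow> complex" where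
  "mds_coord V lam i c = complex_of_real (V i c) * csqrt (complex_of_real (lam c))"

definition mds_drawing :: "nat \<Rightarrow> (nat \<Rightarrow> nat \<Rightarrow> real) \<Rightarrow> (nat \<Rightarrow> real) \<Rightarrow> complex list" where
  "mds_drawing n V lam = concat (map (\<lambda>i. [mds_coord V lam i 0, mds_coord V lam i 1]) [0..<n])"

text \<open>Computation-node operations; natural-number arguments are indices of values
  computed at ancestor nodes (the input values come first).\<close>
datatype rop = RConst int | RAdd nat nat | RSub nat nat | RMul nat nat | RDiv nat nat
  | RRoot nat nat  \<comment> \<open>RRoot k i: a k-th root of value i\<close>
  | RConj nat

datatype rtree = RLeaf "nat list" | RComp rop rtree | RDec nat rtree rtree

definition op_val :: "rop \<Rightarrow> complex list \<Rightarrow> complex \<Rightarrow> bool" where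
  "op_val p vs z = (case p of
      RConst c \<Rightarrow> z = of_int c
    | RAdd i j \<Rightarrow> i < length vs \<and> j < length vs \<and> z = vs ! i + vs ! j
    | RSub i j \<Rightarrow> i < length vs \<and> j < length vs \<and> z = vs ! i - vs ! j
    | RMul i j \<Rightarrow> i < length vs \<and> j < length vs \<and> z = vs ! i * vs ! j
    | RDiv i j \<Rightarrow> i < length vs \<and> j < length vs \<and> vs ! j \<noteq> 0 \<and> z = vs ! i / vs ! j
    | RRoot k i \<Rightarrow> 1 \<le> k \<and> i < length vs \<and> z ^ k = vs ! i
    | RConj i \<Rightarrow> i < length vs \<and> z = cnj (vs ! i))"

definition positive_val :: "complex \<Rightarrow> bool" where
  "positive_val z \<longleftrightarrow> Im z = 0 \<and> Re z > 0"

text \<open>rexec T vs out: running T, with values vs computed so far, can output out.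
  Root nodes may take any k-th root (all branches allowed).\<close>
inductive rexec :: "rtree \<Rightarrow> complex list \<Rightarrow> complex list \<Rightarrow> bool" where
  leaf: "(\<forall>i\<in>set outs. i < length vs) \<Longrightarrow> rexec (RLeaf outs) vs (map ((!) vs) outs)"
| comp: "op_val p vs z \<Longrightarrow> rexec t (vs @ [z]) out \<Longrightarrow> rexec (RComp p t) vs out"
| dec_pos: "i < length vs \<Longrightarrow> positive_val (vs ! i) \<Longrightarrow> rexec t1 vs out \<Longrightarrow> rexec (RDec i t1 t2) vs out"
| dec_neg: "i < length vs \<Longrightarrow> \<not> positive_val (vs ! i) \<Longrightarrow> rexec t2 vs out \<Longrightarrow> rexec (RDec i t1 t2) vs out"

definition adj_input :: "nat \<Rightarrow> (nat \<Rightarrow> nat \<Rightarrow> bool) \<Rightarrow> complex list" where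
  "adj_input n E = concat (map (\<lambda>i. map (\<lambda>j. if E i j then 1 else 0) [0..<n]) [0..<n])"

end

theory Submission
  imports Defs "HOL-Computational_Algebra.Fundamental_Theorem_Algebra" "Jordan_Normal_Form.Char_Poly"
begin

text \<open>For the graph below, the nonzero eigenvalues of \<open>B\<close> are \<open>2 + 3 / (2 y)\<close> with \<open>y\<close> a root of
  \<open>f = y^5 - y^4 - 8 y^3 + 2 y^2 + 9 y + 3\<close>. The squares of the first coordinates of the drawing sum
  up to the largest eigenvalue, so a radical drawing would make a root of \<open>f\<close> a radical number.

  Let \<open>\<Gamma>\<close> be the group of automorphisms of the algebraic numbers. A value that is obtained by
  arithmetic, roots and conjugation is fixed by the \<open>n\<close>-fold iterated commutators of \<open>\<Gamma>\<close> for some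
  \<open>n\<close>: commutators fix the roots of unity, and if two automorphisms fix \<open>z^k\<close> and the roots of unity,
  then their commutator fixes \<open>z\<close>. On the other hand, \<open>\<Gamma>\<close> induces all permutations of the five roots
  of \<open>f\<close>, and every 3-cycle on five points is a commutator of 3-cycles, so no root of \<open>f\<close> is fixed by
  all \<open>n\<close>-fold commutators. That \<open>\<Gamma>\<close> acts as the full symmetric group follows from lifts of Frobenius:
  \<open>f\<close> is irreducible modulo 5, which gives a 5-cycle, and has an irreducible quadratic and an
  irreducible cubic factor modulo 7, which gives a transposition.\<close>

text \<open>A tree may take any k-th root and a drawing may come from any eigendecomposition, so the
  argument rests on quantities that survive every choice. The sum of squared coordinates is
  \<open>lam 0\<close> whatever the signs in \<open>V\<close>, and being fixed by derived
  automorphisms does not depend on which root was taken.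

  Working with all automorphisms of the single field \<open>qbar\<close>, instead of Galois groups
  of splitting fields, avoids towers of radical extensions: arithmetic keeps the larger of two
  derived levels and a root adds two. Complex conjugation is harmless because conjugating by
  \<open>cnj\<close> preserves each level.

  The price is that the action on the roots of the quintic has to be found inside an infinite group.
  Frobenius is lifted by means of a valuation ring of the complex numbers over a prime p, with
  congruences modulo its maximal ideal \<open>M\<close> in place of a residue field. Factorizations
  modulo 5 and 7 then enter only as integer polynomial identities evaluated at elements of that
  ring.\<close>

section \<open>Isomorphisms between subfields\<close>

text \<open>\<open>R\<close> may be many-valued. The same closure facts serve for partial
  isomorphisms, the diagonal of a subring, the graph of an automorphism on \<open>qbar\<close>,
  congruence modulo \<open>M\<close> and Frobenius modulo \<open>M\<close>.\<close>

locale ring_rel =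
  fixes R :: "'a::comm_ring_1 \<Rightarrow> 'a \<Rightarrow> bool"
  assumes zero: "R 0 0"
    and one: "R 1 1"
    and add: "R a b \<Longrightarrow> R c d \<Longrightarrow> R (a + c) (b + d)"
    and mult: "R a b \<Longrightarrow> R c d \<Longrightarrow> R (a * c) (b * d)"
    and uminus: "R a b \<Longrightarrow> R (- a) (- b)"
begin

lemma diff: "R a b \<Longrightarrow> R c d \<Longrightarrow> R (a - c) (b - d)"
  using add[OF _ uminus] by force

lemma power: "R a b \<Longrightarrow> R (a ^ n) (b ^ n)"
  by (induction n) (auto intro: one mult)

lemma sum: "(\<And>i. i \<in> I \<Longrightarrow> R (f i) (g i)) \<Longrightarrow> R (sum f I) (sum g I)"
  by (induction I rule: infinite_finite_induct) (auto intro: zero add)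

lemma prod: "(\<And>i. i \<in> I \<Longrightarrow> R (f i) (g i)) \<Longrightarrow> R (prod f I) (prod g I)"
  by (induction I rule: infinite_finite_induct) (auto intro: one mult)

lemma of_nat: "R (of_nat n) (of_nat n)"
  by (induction n) (auto intro: zero one add)

lemma of_int: "R (of_int n) (of_int n)"
  by (cases n) (auto intro: of_nat uminus one add simp del: of_nat_Suc)

end

section \<open>Polynomials with related coefficients\<close>

definition rel_poly :: "('a::comm_ring_1 \<Rightarrow> 'a \<Rightarrow> bool) \<Rightarrow> 'a poly \<Rightarrow> 'a poly \<Rightarrow> bool" where
  "rel_poly R P Q \<longleftrightarrow> (\<forall>i. R (coeff P i) (coeff Q i))"

lemma rel_polyD: "rel_poly R P Q \<Longrightarrow> R (coeff P i) (coeff Q i)"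
  by (simp add: rel_poly_def)

lemma poly_eq_sum_le:
  fixes P :: "'a::comm_ring_1 poly"
  assumes "degree P \<le> n"
  shows "poly P a = (\<Sum>i\<le>n. coeff P i * a ^ i)"
  unfolding poly_altdef
  by (rule sum.mono_neutral_left) (use assms in \<open>auto intro: le_degree\<close>)

context ring_rel
begin

lemma ring_rel_rel_poly: "ring_rel (rel_poly R)"
proof
  fix a b c d assume *: "rel_poly R a b" "rel_poly R c d"
  show "rel_poly R (a * c) (b * d)"
    using * by (auto simp: rel_poly_def coeff_mult intro!: sum mult)
qed (auto simp: rel_poly_def zero one uminus intro: add)

lemma rel_poly_pCons: "R a b \<Longrightarrow> rel_poly R P Q \<Longrightarrow> rel_poly R (pCons a P) (pCons b Q)"
  by (auto simp: rel_poly_def coeff_pCons split: nat.splits)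

lemma rel_poly_monom: "R a b \<Longrightarrow> rel_poly R (monom a n) (monom b n)"
  by (auto simp: rel_poly_def zero)

lemma poly_rel:
  assumes "rel_poly R P Q" "R a b"
  shows "R (poly P a) (poly Q b)"
proof -
  define n where "n = max (degree P) (degree Q)"
  have "R (\<Sum>i\<le>n. coeff P i * a ^ i) (\<Sum>i\<le>n. coeff Q i * b ^ i)"
    using assms by (auto intro!: sum mult power dest: rel_polyD)
  then show ?thesis
    by (simp add: poly_eq_sum_le[of P n] poly_eq_sum_le[of Q n] n_def)
qed

end

text \<open>Partial isomorphisms between subfields are represented by their graphs, so that extending one
  is Zorn's lemma for inclusion and inverting one is the converse relation.\<close>

locale field_rel = ring_rel R for R :: "'a::field \<Rightarrow> 'a \<Rightarrow> bool" +
  assumes inverse: "R a b \<Longrightarrow> R (inverse a) (inverse b)"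
    and zero_iff: "R a b \<Longrightarrow> a = 0 \<longleftrightarrow> b = 0"
begin

lemma divide: "R a b \<Longrightarrow> R c d \<Longrightarrow> R (a / c) (b / d)"
  using mult[OF _ inverse] by (simp add: field_class.field_divide_inverse)

lemma right_unique: "R a b \<Longrightarrow> R a c \<Longrightarrow> b = c"
  using zero_iff[OF diff] by fastforce

lemma left_unique: "R a c \<Longrightarrow> R b c \<Longrightarrow> a = b"
  using zero_iff[OF diff] by fastforce

lemma rel_poly_coeff_zero_iff: "rel_poly R P Q \<Longrightarrow> coeff P i = 0 \<longleftrightarrow> coeff Q i = 0"
  by (rule zero_iff[OF rel_polyD])

lemma rel_poly_degree:
  assumes "rel_poly R P Q"
  shows "degree P = degree Q"
  using rel_poly_coeff_zero_iff[OF assms] by (simp add: degree_def)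

lemma rel_poly_zero_iff:
  assumes "rel_poly R P Q"
  shows "P = 0 \<longleftrightarrow> Q = 0"
  using rel_poly_coeff_zero_iff[OF assms] by (simp add: poly_eq_iff)

text \<open>Long division runs on both sides of \<open>R\<close> at once: leading coefficients are
  related, hence so is each elimination step. Bounding the support by \<open>n\<close>, instead of
  using the degree, lets the induction end at the zero polynomial.\<close>

lemma rel_poly_division_aux:
  assumes m: "rel_poly R m m'" "m \<noteq> 0"
    and P: "rel_poly R P P'" "\<forall>i\<ge>n. coeff P i = 0"
  shows "\<exists>q q' r r'. rel_poly R q q' \<and> rel_poly R r r' \<and>
           P = m * q + r \<and> P' = m' * q' + r' \<and> (r = 0 \<or> degree r < degree m)"
  using P
proof (induction n arbitrary: P P')
  case 0
  then have "P = 0" by (simp add: poly_eq_iff)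
  moreover from this have "P' = 0"
    using rel_poly_zero_iff[OF 0(1)] by simp
  ultimately show ?case
    by (intro exI[of _ 0]) (auto simp: rel_poly_def zero)
next
  case (Suc n)
  interpret poly: ring_rel "rel_poly R" by (rule ring_rel_rel_poly)
  show ?case
  proof (cases "n < degree m")
    case True
    have "degree P \<le> n"
      by (rule degree_le) (use Suc.prems(2) in simp)
    then show ?thesis
      using Suc.prems True poly.zero
      by (rule_tac exI[of _ 0], rule_tac exI[of _ 0], rule_tac exI[of _ P], rule_tac exI[of _ P']) simp
  next
    case False
    define k where "k = n - degree m"
    define c where "c = coeff P n / lead_coeff m"
    define c' where "c' = coeff P' n / lead_coeff m'"
    have cc': "R c c'"
      unfolding c_def c'_def using m(1) Suc.prems(1) rel_poly_degree[OF m(1)]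
      by (auto intro!: divide dest: rel_polyD)
    have mon: "rel_poly R (monom c k * m) (monom c' k * m')"
      using m(1) cc' by (intro poly.mult rel_poly_monom)
    have "\<forall>i\<ge>n. coeff (P - monom c k * m) i = 0"
    proof (intro allI impI)
      fix i assume "n \<le> i"
      then consider "i = n" | "i > n" by linarith
      then show "coeff (P - monom c k * m) i = 0"
      proof cases
        case 1
        then show ?thesis
          using False m(2) by (simp add: coeff_monom_mult k_def c_def)
      next
        case 2
        then have "coeff m (i - k) = 0" "coeff P i = 0"
          using False Suc.prems(2) by (auto simp: k_def intro!: coeff_eq_0)
        then show ?thesis by (simp add: coeff_monom_mult)
      qed
    qed
    from Suc.IH[OF poly.diff[OF Suc.prems(1) mon] this]
    obtain q q' r r' where IH: "rel_poly R q q'" "rel_poly R r r'"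
      "P - monom c k * m = m * q + r" "P' - monom c' k * m' = m' * q' + r'"
      "r = 0 \<or> degree r < degree m"
      by blast
    have "rel_poly R (q + monom c k) (q' + monom c' k)"
      using IH(1) cc' by (intro poly.add rel_poly_monom)
    moreover have "P = m * (q + monom c k) + r"
      using arg_cong[OF IH(3), of "\<lambda>t. t + monom c k * m"] by (simp add: ring_distribs mult.commute)
    moreover have "P' = m' * (q' + monom c' k) + r'"
      using arg_cong[OF IH(4), of "\<lambda>t. t + monom c' k * m'"] by (simp add: ring_distribs mult.commute)
    ultimately show ?thesis
      using IH(2,5) by (intro exI conjI)
  qed
qed

lemma rel_poly_division:
  assumes "rel_poly R m m'" "m \<noteq> 0" "rel_poly R P P'"
  obtains q q' r r' where "rel_poly R q q'" "rel_poly R r r'"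
    "P = m * q + r" "P' = m' * q' + r'" "r = 0 \<or> degree r < degree m"
proof -
  have "\<forall>i\<ge>Suc (degree P). coeff P i = 0"
    by (simp add: coeff_eq_0)
  then show thesis
    using rel_poly_division_aux[OF assms] that by blast
qed

section \<open>Minimal polynomials and simple extensions\<close>

definition minpoly :: "'a poly \<Rightarrow> 'a poly \<Rightarrow> 'a \<Rightarrow> bool" where
  "minpoly m m' y \<longleftrightarrow> rel_poly R m m' \<and> m \<noteq> 0 \<and> poly m y = 0 \<and>
     (\<forall>P P'. rel_poly R P P' \<longrightarrow> P \<noteq> 0 \<longrightarrow> poly P y = 0 \<longrightarrow> degree m \<le> degree P)"

lemma minpolyD:
  assumes "minpoly m m' y"
  shows "rel_poly R m m'" "m \<noteq> 0" "poly m y = 0"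
    "rel_poly R P P' \<Longrightarrow> P \<noteq> 0 \<Longrightarrow> poly P y = 0 \<Longrightarrow> degree m \<le> degree P"
  using assms unfolding minpoly_def by blast+

lemma minpoly_exists:
  assumes "rel_poly R P P'" "P \<noteq> 0" "poly P y = 0"
  obtains m m' where "minpoly m m' y"
proof -
  define S where "S = {d. \<exists>m m'. rel_poly R m m' \<and> m \<noteq> 0 \<and> poly m y = 0 \<and> degree m = d}"
  have "degree P \<in> S"
    unfolding S_def using assms by blast
  then have "Inf S \<in> S" by (intro Inf_nat_def1) auto
  then obtain m m' where m: "rel_poly R m m'" "m \<noteq> 0" "poly m y = 0" "degree m = Inf S"
    unfolding S_def by blast
  have "degree m \<le> degree Q" if "rel_poly R Q Q'" "Q \<noteq> 0" "poly Q y = 0" for Q Q'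
    unfolding m(4) by (rule cInf_lower) (use that in \<open>auto simp: S_def\<close>)
  then show thesis
    using m by (intro that[of m m']) (simp add: minpoly_def)
qed

lemma minpoly_dvd:
  assumes m: "minpoly m m' y" and P: "rel_poly R P P'" "poly P y = 0"
  shows "\<exists>q q'. rel_poly R q q' \<and> P = m * q \<and> P' = m' * q'"
proof -
  obtain q q' r r' where *: "rel_poly R q q'" "rel_poly R r r'"
    "P = m * q + r" "P' = m' * q' + r'" "r = 0 \<or> degree r < degree m"
    using rel_poly_division[OF minpolyD(1,2)[OF m] P(1)] .
  have "poly r y = 0"
    using *(3) P(2) minpolyD(3)[OF m] by simp
  have "r = 0"
  proof (rule ccontr)
    assume "r \<noteq> 0"
    then show False
      using minpolyD(4)[OF m *(2) _ \<open>poly r y = 0\<close>] *(5) by simp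
  qed
  moreover from this have "r' = 0"
    using rel_poly_zero_iff[OF *(2)] by simp
  ultimately show ?thesis
    using *(1,3,4) by (intro exI[of _ q] exI[of _ q']) simp
qed

lemma conversep: "field_rel R\<inverse>\<inverse>"
  by unfold_locales (auto intro: zero one add mult uminus inverse dest: zero_iff)

lemma rel_poly_conversep: "rel_poly R\<inverse>\<inverse> P Q \<longleftrightarrow> rel_poly R Q P"
  by (auto simp: rel_poly_def)

text \<open>For the way back from \<open>z\<close> to \<open>y\<close>, take the minimal polynomial
  \<open>n'\<close> of \<open>z\<close> over the range. It divides \<open>m'\<close>, so its
  counterpart \<open>n\<close> divides \<open>m\<close> with a cofactor of smaller degree. The
  cofactor cannot vanish at \<open>y\<close>, so \<open>n\<close> does, and \<open>n\<close> divides
  \<open>P\<close> whenever \<open>P'\<close> vanishes at \<open>z\<close>.\<close>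

lemma minpoly_root_iff:
  assumes m: "minpoly m m' y" "poly m' z = 0" and P: "rel_poly R P P'"
  shows "poly P y = 0 \<longleftrightarrow> poly P' z = 0"
proof
  assume "poly P y = 0"
  then obtain q' where "P' = m' * q'"
    using minpoly_dvd[OF m(1) P] by blast
  then show "poly P' z = 0"
    using m(2) by simp
next
  assume P'z: "poly P' z = 0"
  interpret conv: field_rel "R\<inverse>\<inverse>" by (rule conversep)
  note mD = minpolyD[OF m(1)]
  have m_conv: "rel_poly R\<inverse>\<inverse> m' m" "m' \<noteq> 0"
    using mD(1,2) rel_poly_zero_iff[OF mD(1)] by (simp_all add: rel_poly_conversep)
  obtain n n' where n: "conv.minpoly n' n z"
    using conv.minpoly_exists[OF m_conv m(2)] by blast
  note nD = conv.minpolyD[OF n]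
  obtain q q' where q: "m = n * q" "rel_poly R q q'"
    using conv.minpoly_dvd[OF n m_conv(1) m(2)] unfolding rel_poly_conversep by blast
  have nq0: "n \<noteq> 0" "q \<noteq> 0" using q(1) mD(2) by auto
  have "degree n \<noteq> 0"
  proof
    assume "degree n = 0"
    then have "degree n' = 0"
      using conv.rel_poly_degree[OF nD(1)] by simp
    then show False
      using nD(2,3) by (elim degree_eq_zeroE) simp
  qed
  then have "degree q < degree m"
    using nq0 by (simp add: q(1) degree_mult_eq)
  then have "poly q y \<noteq> 0"
    using mD(4)[OF q(2) nq0(2)] by auto
  then have "poly n y = 0"
    using mD(3) by (simp add: q(1))
  moreover have "rel_poly R\<inverse>\<inverse> P' P"
    using P by (simp add: rel_poly_conversep)
  then obtain r where "P = n * r"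
    using conv.minpoly_dvd[OF n _ P'z] by blast
  ultimately show "poly P y = 0" by simp
qed

text \<open>The extension pairs fractions of polynomial values at \<open>y\<close> and at
  \<open>z\<close>. Well-definedness and injectivity are both contained in the law
  \<open>zero_iff\<close>, which is what the hypothesis provides. Algebraic and transcendental
  \<open>y\<close> are treated alike.\<close>

lemma simple_extension:
  assumes "\<forall>P Q. rel_poly R P Q \<longrightarrow> (poly P y = 0 \<longleftrightarrow> poly Q z = 0)"
  obtains R' where "field_rel R'" "\<And>a b. R a b \<Longrightarrow> R' a b" "R' y z"
proof -
  have yz: "poly P y = 0 \<longleftrightarrow> poly Q z = 0" if "rel_poly R P Q" for P Q
    using assms that by blast
  interpret poly: ring_rel "rel_poly R" by (rule ring_rel_rel_poly)
  define R' where "R' a b \<longleftrightarrow> (\<exists>P Q P' Q'. rel_poly R P Q \<and> rel_poly R P' Q' \<and> poly P' y \<noteq> 0 \<and>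
      poly Q' z \<noteq> 0 \<and> a = poly P y / poly P' y \<and> b = poly Q z / poly Q' z)" for a b
  have R'I: "R' (poly P y / poly P' y) (poly Q z / poly Q' z)"
    if "rel_poly R P Q" "rel_poly R P' Q'" "poly P' y \<noteq> 0" for P Q P' Q'
    using that yz[OF that(2)] unfolding R'_def by blast
  have "field_rel R'"
  proof
    show "R' 0 0" using R'I[OF poly.zero poly.one] by simp
    show "R' 1 1" using R'I[OF poly.one poly.one] by simp
  next
    fix a b c d assume "R' a b" "R' c d"
    then obtain P Q P' Q' U V U' V' where
      1: "rel_poly R P Q" "rel_poly R P' Q'" "poly P' y \<noteq> 0" "poly Q' z \<noteq> 0"
        "a = poly P y / poly P' y" "b = poly Q z / poly Q' z" and
      2: "rel_poly R U V" "rel_poly R U' V'" "poly U' y \<noteq> 0" "poly V' z \<noteq> 0"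
        "c = poly U y / poly U' y" "d = poly V z / poly V' z"
      unfolding R'_def by metis
    have den: "rel_poly R (P' * U') (Q' * V')" "poly (P' * U') y \<noteq> 0"
      using 1(2,3) 2(2,3) by (auto intro: poly.mult)
    have "a + c = poly (P * U' + U * P') y / poly (P' * U') y"
      "b + d = poly (Q * V' + V * Q') z / poly (Q' * V') z"
      unfolding 1(5,6) 2(5,6) using 1(3,4) 2(3,4) by (simp_all add: add_frac_eq)
    then show "R' (a + c) (b + d)"
      using R'I[OF poly.add[OF poly.mult[OF 1(1) 2(2)] poly.mult[OF 2(1) 1(2)]] den] by (simp only:)
    have "a * c = poly (P * U) y / poly (P' * U') y" "b * d = poly (Q * V) z / poly (Q' * V') z"
      unfolding 1(5,6) 2(5,6) by simp_all
    then show "R' (a * c) (b * d)"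
      using R'I[OF poly.mult[OF 1(1) 2(1)] den] by (simp only:)
  next
    fix a b assume "R' a b"
    then obtain P Q P' Q' where
      1: "rel_poly R P Q" "rel_poly R P' Q'" "poly P' y \<noteq> 0" "poly Q' z \<noteq> 0"
      and ab: "a = poly P y / poly P' y" "b = poly Q z / poly Q' z"
      unfolding R'_def by metis
    show "R' (- a) (- b)"
      unfolding ab using R'I[OF poly.uminus[OF 1(1)] 1(2,3)] by simp
    show "a = 0 \<longleftrightarrow> b = 0"
      unfolding ab using yz[OF 1(1)] 1(3,4) by simp
    show "R' (inverse a) (inverse b)"
    proof (cases "poly P y = 0")
      case True
      then show ?thesis
        unfolding ab using yz[OF 1(1)] R'I[OF poly.zero poly.one] by simp
    next
      case False
      then show ?thesis
        unfolding ab using R'I[OF 1(2,1)] by simp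
    qed
  qed
  moreover have "R' a b" if "R a b" for a b
    using R'I[OF rel_poly_monom[OF that, of 0] poly.one] by (simp add: poly_monom)
  moreover have "R' y z"
    using R'I[OF rel_poly_monom[OF one, of 1] poly.one] by (simp add: poly_monom)
  ultimately show thesis by (rule that[of R'])
qed

end

section \<open>Automorphisms of the algebraic numbers\<close>

text \<open>A subfield is encoded as its diagonal relation, so that the facts about
  \<open>field_rel\<close> apply to it directly.\<close>

definition alg_closed_subfield :: "complex set \<Rightarrow> bool" where
  "alg_closed_subfield K \<longleftrightarrow> field_rel (\<lambda>a b. a = b \<and> a \<in> K) \<and>
     (\<forall>P z. P \<noteq> 0 \<longrightarrow> (\<forall>i. coeff P i \<in> K) \<longrightarrow> poly P z = 0 \<longrightarrow> z \<in> K)"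

lemma field_rel_subfield_iff:
  "field_rel (\<lambda>a b. a = b \<and> a \<in> K) \<longleftrightarrow>
     0 \<in> K \<and> 1 \<in> K \<and> (\<forall>a\<in>K. \<forall>b\<in>K. a + b \<in> K \<and> a * b \<in> K) \<and> (\<forall>a\<in>K. - a \<in> K \<and> inverse a \<in> K)"
  (is "_ = ?r")
proof
  assume "field_rel (\<lambda>a b. a = b \<and> a \<in> K)"
  then interpret field_rel "\<lambda>a b. a = b \<and> a \<in> K" .
  show ?r
    using zero one add mult uminus inverse by simp
next
  assume ?r
  then show "field_rel (\<lambda>a b. a = b \<and> a \<in> K)"
    by unfold_locales auto
qed

text \<open>The algebraic numbers, defined so that they are a subfield by construction.\<close>

definition qbar :: "complex set" where
  "qbar = \<Inter>{K. alg_closed_subfield K}"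

lemma qbar_subset: "alg_closed_subfield K \<Longrightarrow> qbar \<subseteq> K"
  by (auto simp: qbar_def)

lemma alg_closed_subfield_qbar: "alg_closed_subfield qbar"
  unfolding alg_closed_subfield_def field_rel_subfield_iff
proof (intro conjI allI impI ballI)
  fix P z assume *: "P \<noteq> 0" "\<forall>i. coeff P i \<in> qbar" "poly P z = 0"
  show "z \<in> qbar"
    unfolding qbar_def
  proof safe
    fix K assume K: "alg_closed_subfield K"
    with *(2) have "\<forall>i. coeff P i \<in> K" using qbar_subset by blast
    with K * show "z \<in> K" unfolding alg_closed_subfield_def by blast
  qed
qed (auto simp: qbar_def alg_closed_subfield_def field_rel_subfield_iff)

interpretation qbar: field_rel "\<lambda>a b. a = b \<and> a \<in> qbar"
  using alg_closed_subfield_qbar by (simp add: alg_closed_subfield_def)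

lemma qbar_add: "a \<in> qbar \<Longrightarrow> b \<in> qbar \<Longrightarrow> a + b \<in> qbar"
  using qbar.add by blast

lemma qbar_mult: "a \<in> qbar \<Longrightarrow> b \<in> qbar \<Longrightarrow> a * b \<in> qbar"
  using qbar.mult by blast

lemma qbar_uminus: "a \<in> qbar \<Longrightarrow> - a \<in> qbar"
  using qbar.uminus by blast

lemma qbar_inverse: "a \<in> qbar \<Longrightarrow> inverse a \<in> qbar"
  using qbar.inverse by blast

lemma qbar_root: "P \<noteq> 0 \<Longrightarrow> (\<And>i. coeff P i \<in> qbar) \<Longrightarrow> poly P z = 0 \<Longrightarrow> z \<in> qbar"
  using alg_closed_subfield_qbar unfolding alg_closed_subfield_def by blast

text \<open>An algebraic \<open>z\<close> outside the domain could be added: the fundamental theorem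
  of algebra gives a root \<open>w\<close> of the transported minimal polynomial, and sending
  \<open>z\<close> to \<open>w\<close> extends \<open>R\<close>.\<close>

lemma maximal_alg_closed_domain:
  fixes R :: "complex \<Rightarrow> complex \<Rightarrow> bool"
  assumes "field_rel R"
    and max: "\<And>R'. field_rel R' \<Longrightarrow> (\<And>a b. R a b \<Longrightarrow> R' a b) \<Longrightarrow> R' = R"
  shows "alg_closed_subfield {a. \<exists>b. R a b}"
  unfolding alg_closed_subfield_def field_rel_subfield_iff
proof (intro conjI allI impI)
  interpret field_rel R by fact
  show "0 \<in> {a. \<exists>b. R a b}" "1 \<in> {a. \<exists>b. R a b}"
    "\<forall>a\<in>{a. \<exists>b. R a b}. \<forall>b\<in>{a. \<exists>b. R a b}. a + b \<in> {a. \<exists>b. R a b} \<and> a * b \<in> {a. \<exists>b. R a b}"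
    "\<forall>a\<in>{a. \<exists>b. R a b}. - a \<in> {a. \<exists>b. R a b} \<and> inverse a \<in> {a. \<exists>b. R a b}"
    by (blast intro: zero one add mult uminus inverse)+
  fix P z assume P: "P \<noteq> 0" "\<forall>i. coeff P i \<in> {a. \<exists>b. R a b}" "poly P z = 0"
  define f where "f a = (THE b. R a b)" for a
  have f: "f a = b" if "R a b" for a b
    unfolding f_def using that right_unique by blast
  have "rel_poly R P (map_poly f P)"
    unfolding rel_poly_def using P(2) f zero by (auto simp: coeff_map_poly)
  then obtain m m' where m: "minpoly m m' z"
    using minpoly_exists P(1,3) by blast
  note mD = minpolyD[OF m]
  have "degree m \<noteq> 0"
  proof
    assume "degree m = 0"
    then show False
      using mD(2,3) by (elim degree_eq_zeroE) simp
  qed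
  then have "\<exists>w. poly m' w = 0"
    using rel_poly_degree[OF mD(1)] by (intro fundamental_theorem_of_algebra_alt) auto
  then obtain w where "poly m' w = 0" ..
  then obtain R' where R': "field_rel R'" "\<And>a b. R a b \<Longrightarrow> R' a b" "R' z w"
    using simple_extension[of z w] minpoly_root_iff[OF m] by blast
  then show "z \<in> {a. \<exists>b. R a b}"
    using max[OF R'(1,2)] by auto
qed

section \<open>Extending partial isomorphisms to automorphisms\<close>

lemma field_rel_Union_chain:
  assumes "\<C> \<noteq> {}" "subset.chain {G. field_rel (\<lambda>a b. (a, b) \<in> G)} \<C>"
  shows "field_rel (\<lambda>a b. (a, b) \<in> \<Union>\<C>)"
proof -
  have fr: "field_rel (\<lambda>a b. (a, b) \<in> G)" if "G \<in> \<C>" for G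
    using assms(2) that by (auto simp: subset.chain_def)
  have directed: "\<exists>G\<in>\<C>. s \<in> G \<and> t \<in> G" if "s \<in> \<Union>\<C>" "t \<in> \<Union>\<C>" for s t
  proof -
    from that obtain G H where GH: "G \<in> \<C>" "H \<in> \<C>" "s \<in> G" "t \<in> H"
      by blast
    then have "G \<subseteq> H \<or> H \<subseteq> G"
      using assms(2) unfolding subset_chain_def by blast
    then show ?thesis using GH by blast
  qed
  obtain G where G: "G \<in> \<C>" using assms(1) by blast
  show ?thesis
  proof
    show "(0, 0) \<in> \<Union>\<C>" "(1, 1) \<in> \<Union>\<C>"
      using G ring_rel.zero ring_rel.one field_rel.axioms(1)[OF fr[OF G]] by blast+
  next
    fix a b c d assume "(a, b) \<in> \<Union>\<C>" "(c, d) \<in> \<Union>\<C>"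
    then obtain H where H: "H \<in> \<C>" "(a, b) \<in> H" "(c, d) \<in> H"
      using directed by blast
    interpret field_rel "\<lambda>a b. (a, b) \<in> H" using fr[OF H(1)] .
    show "(a + c, b + d) \<in> \<Union>\<C>" "(a * c, b * d) \<in> \<Union>\<C>"
      using H add mult by blast+
  next
    fix a b assume "(a, b) \<in> \<Union>\<C>"
    then obtain H where H: "H \<in> \<C>" "(a, b) \<in> H" by blast
    interpret field_rel "\<lambda>a b. (a, b) \<in> H" using fr[OF H(1)] .
    show "(- a, - b) \<in> \<Union>\<C>" "(inverse a, inverse b) \<in> \<Union>\<C>" "a = 0 \<longleftrightarrow> b = 0"
      using H uminus inverse zero_iff by blast+
  qed
qed

lemma maximal_field_rel:
  assumes "field_rel R"
  obtains S where "field_rel S" "\<And>a b. R a b \<Longrightarrow> S a b"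
    "\<And>S'. field_rel S' \<Longrightarrow> (\<And>a b. S a b \<Longrightarrow> S' a b) \<Longrightarrow> S' = S"
proof -
  define \<A> where "\<A> = {G. field_rel (\<lambda>a b. (a, b) \<in> G) \<and> {(a, b). R a b} \<subseteq> G}"
  have "\<exists>M\<in>\<A>. \<forall>X\<in>\<A>. M \<subseteq> X \<longrightarrow> X = M"
  proof (rule subset_Zorn_nonempty)
    have "{(a, b). R a b} \<in> \<A>" using assms by (simp add: \<A>_def)
    then show "\<A> \<noteq> {}" by blast
  next
    fix \<C> assume \<C>: "\<C> \<noteq> {}" "subset.chain \<A> \<C>"
    then have "subset.chain {G. field_rel (\<lambda>a b. (a, b) \<in> G)} \<C>"
      unfolding subset_chain_def \<A>_def by blast
    then have "field_rel (\<lambda>a b. (a, b) \<in> \<Union>\<C>)"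
      using \<C>(1) field_rel_Union_chain by blast
    moreover have "{(a, b). R a b} \<subseteq> \<Union>\<C>"
      using \<C> unfolding subset_chain_def \<A>_def by blast
    ultimately show "\<Union>\<C> \<in> \<A>" by (simp add: \<A>_def)
  qed
  then obtain M where M: "M \<in> \<A>" "\<And>X. X \<in> \<A> \<Longrightarrow> M \<subseteq> X \<Longrightarrow> X = M" by blast
  show thesis
  proof (rule that[of "\<lambda>a b. (a, b) \<in> M"])
    fix S' assume S': "field_rel S'" "\<And>a b. (a, b) \<in> M \<Longrightarrow> S' a b"
    have "{(a, b). S' a b} = M"
      using S' M(1) by (intro M(2)) (auto simp: \<A>_def)
    then show "S' = (\<lambda>a b. (a, b) \<in> M)" by auto
  qed (use M(1) in \<open>auto simp: \<A>_def\<close>)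
qed

text \<open>Values outside \<open>qbar\<close> are arbitrary, so identities between automorphisms
  are only claimed on \<open>qbar\<close>.\<close>

definition qbar_aut :: "(complex \<Rightarrow> complex) \<Rightarrow> bool" where
  "qbar_aut \<gamma> \<longleftrightarrow> bij_betw \<gamma> qbar qbar \<and>
     (\<forall>a\<in>qbar. \<forall>b\<in>qbar. \<gamma> (a + b) = \<gamma> a + \<gamma> b \<and> \<gamma> (a * b) = \<gamma> a * \<gamma> b)"

text \<open>Since \<open>qbar\<close> is the smallest algebraically closed subfield, it lies in this
  preimage; this is how \<open>R\<close> is seen to map \<open>qbar\<close> into itself.\<close>

lemma qbar_preimage_alg_closed:
  assumes "field_rel R" "alg_closed_subfield {a. \<exists>b. R a b}"
  shows "alg_closed_subfield {a. \<exists>b. R a b \<and> b \<in> qbar}"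
  unfolding alg_closed_subfield_def field_rel_subfield_iff
proof (intro conjI allI impI)
  interpret field_rel R by fact
  let ?K = "{a. \<exists>b. R a b \<and> b \<in> qbar}"
  show "0 \<in> ?K" using zero qbar.zero by blast
  show "1 \<in> ?K" using one qbar.one by blast
  show "\<forall>a\<in>?K. \<forall>b\<in>?K. a + b \<in> ?K \<and> a * b \<in> ?K"
    using add mult qbar_add qbar_mult by (simp, meson)
  show "\<forall>a\<in>?K. - a \<in> ?K \<and> inverse a \<in> ?K"
    using uminus inverse qbar_uminus qbar_inverse by (simp, meson)
  fix P z assume P: "P \<noteq> 0" "\<forall>i. coeff P i \<in> ?K" "poly P z = 0"
  define f where "f a = (THE b. R a b)" for a
  have f: "f a = b" if "R a b" for a b
    unfolding f_def using that right_unique by blast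
  define Q where "Q = map_poly f P"
  have coeff_Q: "coeff Q i = f (coeff P i)" for i
    unfolding Q_def using f zero by (simp add: coeff_map_poly)
  have Q: "rel_poly R P Q" "\<And>i. coeff Q i \<in> qbar"
    unfolding rel_poly_def coeff_Q using P(2) f by fastforce+
  have "z \<in> {a. \<exists>b. R a b}"
    using assms(2) P unfolding alg_closed_subfield_def by blast
  then obtain w where w: "R z w" by blast
  have "poly Q w = 0"
    using zero_iff[OF poly_rel[OF Q(1) w]] P(3) by simp
  then have "w \<in> qbar"
    using qbar_root Q(2) rel_poly_zero_iff[OF Q(1)] P(1) by blast
  then show "z \<in> ?K" using w by blast
qed

text \<open>A maximal extension has an algebraically closed domain, hence is defined on
  \<open>qbar\<close> and maps it into \<open>qbar\<close>. Maximality passes to the converse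
  relation, for which the same argument yields surjectivity.\<close>

lemma field_rel_extends_to_qbar_aut:
  assumes "field_rel R"
  obtains \<gamma> where "qbar_aut \<gamma>" "\<And>a b. R a b \<Longrightarrow> a \<in> qbar \<Longrightarrow> \<gamma> a = b"
proof -
  obtain S where S: "field_rel S" "\<And>a b. R a b \<Longrightarrow> S a b"
    "\<And>S'. field_rel S' \<Longrightarrow> (\<And>a b. S a b \<Longrightarrow> S' a b) \<Longrightarrow> S' = S"
    using maximal_field_rel[OF assms] by blast
  interpret field_rel S by (rule S(1))
  have dom: "\<exists>b. S a b \<and> b \<in> qbar" if "a \<in> qbar" for a
    using qbar_subset[OF qbar_preimage_alg_closed[OF S(1) maximal_alg_closed_domain[OF S(1,3)]]] that
    by blast
  have "S' = S\<inverse>\<inverse>" if "field_rel S'" "\<And>a b. S\<inverse>\<inverse> a b \<Longrightarrow> S' a b" for S'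
    using S(3)[of "S'\<inverse>\<inverse>"] field_rel.conversep[OF that(1)] that(2) by (auto simp: fun_eq_iff)
  from qbar_subset[OF qbar_preimage_alg_closed[OF conversep maximal_alg_closed_domain[OF conversep this]]]
  have ran: "\<exists>a. S a b \<and> a \<in> qbar" if "b \<in> qbar" for b
    using that by auto
  define \<gamma> where "\<gamma> a = (THE b. S a b)" for a
  have \<gamma>: "\<gamma> a = b" if "S a b" for a b
    unfolding \<gamma>_def using that right_unique by blast
  have S\<gamma>: "S a (\<gamma> a)" "\<gamma> a \<in> qbar" if "a \<in> qbar" for a
    using dom[OF that] \<gamma> by auto
  have "qbar_aut \<gamma>"
    unfolding qbar_aut_def bij_betw_def
  proof (intro conjI ballI)
    show "inj_on \<gamma> qbar"
      by (rule inj_onI) (metis S\<gamma>(1) left_unique)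
    have "b \<in> \<gamma> ` qbar" if "b \<in> qbar" for b
      using ran[OF that] \<gamma> by blast
    then show "\<gamma> ` qbar = qbar"
      using S\<gamma>(2) by blast
    fix a b assume "a \<in> qbar" "b \<in> qbar"
    then show "\<gamma> (a + b) = \<gamma> a + \<gamma> b" "\<gamma> (a * b) = \<gamma> a * \<gamma> b"
      using S\<gamma>(1) by (intro \<gamma> add mult; simp)+
  qed
  then show thesis
    using S(2) \<gamma> by (intro that) blast+
qed

section \<open>The fixed field\<close>

lemma Rats_field_rel: "field_rel (\<lambda>a b. a = b \<and> a \<in> (\<rat> :: 'a::field_char_0 set))"
  unfolding field_rel_def field_rel_axioms_def ring_rel_def by auto

text \<open>An irrational \<open>y\<close> has a second possible image \<open>z\<close>:
  \<open>y + 1\<close> if it is transcendental, another root of its minimal polynomial if it is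
  algebraic. The isomorphism that sends \<open>y\<close> to \<open>z\<close> extends to an
  automorphism moving \<open>y\<close>.\<close>

lemma fixed_field_Rats:
  assumes "y \<in> qbar" and fixed: "\<And>\<gamma>. qbar_aut \<gamma> \<Longrightarrow> \<gamma> y = y"
  shows "y \<in> \<rat>"
proof (rule ccontr)
  assume y: "y \<notin> \<rat>"
  define Q where "Q = (\<lambda>a b. a = b \<and> a \<in> (\<rat> :: complex set))"
  interpret field_rel Q unfolding Q_def by (rule Rats_field_rel)
  have rel_Q: "rel_poly Q P P' \<longleftrightarrow> P = P' \<and> (\<forall>i. coeff P i \<in> \<rat>)" for P P'
    by (auto simp: rel_poly_def Q_def poly_eq_iff)
  have "\<exists>z. z \<noteq> y \<and> (\<forall>P P'. rel_poly Q P P' \<longrightarrow> (poly P y = 0 \<longleftrightarrow> poly P' z = 0))"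
  proof (cases "\<exists>P P'. rel_poly Q P P' \<and> P \<noteq> 0 \<and> poly P y = 0")
    case False
    \<comment> \<open>the algebraicity of the elements of \<open>qbar\<close> is not available, so \<open>y\<close> may be transcendental\<close>
    have "poly P y = 0 \<longleftrightarrow> poly P' (y + 1) = 0" if P: "rel_poly Q P P'" for P P'
    proof -
      have eq: "P' = P" and "\<forall>i. coeff P i \<in> \<rat>" using P by (auto simp: rel_Q)
      interpret poly: ring_rel "rel_poly Q" by (rule ring_rel_rel_poly)
      have "rel_poly Q (pcompose P [:1, 1:]) (pcompose P [:1, 1:])"
        using \<open>\<forall>i. coeff P i \<in> \<rat>\<close>
      proof (induction P)
        case 0
        show ?case using poly.zero by simp
      next
        case (pCons a P)
        have "a \<in> \<rat>" "\<forall>i. coeff P i \<in> \<rat>"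
          using pCons.prems by (metis coeff_pCons_0, metis coeff_pCons_Suc)
        then show ?case
          unfolding pcompose_pCons
          by (intro poly.add poly.mult rel_poly_pCons one pCons.IH poly.zero) (auto simp: Q_def)
      qed
      moreover have "pcompose P [:1, 1:] = 0 \<longleftrightarrow> P = 0"
        by (rule pcompose_eq_0_iff) simp
      moreover have "poly P' (y + 1) = poly (pcompose P [:1, 1:]) y"
        by (simp add: poly_pcompose eq add.commute)
      ultimately show ?thesis
        using False P eq by (metis poly_0)
    qed
    then show ?thesis by (intro exI[of _ "y + 1"]) auto
  next
    case True
    then obtain m m' where m: "minpoly m m' y"
      using minpoly_exists by blast
    note mD = minpolyD[OF m]
    have mm: "rel_poly Q m m" and [simp]: "m' = m"
      using mD(1) by (auto simp: rel_Q)
    obtain h where h: "m = [:- y, 1:] * h"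
      using mD(3) by (auto simp: poly_eq_0_iff_dvd)
    have h0: "h \<noteq> 0" using mD(2) h by auto
    have deg: "degree m = Suc (degree h)"
      using h0 by (simp add: h degree_mult_eq del: mult_pCons_left)
    have "degree h \<noteq> 0"
    proof
      assume "degree h = 0"
      then obtain c where c: "h = [:c:]" "c \<noteq> 0" using h0 by (auto elim!: degree_eq_zeroE)
      have "coeff m 0 \<in> \<rat>" "coeff m 1 \<in> \<rat>" using mm by (auto simp: rel_Q)
      then have "y * c \<in> \<rat>" "c \<in> \<rat>" by (auto simp: h c(1) mult.commute)
      then have "y * c / c \<in> \<rat>" by (rule Rats_divide)
      then show False using y c(2) by simp
    qed
    then have "\<exists>z. poly h z = 0"
      by (intro fundamental_theorem_of_algebra_alt) auto
    then obtain z where z: "poly h z = 0" ..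
    \<comment> \<open>The derivative has smaller degree than the minimal polynomial, so
      \<open>y\<close> is a simple root and the root \<open>z\<close> of the cofactor differs from
      it.\<close>
    have "poly (pderiv m) y \<noteq> 0"
    proof
      assume "poly (pderiv m) y = 0"
      moreover have "rel_poly Q (pderiv m) (pderiv m)"
        using mm by (auto simp: rel_Q coeff_pderiv)
      moreover have "pderiv m \<noteq> 0" using deg by (auto simp: pderiv_eq_0_iff)
      ultimately show False
        using mD(4)[of "pderiv m" "pderiv m"] deg by (simp add: degree_pderiv)
    qed
    moreover have "poly (pderiv m) y = poly h y"
      by (simp add: h pderiv_mult pderiv_pCons del: mult_pCons_left)
    ultimately have "z \<noteq> y" using z by auto
    moreover have "poly m z = 0" using z h by simp
    ultimately show ?thesis
      using minpoly_root_iff[OF m] by (intro exI[of _ z]) simp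
  qed
  then obtain z where z: "z \<noteq> y" "\<forall>P P'. rel_poly Q P P' \<longrightarrow> (poly P y = 0 \<longleftrightarrow> poly P' z = 0)"
    by blast
  obtain R where R: "field_rel R" "R y z"
    using simple_extension[OF z(2)] by blast
  show False
    using field_rel_extends_to_qbar_aut[OF R(1)] fixed R(2) assms(1) z(1) by metis
qed

section \<open>Computing with automorphisms\<close>

lemma qbar_autD:
  assumes "qbar_aut \<gamma>"
  shows "a \<in> qbar \<Longrightarrow> \<gamma> a \<in> qbar"
    and "a \<in> qbar \<Longrightarrow> b \<in> qbar \<Longrightarrow> \<gamma> (a + b) = \<gamma> a + \<gamma> b"
    and "a \<in> qbar \<Longrightarrow> b \<in> qbar \<Longrightarrow> \<gamma> (a * b) = \<gamma> a * \<gamma> b"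
    and "a \<in> qbar \<Longrightarrow> b \<in> qbar \<Longrightarrow> \<gamma> a = \<gamma> b \<longleftrightarrow> a = b"
    and "b \<in> qbar \<Longrightarrow> \<exists>a\<in>qbar. \<gamma> a = b"
proof -
  have bij: "bij_betw \<gamma> qbar qbar" and
    hom: "\<forall>a\<in>qbar. \<forall>b\<in>qbar. \<gamma> (a + b) = \<gamma> a + \<gamma> b \<and> \<gamma> (a * b) = \<gamma> a * \<gamma> b"
    using assms by (simp_all add: qbar_aut_def)
  show "a \<in> qbar \<Longrightarrow> \<gamma> a \<in> qbar"
    using bij by (rule bij_betwE[rule_format])
  show "a \<in> qbar \<Longrightarrow> b \<in> qbar \<Longrightarrow> \<gamma> (a + b) = \<gamma> a + \<gamma> b"
    "a \<in> qbar \<Longrightarrow> b \<in> qbar \<Longrightarrow> \<gamma> (a * b) = \<gamma> a * \<gamma> b"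
    using hom by simp_all
  show "a \<in> qbar \<Longrightarrow> b \<in> qbar \<Longrightarrow> \<gamma> a = \<gamma> b \<longleftrightarrow> a = b"
    using bij by (meson bij_betw_imp_inj_on inj_on_eq_iff)
  show "b \<in> qbar \<Longrightarrow> \<exists>a\<in>qbar. \<gamma> a = b"
    using bij_betw_imp_surj_on[OF bij] by (metis imageE)
qed

lemma qbar_aut_field_rel:
  assumes "qbar_aut \<gamma>"
  shows "field_rel (\<lambda>a b. a \<in> qbar \<and> b = \<gamma> a)"
proof -
  note g = qbar_autD[OF assms]
  have 0: "\<gamma> 0 = 0"
    using g(2)[of 0 0] qbar.zero by simp
  have "\<gamma> 1 \<noteq> 0"
    using g(4)[of 1 0] qbar.zero qbar.one 0 by simp
  then have 1: "\<gamma> 1 = 1"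
    using g(3)[of 1 1] qbar.one by simp
  show ?thesis
  proof
    fix a b assume a: "a \<in> qbar \<and> b = \<gamma> a"
    show "- a \<in> qbar \<and> - b = \<gamma> (- a)"
      using a g(2)[of a "- a"] 0 by (simp add: qbar_uminus minus_unique)
    show "a = 0 \<longleftrightarrow> b = 0"
      using a g(4)[of a 0] 0 qbar.zero by simp
    then show "inverse a \<in> qbar \<and> inverse b = \<gamma> (inverse a)"
      using a g(3)[of a "inverse a"] 0 1 qbar_inverse[of a]
      by (cases "a = 0") (auto intro: inverse_unique)
  qed (use 0 1 g(2,3) qbar.zero qbar.one qbar_add qbar_mult in auto)
qed

lemma qbar_aut_of_int: "qbar_aut \<gamma> \<Longrightarrow> \<gamma> (of_int c) = of_int c"
  using ring_rel.of_int[OF field_rel.axioms(1)[OF qbar_aut_field_rel]] by metis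

lemma qbar_aut_power: "qbar_aut \<gamma> \<Longrightarrow> a \<in> qbar \<Longrightarrow> \<gamma> (a ^ n) = \<gamma> a ^ n"
  using ring_rel.power[OF field_rel.axioms(1)[OF qbar_aut_field_rel], of \<gamma> a "\<gamma> a" n] by auto

lemma qbar_diff: "a \<in> qbar \<Longrightarrow> b \<in> qbar \<Longrightarrow> a - b \<in> qbar"
  using qbar.diff by blast

lemma qbar_power: "a \<in> qbar \<Longrightarrow> a ^ n \<in> qbar"
  using qbar.power by blast

lemma qbar_aut_comp: "qbar_aut \<gamma> \<Longrightarrow> qbar_aut \<delta> \<Longrightarrow> qbar_aut (\<gamma> \<circ> \<delta>)"
  unfolding qbar_aut_def by (auto intro: bij_betw_trans dest: bij_betwE)

lemma qbar_aut_inv: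
  assumes "qbar_aut \<gamma>"
  shows "qbar_aut (inv_into qbar \<gamma>)"
proof -
  note g = qbar_autD[OF assms]
  have bij: "bij_betw \<gamma> qbar qbar" using assms by (simp add: qbar_aut_def)
  have inv: "inv_into qbar \<gamma> (\<gamma> a) = a" if "a \<in> qbar" for a
    using that bij by (simp add: bij_betw_inv_into_left)
  show ?thesis
    unfolding qbar_aut_def
  proof (intro conjI ballI)
    show "bij_betw (inv_into qbar \<gamma>) qbar qbar"
      using bij by (rule bij_betw_inv_into)
    fix a b assume "a \<in> qbar" "b \<in> qbar"
    then obtain c d where cd: "c \<in> qbar" "d \<in> qbar" "a = \<gamma> c" "b = \<gamma> d"
      using g(5) by metis
    show "inv_into qbar \<gamma> (a + b) = inv_into qbar \<gamma> a + inv_into qbar \<gamma> b"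
      unfolding cd(3,4) g(2)[OF cd(1,2), symmetric] using cd(1,2) by (simp add: inv qbar_add)
    show "inv_into qbar \<gamma> (a * b) = inv_into qbar \<gamma> a * inv_into qbar \<gamma> b"
      unfolding cd(3,4) g(3)[OF cd(1,2), symmetric] using cd(1,2) by (simp add: inv qbar_mult)
  qed
qed

text \<open>The preimage of \<open>qbar\<close> under conjugation is an algebraically closed
  subfield, so it contains the smallest one.\<close>

lemma cnj_qbar: "z \<in> qbar \<Longrightarrow> cnj z \<in> qbar"
proof -
  have "alg_closed_subfield {z. cnj z \<in> qbar}"
    unfolding alg_closed_subfield_def field_rel_subfield_iff
  proof (intro conjI allI impI)
    let ?K = "{z. cnj z \<in> qbar}"
    show "0 \<in> ?K" "1 \<in> ?K"
      using qbar.zero qbar.one by simp_all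
    show "\<forall>a\<in>?K. \<forall>b\<in>?K. a + b \<in> ?K \<and> a * b \<in> ?K"
      using qbar_add qbar_mult by simp
    show "\<forall>a\<in>?K. - a \<in> ?K \<and> inverse a \<in> ?K"
      using qbar_uminus qbar_inverse by simp
    fix P z assume *: "P \<noteq> 0" "\<forall>i. coeff P i \<in> ?K" "poly P z = 0"
    have "cnj z \<in> qbar"
    proof (rule qbar_root)
      show "map_poly cnj P \<noteq> 0"
        using *(1) by (simp add: map_poly_eq_0_iff)
      show "coeff (map_poly cnj P) i \<in> qbar" for i
        using *(2) by (simp add: coeff_map_poly)
      show "poly (map_poly cnj P) (cnj z) = 0"
        using poly_cnj[of P z] *(3) by simp
    qed
    then show "z \<in> ?K" by simp
  qed
  then show "z \<in> qbar \<Longrightarrow> cnj z \<in> qbar"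
    using qbar_subset by blast
qed

lemma qbar_aut_cnj_conjugate:
  assumes "qbar_aut \<gamma>"
  shows "qbar_aut (cnj \<circ> \<gamma> \<circ> cnj)"
proof -
  have "bij_betw cnj qbar qbar"
    by (rule bij_betw_byWitness[where f' = cnj]) (auto intro: cnj_qbar)
  then have "qbar_aut cnj" by (simp add: qbar_aut_def)
  then show ?thesis using assms by (intro qbar_aut_comp)
qed

section \<open>Radical numbers\<close>

text \<open>Iterated sets of commutators; \<open>\<kappa> \<circ> \<delta> \<circ> \<gamma> = \<gamma> \<circ> \<delta>\<close> says that \<open>\<kappa>\<close> is the commutator of
  \<open>\<gamma>\<close> and \<open>\<delta>\<close>. No subgroup is generated: the commutators themselves suffice on both sides
  of the argument.\<close>

primrec derived_auts :: "nat \<Rightarrow> (complex \<Rightarrow> complex) set" where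
  "derived_auts 0 = {\<gamma>. qbar_aut \<gamma>}"
| "derived_auts (Suc n) = {\<kappa>. qbar_aut \<kappa> \<and>
     (\<exists>\<gamma>\<in>derived_auts n. \<exists>\<delta>\<in>derived_auts n. \<forall>a\<in>qbar. \<kappa> (\<delta> (\<gamma> a)) = \<gamma> (\<delta> a))}"

lemma derived_auts_qbar_aut: "\<kappa> \<in> derived_auts n \<Longrightarrow> qbar_aut \<kappa>"
  by (cases n) auto

lemma derived_auts_Suc_subset: "derived_auts (Suc n) \<subseteq> derived_auts n"
proof (induction n)
  case (Suc n)
  show ?case
  proof
    fix \<kappa> assume "\<kappa> \<in> derived_auts (Suc (Suc n))"
    then obtain \<gamma> \<delta> where "qbar_aut \<kappa>" "\<gamma> \<in> derived_auts (Suc n)" "\<delta> \<in> derived_auts (Suc n)"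
      "\<forall>a\<in>qbar. \<kappa> (\<delta> (\<gamma> a)) = \<gamma> (\<delta> a)"
      unfolding derived_auts.simps(2)[of "Suc n"] by blast
    with Suc.IH show "\<kappa> \<in> derived_auts (Suc n)"
      unfolding derived_auts.simps(2)[of n] by blast
  qed
qed auto

lemma derived_auts_antimono: "m \<le> n \<Longrightarrow> derived_auts n \<subseteq> derived_auts m"
  using lift_Suc_antimono_le[of derived_auts] derived_auts_Suc_subset by blast

text \<open>Handles conjugation nodes: \<open>\<kappa>\<close> fixes \<open>cnj z\<close> exactly if
  its conjugate by \<open>cnj\<close> fixes \<open>z\<close>.\<close>

lemma derived_auts_cnj: "\<kappa> \<in> derived_auts n \<Longrightarrow> cnj \<circ> \<kappa> \<circ> cnj \<in> derived_auts n"
proof (induction n arbitrary: \<kappa>)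
  case 0
  then show ?case
    unfolding derived_auts.simps(1) using qbar_aut_cnj_conjugate by blast
next
  case (Suc n)
  then obtain \<gamma> \<delta> where *: "qbar_aut \<kappa>" "\<gamma> \<in> derived_auts n" "\<delta> \<in> derived_auts n"
    "\<forall>a\<in>qbar. \<kappa> (\<delta> (\<gamma> a)) = \<gamma> (\<delta> a)"
    by auto
  have "\<forall>a\<in>qbar. (cnj \<circ> \<kappa> \<circ> cnj) ((cnj \<circ> \<delta> \<circ> cnj) ((cnj \<circ> \<gamma> \<circ> cnj) a)) =
      (cnj \<circ> \<gamma> \<circ> cnj) ((cnj \<circ> \<delta> \<circ> cnj) a)"
    using *(4) cnj_qbar by simp
  then show ?case
    unfolding derived_auts.simps(2) mem_Collect_eq
    by (intro conjI qbar_aut_cnj_conjugate[OF *(1)] bexI[OF _ Suc.IH[OF *(2)]]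
        bexI[OF _ Suc.IH[OF *(3)]])
qed

section \<open>Roots of unity\<close>

lemma qbar_nth_root:
  assumes "z ^ k = v" "0 < k" "v \<in> qbar"
  shows "z \<in> qbar"
proof (rule qbar_root)
  have "coeff (monom 1 k - [:v:]) k = 1"
    using assms(2) by (cases k) auto
  then show "monom 1 k - [:v:] \<noteq> 0" by (metis coeff_0 zero_neq_one)
  have "coeff (monom 1 k) i \<in> qbar" "coeff [:v:] i \<in> qbar" for i
    using assms(3) qbar.zero qbar.one by (auto simp: coeff_pCons split: nat.splits)
  then show "coeff (monom 1 k - [:v:]) i \<in> qbar" for i
    using qbar_diff by simp
  show "poly (monom 1 k - [:v:]) z = 0"
    using assms(1) by (simp add: poly_monom)
qed

lemma root_of_unity_primitive_power:
  assumes "(w :: complex) ^ k = 1" "0 < k"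
  shows "\<exists>j. w = cis (2 * pi / real k) ^ j"
proof -
  have "w \<in> (\<lambda>j. cis (2 * pi * real j / real k)) ` {..<k}"
    using bij_betw_roots_unity[OF assms(2)] assms(1) unfolding bij_betw_def by blast
  then show ?thesis
    by (auto simp: DeMoivre mult_ac)
qed

text \<open>Automorphisms act on the k-th roots of unity by raising to powers, so
  \<open>\<gamma>\<close> and \<open>\<delta>\<close> commute there. The commutator equation is
  evaluated at the preimage \<open>w\<close> of \<open>t\<close> under
  \<open>\<delta> \<circ> \<gamma>\<close>, which is again a k-th root of unity.\<close>

lemma derived_auts_fix_roots_of_unity:
  assumes "\<kappa> \<in> derived_auts (Suc 0)" "t ^ k = 1" "0 < k"
  shows "\<kappa> t = t"
proof -
  obtain \<gamma> \<delta> where *: "qbar_aut \<gamma>" "qbar_aut \<delta>" "\<forall>a\<in>qbar. \<kappa> (\<delta> (\<gamma> a)) = \<gamma> (\<delta> a)"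
    using assms(1) by auto
  define \<omega> where "\<omega> = cis (2 * pi / real k)"
  have unity_qbar: "w \<in> qbar" if "w ^ k = 1" for w
    using qbar_nth_root[OF that assms(3)] qbar.one by simp
  have aut_unity: "\<alpha> w ^ k = 1" if "qbar_aut \<alpha>" "w ^ k = 1" for \<alpha> w
    using qbar_aut_power[OF that(1) unity_qbar[OF that(2)], of k] that qbar_aut_of_int[of \<alpha> 1] by simp
  have "\<omega> ^ k = 1"
    using assms(3) by (simp add: \<omega>_def DeMoivre)
  then have \<omega>: "\<omega> \<in> qbar" "\<gamma> \<omega> ^ k = 1" "\<delta> \<omega> ^ k = 1"
    using unity_qbar aut_unity * by auto
  obtain i j where ij: "\<gamma> \<omega> = \<omega> ^ i" "\<delta> \<omega> = \<omega> ^ j"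
    using root_of_unity_primitive_power[OF \<omega>(2) assms(3)]
      root_of_unity_primitive_power[OF \<omega>(3) assms(3)] unfolding \<omega>_def by blast
  have commute: "\<delta> (\<gamma> w) = \<gamma> (\<delta> w)" if "w ^ k = 1" for w
  proof -
    from that obtain l where "w = \<omega> ^ l"
      using root_of_unity_primitive_power[OF _ assms(3)] unfolding \<omega>_def by blast
    then show ?thesis
      using * \<omega>(1) by (simp add: qbar_aut_power qbar_power ij flip: power_mult)
        (simp add: mult_ac)
  qed
  have "qbar_aut (\<delta> \<circ> \<gamma>)" using * by (intro qbar_aut_comp)
  note dg = this qbar_autD(4,5)[OF this]
  obtain w where w: "w \<in> qbar" "\<delta> (\<gamma> w) = t"
    using dg(3)[OF unity_qbar[OF assms(2)]] by auto
  have "(\<delta> \<circ> \<gamma>) (w ^ k) = (\<delta> \<circ> \<gamma>) 1"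
    using qbar_aut_power[OF dg(1) w(1), of k] w(2) assms(2) qbar_aut_of_int[OF dg(1), of 1] by simp
  then have "w ^ k = 1"
    using dg(2)[OF qbar_power[OF w(1)], of 1] qbar.one by simp
  then have "\<delta> (\<gamma> w) = \<gamma> (\<delta> w)" by (rule commute)
  moreover have "\<kappa> (\<delta> (\<gamma> w)) = \<gamma> (\<delta> w)"
    using *(3) w(1) by blast
  ultimately show ?thesis using w(2) by metis
qed

text \<open>An invariant rather than expressibility by radicals: only the implication from values of
  radical trees to this property is established.\<close>

definition radical_number :: "complex \<Rightarrow> bool" where
  "radical_number z \<longleftrightarrow> z \<in> qbar \<and> (\<exists>n. \<forall>\<kappa>\<in>derived_auts n. \<kappa> z = z)"

lemma radical_number_level:
  assumes "radical_number z"
  obtains n where "\<And>m \<kappa>. n \<le> m \<Longrightarrow> \<kappa> \<in> derived_auts m \<Longrightarrow> \<kappa> z = z"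
  using assms derived_auts_antimono unfolding radical_number_def by blast

lemma radical_number_of_int: "radical_number (of_int c)"
  using qbar.of_int[of c] qbar_aut_of_int unfolding radical_number_def
  by (intro conjI exI[of _ 0]) auto

lemma radical_number_op:
  assumes "radical_number a" "radical_number b" "f a b \<in> qbar"
    and f: "\<And>\<kappa>. qbar_aut \<kappa> \<Longrightarrow> \<kappa> (f a b) = f (\<kappa> a) (\<kappa> b)"
  shows "radical_number (f a b)"
proof -
  obtain m where m: "\<And>l \<kappa>. m \<le> l \<Longrightarrow> \<kappa> \<in> derived_auts l \<Longrightarrow> \<kappa> a = a"
    using radical_number_level[OF assms(1)] by blast
  obtain n where n: "\<And>l \<kappa>. n \<le> l \<Longrightarrow> \<kappa> \<in> derived_auts l \<Longrightarrow> \<kappa> b = b"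
    using radical_number_level[OF assms(2)] by blast
  have "\<kappa> (f a b) = f a b" if "\<kappa> \<in> derived_auts (max m n)" for \<kappa>
    using f[OF derived_auts_qbar_aut[OF that]] m[OF _ that] n[OF _ that] by simp
  then show ?thesis
    using assms(3) unfolding radical_number_def by blast
qed

lemma
  assumes "radical_number a" "radical_number b"
  shows radical_number_add: "radical_number (a + b)"
    and radical_number_diff: "radical_number (a - b)"
    and radical_number_mult: "radical_number (a * b)"
    and radical_number_divide: "radical_number (a / b)"
proof -
  have ab: "a \<in> qbar" "b \<in> qbar" using assms by (auto simp: radical_number_def)
  have rel: "field_rel (\<lambda>a b. a \<in> qbar \<and> b = \<gamma> a)" if "qbar_aut \<gamma>" for \<gamma>
    using that by (rule qbar_aut_field_rel)
  show "radical_number (a + b)"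
    by (rule radical_number_op[OF assms, of "(+)"]) (use ab qbar_add qbar_autD(2) in auto)
  show "radical_number (a * b)"
    by (rule radical_number_op[OF assms, of "(*)"]) (use ab qbar_mult qbar_autD(3) in auto)
  have "\<gamma> (a - b) = \<gamma> a - \<gamma> b" "\<gamma> (a / b) = \<gamma> a / \<gamma> b" if "qbar_aut \<gamma>" for \<gamma>
    using ring_rel.diff[OF field_rel.axioms(1)[OF rel[OF that]], of a "\<gamma> a" b "\<gamma> b"]
      field_rel.divide[OF rel[OF that], of a "\<gamma> a" b "\<gamma> b"] ab by auto
  moreover have "a - b \<in> qbar" "a / b \<in> qbar"
    using qbar.diff[of a a b b] qbar.divide[of a a b b] ab by auto
  ultimately show "radical_number (a - b)" "radical_number (a / b)"
    using radical_number_op[OF assms, of "(-)"] radical_number_op[OF assms, of "(/)"] by blast+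
qed

lemma radical_number_cnj:
  assumes "radical_number z"
  shows "radical_number (cnj z)"
proof -
  obtain n where n: "\<forall>\<kappa>\<in>derived_auts n. \<kappa> z = z" and z: "z \<in> qbar"
    using assms by (auto simp: radical_number_def)
  have "\<kappa> (cnj z) = cnj z" if "\<kappa> \<in> derived_auts n" for \<kappa>
    using n derived_auts_cnj[OF that] by (metis comp_apply complex_cnj_cnj)
  then show ?thesis
    using cnj_qbar[OF z] by (auto simp: radical_number_def)
qed

lemma radical_number_root:
  assumes v: "radical_number v" and "z ^ k = v" "1 \<le> k"
  shows "radical_number z"
proof (cases "z = 0")
  case True
  then show ?thesis using radical_number_of_int[of 0] by simp
next
  case False
  have k: "0 < k" using assms(3) by simp
  have z: "z \<in> qbar"
    using qbar_nth_root[OF assms(2) k] v by (simp add: radical_number_def)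
  obtain n where n: "\<And>m \<kappa>. n \<le> m \<Longrightarrow> \<kappa> \<in> derived_auts m \<Longrightarrow> \<kappa> v = v"
    using radical_number_level[OF v] by blast
  \<comment> \<open>Level \<open>n\<close> fixes \<open>v\<close>; the additional level ensures that
    roots of unity are fixed too, which would fail at level 0.\<close>
  define N where "N = Suc n"
  have multiplier: "\<exists>\<zeta>. \<zeta> ^ k = 1 \<and> \<alpha> z = \<zeta> * z" if "\<alpha> \<in> derived_auts N" for \<alpha>
  proof (intro exI conjI)
    have "\<alpha> z ^ k = z ^ k"
      using qbar_aut_power[OF derived_auts_qbar_aut[OF that] z, of k] n[OF _ that] assms(2)
      by (simp add: N_def)
    then show "(\<alpha> z / z) ^ k = 1"
      using False by (simp add: power_divide)
  qed (use False in simp)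
  have fix_unity: "\<alpha> \<zeta> = \<zeta>" if "\<alpha> \<in> derived_auts N" "\<zeta> ^ k = 1" for \<alpha> \<zeta>
  proof (rule derived_auts_fix_roots_of_unity[OF _ that(2) k])
    have "derived_auts N \<subseteq> derived_auts (Suc 0)"
      by (rule derived_auts_antimono) (simp add: N_def)
    then show "\<alpha> \<in> derived_auts (Suc 0)" using that(1) by blast
  qed
  have unity_qbar: "\<zeta> \<in> qbar" if "\<zeta> ^ k = 1" for \<zeta>
    using qbar_nth_root[OF that k] qbar.one by simp
  have "\<kappa> z = z" if \<kappa>: "\<kappa> \<in> derived_auts (Suc N)" for \<kappa>
  proof -
    obtain \<gamma> \<delta> where *: "\<gamma> \<in> derived_auts N" "\<delta> \<in> derived_auts N"
      "\<forall>a\<in>qbar. \<kappa> (\<delta> (\<gamma> a)) = \<gamma> (\<delta> a)"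
      using \<kappa> by auto
    obtain \<zeta> \<xi> where \<zeta>: "\<zeta> ^ k = 1" "\<gamma> z = \<zeta> * z" and \<xi>: "\<xi> ^ k = 1" "\<delta> z = \<xi> * z"
      using multiplier *(1,2) by blast
    \<comment> \<open>Chosen such that \<open>\<delta> (\<gamma> (c * z)) = z\<close>; the
      commutator equation at \<open>c * z\<close> then reads \<open>\<kappa> z = z\<close>.\<close>
    define c where "c = inverse (\<zeta> * \<xi>)"
    have c: "c ^ k = 1" "c \<in> qbar"
      using \<zeta>(1) \<xi>(1) unity_qbar by (auto simp: c_def power_inverse power_mult_distrib)
    have nz: "\<zeta> \<noteq> 0" "\<xi> \<noteq> 0" using \<zeta>(1) \<xi>(1) k by (auto simp: zero_power)
    have aut: "\<alpha> (s * t) = s * \<alpha> t" if "\<alpha> \<in> derived_auts N" "s ^ k = 1" "t \<in> qbar" for \<alpha> s t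
      using qbar_autD(3)[OF derived_auts_qbar_aut[OF that(1)] unity_qbar[OF that(2)] that(3)]
        fix_unity[OF that(1,2)] by simp
    have "\<delta> (\<gamma> (c * z)) = c * (\<zeta> * (\<xi> * z))"
      by (simp add: aut[OF *(1) c(1) z] \<zeta>(2) aut[OF *(2) c(1)] qbar_mult unity_qbar \<zeta>(1) z
          aut[OF *(2) \<zeta>(1)] \<xi>(2))
    moreover have "\<gamma> (\<delta> (c * z)) = c * (\<xi> * (\<zeta> * z))"
      by (simp add: aut[OF *(2) c(1) z] \<xi>(2) aut[OF *(1) c(1)] qbar_mult unity_qbar \<xi>(1) z
          aut[OF *(1) \<xi>(1)] \<zeta>(2))
    moreover have "c * (\<zeta> * (\<xi> * z)) = z" "c * (\<xi> * (\<zeta> * z)) = z"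
      using nz by (simp_all add: c_def field_simps)
    moreover have "\<kappa> (\<delta> (\<gamma> (c * z))) = \<gamma> (\<delta> (c * z))"
      using *(3) c(2) z qbar_mult by blast
    ultimately show ?thesis by simp
  qed
  then show ?thesis
    using z unfolding radical_number_def by blast
qed

text \<open>Decision nodes only select a subtree and \<open>radical_number_root\<close> covers every
  choice of root, so the invariant holds on each run.\<close>

lemma rexec_radical_number:
  assumes "rexec T vs out" "\<forall>v\<in>set vs. radical_number v"
  shows "\<forall>v\<in>set out. radical_number v"
  using assms
proof (induction rule: rexec.induct)
  case (comp p vs z t out)
  have vs: "radical_number (vs ! i)" if "i < length vs" for i
    using comp.prems that by simp
  note op = comp.hyps(1)[unfolded op_val_def]
  have "radical_number z"
  proof (cases p)
    case (RConst c)
    then show ?thesis using op by (simp add: radical_number_of_int)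
  next
    case (RAdd i j)
    then show ?thesis using op vs by (simp add: radical_number_add)
  next
    case (RSub i j)
    then show ?thesis using op vs by (simp add: radical_number_diff)
  next
    case (RMul i j)
    then show ?thesis using op vs by (simp add: radical_number_mult)
  next
    case (RDiv i j)
    then show ?thesis using op vs by (simp add: radical_number_divide)
  next
    case (RRoot k i)
    then show ?thesis using op radical_number_root[OF vs[of i], of z k] by simp
  next
    case (RConj i)
    then show ?thesis using op vs by (simp add: radical_number_cnj)
  qed
  then show ?case using comp.prems by (intro comp.IH) simp
next
  case (leaf outs vs)
  then show ?case by simp
next
  case (dec_pos i vs t1 out t2)
  then show ?case by blast
next
  case (dec_neg i vs t2 out t1)
  then show ?case by blast
qed

section \<open>Valuation rings\<close>

definition is_subring :: "'a::comm_ring_1 set \<Rightarrow> bool" where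
  "is_subring B \<longleftrightarrow> 1 \<in> B \<and> (\<forall>a\<in>B. \<forall>b\<in>B. a - b \<in> B \<and> a * b \<in> B)"

lemma is_subringD:
  assumes "is_subring B"
  shows "1 \<in> B" "0 \<in> B" "a \<in> B \<Longrightarrow> b \<in> B \<Longrightarrow> a - b \<in> B" "a \<in> B \<Longrightarrow> b \<in> B \<Longrightarrow> a * b \<in> B"
    "a \<in> B \<Longrightarrow> - a \<in> B" "a \<in> B \<Longrightarrow> b \<in> B \<Longrightarrow> a + b \<in> B"
proof -
  have 1: "1 \<in> B" and diff: "\<And>a b. a \<in> B \<Longrightarrow> b \<in> B \<Longrightarrow> a - b \<in> B"
    and mult: "\<And>a b. a \<in> B \<Longrightarrow> b \<in> B \<Longrightarrow> a * b \<in> B"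
    using assms by (simp_all add: is_subring_def)
  have 0: "0 \<in> B"
    using diff[OF 1 1] by simp
  have minus: "- a \<in> B" if "a \<in> B" for a
    using diff[OF 0 that] by simp
  have "a + b \<in> B" if "a \<in> B" "b \<in> B" for a b
    using diff[OF that(1) minus[OF that(2)]] by simp
  note add = this
  show "1 \<in> B" "0 \<in> B" "a \<in> B \<Longrightarrow> b \<in> B \<Longrightarrow> a - b \<in> B" "a \<in> B \<Longrightarrow> b \<in> B \<Longrightarrow> a * b \<in> B"
    "a \<in> B \<Longrightarrow> - a \<in> B" "a \<in> B \<Longrightarrow> b \<in> B \<Longrightarrow> a + b \<in> B"
    by (fact 1, fact 0, fact diff, fact mult, fact minus, fact add)
qed

lemma is_subring_ring_rel: "is_subring B \<Longrightarrow> ring_rel (\<lambda>a b. a = b \<and> a \<in> B)"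
  by unfold_locales (simp_all add: is_subringD)

lemma rel_poly_subring_iff: "rel_poly (\<lambda>a b. a = b \<and> a \<in> B) P Q \<longleftrightarrow> P = Q \<and> (\<forall>i. coeff P i \<in> B)"
  by (auto simp: rel_poly_def poly_eq_iff)

lemma is_subring_adjoin:
  assumes "is_subring B"
  shows "is_subring {poly P x |P. \<forall>i. coeff P i \<in> B}"
proof -
  let ?S = "{poly P x |P. \<forall>i. coeff P i \<in> B}"
  interpret B: ring_rel "\<lambda>a b. a = b \<and> a \<in> B" by (rule is_subring_ring_rel[OF assms])
  interpret poly: ring_rel "rel_poly (\<lambda>a b. a = b \<and> a \<in> B)" by (rule B.ring_rel_rel_poly)
  have I: "poly P x \<in> ?S" if "rel_poly (\<lambda>a b. a = b \<and> a \<in> B) P P" for P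
    using that unfolding rel_poly_subring_iff by blast
  show ?thesis
    unfolding is_subring_def
  proof (intro conjI ballI)
    show "1 \<in> ?S" using I[OF poly.one] by simp
    fix a b assume "a \<in> ?S" "b \<in> ?S"
    then obtain P Q where
      P: "a = poly P x" "rel_poly (\<lambda>a b. a = b \<and> a \<in> B) P P" and
      Q: "b = poly Q x" "rel_poly (\<lambda>a b. a = b \<and> a \<in> B) Q Q"
      unfolding rel_poly_subring_iff by blast
    show "a - b \<in> ?S" using I[OF poly.diff[OF P(2) Q(2)]] P(1) Q(1) by simp
    show "a * b \<in> ?S" using I[OF poly.mult[OF P(2) Q(2)]] P(1) Q(1) by simp
  qed
qed

text \<open>With \<open>c\<close> the inverse of p, this gives a ring maximal among those in which p
  is not invertible.\<close>

lemma maximal_subring_avoiding: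
  assumes "is_subring B\<^sub>0" "c \<notin> B\<^sub>0"
  obtains B where "is_subring B" "c \<notin> B" "\<And>B'. is_subring B' \<Longrightarrow> c \<notin> B' \<Longrightarrow> B \<subseteq> B' \<Longrightarrow> B' = B"
proof -
  let ?A = "{B. is_subring B \<and> c \<notin> B}"
  have "\<exists>M\<in>?A. \<forall>X\<in>?A. M \<subseteq> X \<longrightarrow> X = M"
  proof (rule subset_Zorn_nonempty)
    show "?A \<noteq> {}" using assms by blast
    fix \<C> assume ne: "\<C> \<noteq> {}" and chain: "subset.chain ?A \<C>"
    have C: "is_subring G" "c \<notin> G" if "G \<in> \<C>" for G
      using chain that unfolding subset_chain_def by blast+
    have "is_subring (\<Union>\<C>)"
      unfolding is_subring_def
    proof (intro conjI ballI)
      show "1 \<in> \<Union>\<C>" using ne C(1) is_subringD(1) by blast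
      fix a b assume "a \<in> \<Union>\<C>" "b \<in> \<Union>\<C>"
      then obtain G H where GH: "G \<in> \<C>" "H \<in> \<C>" "a \<in> G" "b \<in> H" by blast
      then have "G \<subseteq> H \<or> H \<subseteq> G" using chain unfolding subset_chain_def by blast
      then obtain K where "K \<in> \<C>" "a \<in> K" "b \<in> K" using GH by blast
      then show "a - b \<in> \<Union>\<C>" "a * b \<in> \<Union>\<C>"
        using is_subringD(3,4)[OF C(1)] by blast+
    qed
    then show "\<Union>\<C> \<in> ?A" using C(2) by blast
  qed
  then show thesis using that by blast
qed

text \<open>A valuation ring of the field whose maximal ideal lies over p.\<close>

locale place =
  fixes p :: nat and B :: "'a::field_char_0 set"
  assumes prime: "prime p"
    and subring: "is_subring B"
    and inverse_p: "inverse (of_nat p) \<notin> B"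
    and valuation: "x \<notin> B \<Longrightarrow> inverse x \<in> B"

text \<open>Chevalley's argument: if neither \<open>x\<close> nor \<open>1/x\<close> is in \<open>B\<close>, then by maximality 1 is a polynomial in
  \<open>x\<close> with coefficients in \<open>p B\<close>, and likewise in \<open>1/x\<close>; the one of larger degree can be shortened by
  means of the other.\<close>

context
  fixes p :: nat and B :: "'a::field_char_0 set"
  assumes p: "prime p" and B: "is_subring B" and p_B: "inverse (of_nat p) \<notin> B"
    and B_max: "\<And>B'. is_subring B' \<Longrightarrow> inverse (of_nat p) \<notin> B' \<Longrightarrow> B \<subseteq> B' \<Longrightarrow> B' = B"
begin

private definition pB :: "'a set" where
  "pB = (*) (of_nat p) ` B"

private lemma pB_I: "b \<in> B \<Longrightarrow> of_nat p * b \<in> pB"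
  unfolding pB_def by (rule imageI)

private lemma pB_add: "a \<in> pB \<Longrightarrow> b \<in> pB \<Longrightarrow> a + b \<in> pB"
  unfolding pB_def by (auto simp: image_iff is_subringD(6)[OF B] simp flip: distrib_left)

private lemma pB_diff: "a \<in> pB \<Longrightarrow> b \<in> pB \<Longrightarrow> a - b \<in> pB"
  unfolding pB_def by (auto simp: image_iff is_subringD(3)[OF B] simp flip: right_diff_distrib)

private lemma pB_mult: "a \<in> B \<Longrightarrow> b \<in> pB \<Longrightarrow> a * b \<in> pB"
  unfolding pB_def by (auto simp: image_iff is_subringD(4)[OF B] mult.left_commute)

private lemma B_of_nat: "of_nat n \<in> B"
  by (induction n) (simp_all add: is_subringD[OF B])

private lemma pB_subset: "a \<in> pB \<Longrightarrow> a \<in> B"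
  unfolding pB_def using is_subringD(4)[OF B B_of_nat] by blast

private lemma one_notin_pB: "1 \<notin> pB"
proof
  assume "1 \<in> pB"
  then obtain b where "1 = of_nat p * b" "b \<in> B" by (auto simp: pB_def)
  then show False using p_B by (metis inverse_unique)
qed

private lemma pB_sum: "(\<And>i. i \<in> I \<Longrightarrow> f i \<in> pB) \<Longrightarrow> sum f I \<in> pB"
  using pB_I[OF is_subringD(2)[OF B]]
  by (induction I rule: infinite_finite_induct) (auto intro: pB_add)

private definition relation_le :: "'a \<Rightarrow> nat \<Rightarrow> bool" where
  "relation_le x n \<longleftrightarrow> (\<exists>P. (\<forall>i. coeff P i \<in> pB) \<and> degree P \<le> n \<and> poly P x = 1)"

text \<open>The ring generated by \<open>B\<close> and \<open>x\<close> is strictly larger than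
  \<open>B\<close>, so by maximality it contains the inverse of p; multiply that expression by
  p.\<close>

private lemma relation_if_notin:
  assumes "x \<notin> B"
  obtains n where "relation_le x n"
proof -
  let ?S = "{poly P x |P. \<forall>i. coeff P i \<in> B}"
  have 0: "0 \<in> B" and 1: "1 \<in> B" using B by (rule is_subringD)+
  have "b \<in> ?S" if "b \<in> B" for b
    by (rule CollectI, rule exI[of _ "[:b:]"]) (auto simp: coeff_pCons that 0 split: nat.splits)
  then have "B \<subseteq> ?S" by blast
  moreover have "x \<in> ?S"
    by (rule CollectI, rule exI[of _ "[:0, 1:]"]) (auto simp: coeff_pCons 0 1 split: nat.splits)
  ultimately have "inverse (of_nat p) \<in> ?S"
    using B_max[OF is_subring_adjoin[OF B, of x]] assms by blast
  then obtain P where P: "inverse (of_nat p) = poly P x" "\<forall>i. coeff P i \<in> B" by blast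
  have "p \<noteq> 0" using p by (metis not_prime_0)
  then have "poly (Polynomial.smult (of_nat p) P) x = 1"
    by (simp flip: P(1))
  then have "relation_le x (degree (Polynomial.smult (of_nat p) P))"
    unfolding relation_le_def using P(2) pB_I
    by (intro exI[of _ "Polynomial.smult (of_nat p) P"]) simp
  then show thesis by (rule that)
qed

text \<open>Otherwise a relation for the inverse of \<open>u = 1 - b\<close>, multiplied by
  \<open>u ^ n\<close>, puts \<open>u ^ n\<close> into \<open>pB\<close>. But \<open>u\<close> is 1
  modulo \<open>pB\<close>, hence so is \<open>u ^ n\<close>, and 1 would lie in
  \<open>pB\<close>.\<close>

private lemma one_minus_pB_unit:
  assumes "b \<in> pB"
  shows "inverse (1 - b) \<in> B"
proof (rule ccontr)
  assume "inverse (1 - b) \<notin> B"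
  then obtain n P where P: "\<forall>i. coeff P i \<in> pB" "degree P \<le> n" "poly P (inverse (1 - b)) = 1"
    using relation_if_notin unfolding relation_le_def by metis
  define u where "u = 1 - b"
  have u: "u \<in> B" "u \<noteq> 0"
    using assms one_notin_pB is_subringD(1,3)[OF B] pB_subset by (auto simp: u_def)
  have upow: "u ^ k \<in> B" for k
    using u(1) by (induction k) (simp_all add: is_subringD[OF B])
  have "1 - u ^ k \<in> pB" for k
  proof (induction k)
    case 0
    show ?case using pB_I[OF is_subringD(2)[OF B]] by simp
  next
    case (Suc k)
    have "1 - u ^ Suc k = (1 - u ^ k) + u ^ k * b"
      by (simp add: u_def algebra_simps)
    then show ?case
      using pB_add[OF Suc pB_mult[OF upow assms]] by (simp only:)
  qed
  moreover have "u ^ n \<in> pB"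
  proof -
    have "u ^ n = u ^ n * poly P (inverse u)"
      using P(3) by (simp add: u_def)
    also have "\<dots> = (\<Sum>i\<le>n. u ^ n * (coeff P i * inverse u ^ i))"
      by (simp add: poly_eq_sum_le[OF P(2)] sum_distrib_left)
    also have "\<dots> = (\<Sum>i\<le>n. u ^ (n - i) * coeff P i)"
      using u(2) by (intro sum.cong) (auto simp: power_diff field_simps)
    also have "\<dots> \<in> pB"
      using P(1) upow by (intro pB_sum pB_mult) auto
    finally show ?thesis .
  qed
  ultimately have "(1 - u ^ n) + u ^ n \<in> pB" by (intro pB_add)
  then show False using one_notin_pB by simp
qed

text \<open>Moving the constant term of \<open>Q\<close> to the other side and dividing by the unit
  \<open>1 - coeff Q 0\<close> expresses 1 by positive powers of the inverse of \<open>x\<close>.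
  Multiplied by \<open>x ^ n\<close>, this replaces the top power in \<open>P\<close> by lower
  ones.\<close>

private lemma relation_le_descent:
  assumes "x \<noteq> 0" "relation_le x n" "relation_le (inverse x) m" "m \<le> n" "0 < m"
  shows "relation_le x (n - 1)"
proof -
  obtain P where P: "\<forall>i. coeff P i \<in> pB" "degree P \<le> n" "poly P x = 1"
    using assms(2) unfolding relation_le_def by blast
  obtain Q where Q: "\<forall>i. coeff Q i \<in> pB" "degree Q \<le> m" "poly Q (inverse x) = 1"
    using assms(3) unfolding relation_le_def by blast
  define v where "v = inverse (1 - coeff Q 0)"
  have v: "v \<in> B" unfolding v_def using Q(1) one_minus_pB_unit by blast
  have "1 - coeff Q 0 \<noteq> 0" using Q(1) one_notin_pB by (metis eq_iff_diff_eq_0)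
  then have v1: "v * (1 - coeff Q 0) = 1" by (simp add: v_def)
  \<comment> \<open>The condition \<open>m \<le> n\<close> keeps the subtraction
    \<open>n - i\<close> from being truncated, and \<open>1 \<le> i\<close> keeps the exponent below
    \<open>n\<close>.\<close>
  define S where "S = (\<Sum>i\<in>{1..m}. monom (v * coeff Q i) (n - i))"
  have "1 = coeff Q 0 + (\<Sum>i\<in>{1..m}. coeff Q i * inverse x ^ i)"
    using Q(3) unfolding poly_eq_sum_le[OF Q(2)]
    by (simp add: atMost_atLeast0 sum.atLeast_Suc_atMost)
  then have Qsum: "(\<Sum>i\<in>{1..m}. coeff Q i * inverse x ^ i) = 1 - coeff Q 0" by (simp add: algebra_simps)
  have "poly S x = (\<Sum>i\<in>{1..m}. v * coeff Q i * x ^ (n - i))"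
    by (simp add: S_def poly_sum poly_monom)
  also have "\<dots> = (\<Sum>i\<in>{1..m}. v * x ^ n * (coeff Q i * inverse x ^ i))"
    using assms(1,4) by (intro sum.cong) (auto simp: power_diff field_simps)
  also have "\<dots> = x ^ n"
    unfolding sum_distrib_left[symmetric] Qsum using v1 by (simp add: mult.commute mult.left_commute)
  finally have Sx: "poly S x = x ^ n" .
  define T where "T = (P - monom (coeff P n) n) + Polynomial.smult (coeff P n) S"
  have "poly T x = 1"
    by (simp add: T_def Sx P(3) poly_monom)
  moreover have coeff_S: "coeff S j \<in> pB" for j
    unfolding S_def coeff_sum using Q(1) v pB_I[OF is_subringD(2)[OF B]]
    by (auto intro!: pB_sum pB_mult)
  have "coeff T j \<in> pB" for j
    unfolding T_def using P(1) coeff_S pB_I[OF is_subringD(2)[OF B]]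
    by (auto intro!: pB_add pB_diff pB_mult pB_subset)
  moreover have "degree T \<le> n - 1"
  proof (rule degree_le, intro allI impI)
    fix j assume "n - 1 < j"
    have "coeff S j = 0"
      unfolding S_def coeff_sum using \<open>n - 1 < j\<close> by (intro sum.neutral) auto
    moreover have "coeff (P - monom (coeff P n) n) j = 0"
      using \<open>n - 1 < j\<close> P(2) by (cases "j = n") (auto intro: coeff_eq_0)
    ultimately show "coeff T j = 0" by (simp add: T_def)
  qed
  ultimately show ?thesis unfolding relation_le_def by blast
qed

private lemma not_relation_le_0: "\<not> relation_le x 0"
proof
  assume "relation_le x 0"
  then obtain P where P: "\<forall>i. coeff P i \<in> pB" "degree P = 0" "poly P x = 1"
    unfolding relation_le_def by blast
  then have "coeff P 0 = 1" by (elim degree_eq_zeroE) simp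
  then show False using P(1) one_notin_pB by metis
qed

lemma maximal_subring_valuation:
  assumes "x \<notin> B"
  shows "inverse x \<in> B"
proof (rule ccontr)
  assume "inverse x \<notin> B"
  obtain n where n: "relation_le x n" "\<And>k. k < n \<Longrightarrow> \<not> relation_le x k"
    using relation_if_notin[OF assms] by (metis LeastI not_less_Least)
  obtain m where m: "relation_le (inverse x) m" "\<And>k. k < m \<Longrightarrow> \<not> relation_le (inverse x) k"
    using relation_if_notin[OF \<open>inverse x \<notin> B\<close>] by (metis LeastI not_less_Least)
  have nm: "0 < n" "0 < m"
    using n(1) m(1) not_relation_le_0 by (metis gr0I)+
  have x: "x \<noteq> 0" using assms is_subringD(2)[OF B] by metis
  show False
  proof (cases "m \<le> n")
    case True
    then show False
      using relation_le_descent[OF x n(1) m(1) True nm(2)] n(2)[of "n - 1"] nm(1) by simp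
  next
    case False
    then show False
      using relation_le_descent[of "inverse x" m n] n(1) m(1) m(2)[of "m - 1"] nm x by simp
  qed
qed

end

lemma place_exists:
  assumes "prime p"
  obtains B :: "'a::field_char_0 set" where "place p B"
proof -
  have "inverse (of_nat p) \<notin> (\<int> :: 'a set)"
  proof
    assume "inverse (of_nat p) \<in> (\<int> :: 'a set)"
    then obtain k where k: "inverse (of_nat p) = (of_int k :: 'a)" by (elim Ints_cases)
    have "p \<noteq> 0" using assms by (metis not_prime_0)
    then have "of_int (int p * k) = (of_int 1 :: 'a)"
      by (simp flip: k)
    then have "int p * k = 1" by (simp only: of_int_eq_iff)
    then have "p = 1" by (simp add: zmult_eq_1_iff)
    then show False using assms by simp
  qed
  moreover have "is_subring (\<int> :: 'a set)"
    by (auto simp: is_subring_def)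
  ultimately obtain B :: "'a set" where "is_subring B" "inverse (of_nat p) \<notin> B"
    "\<And>B'. is_subring B' \<Longrightarrow> inverse (of_nat p) \<notin> B' \<Longrightarrow> B \<subseteq> B' \<Longrightarrow> B' = B"
    using maximal_subring_avoiding by blast
  then have "place p B"
    using maximal_subring_valuation[OF assms] assms unfolding place_def by blast
  then show thesis by (rule that)
qed

section \<open>The maximal ideal of a place\<close>

context place
begin

text \<open>The non-units of \<open>B\<close>. Zero is listed separately because its inverse is 0,
  which belongs to \<open>B\<close>.\<close>

definition M :: "'a set" where
  "M = {b \<in> B. b = 0 \<or> inverse b \<notin> B}"

lemma B_of_int: "of_int c \<in> B"
  using ring_rel.of_int[OF is_subring_ring_rel[OF subring]] by blast

lemma B_of_nat: "of_nat c \<in> B"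
  using B_of_int[of "int c"] by simp

lemma B_power: "b \<in> B \<Longrightarrow> b ^ n \<in> B"
  using ring_rel.power[OF is_subring_ring_rel[OF subring]] by blast

lemma zero_in_M: "0 \<in> M"
  by (simp add: M_def is_subringD[OF subring])

lemma one_notin_M: "1 \<notin> M"
  by (simp add: M_def is_subringD[OF subring])

lemma p_nonzero: "(of_nat p :: 'a) \<noteq> 0"
  using prime by (metis not_prime_0 of_nat_eq_0_iff)

lemma p_in_M: "of_nat p \<in> M"
  by (simp add: M_def B_of_nat inverse_p)

lemma M_mult:
  assumes "a \<in> B" "b \<in> M"
  shows "a * b \<in> M"
proof -
  have "inverse (a * b) \<notin> B" if "a * b \<noteq> 0"
  proof
    assume "inverse (a * b) \<in> B"
    then have "a * inverse (a * b) \<in> B"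
      using assms(1) is_subringD(4)[OF subring] by blast
    moreover have "a * inverse (a * b) = inverse b"
      using that by (simp add: field_simps)
    ultimately have "inverse b \<in> B" by (simp only:)
    then show False
      using assms(2) that by (simp add: M_def)
  qed
  then show ?thesis
    using assms is_subringD(4)[OF subring] unfolding M_def by blast
qed

text \<open>In a valuation ring one of two nonzero elements divides the other, so their sum is a
  multiple of one of them.\<close>

lemma M_add_aux:
  assumes "a \<in> M" "b \<in> M" "b \<noteq> 0" "a / b \<in> B"
  shows "a + b \<in> M"
proof -
  have "(a / b + 1) * b \<in> M"
    using assms is_subringD[OF subring] by (intro M_mult) auto
  moreover have "(a / b + 1) * b = a + b"
    using assms(3) by (simp add: field_simps)
  ultimately show ?thesis by simp
qed

lemma M_add:
  assumes "a \<in> M" "b \<in> M"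
  shows "a + b \<in> M"
proof (cases "a = 0 \<or> b = 0")
  case True
  then show ?thesis using assms by auto
next
  case False
  show ?thesis
  proof (cases "a / b \<in> B")
    case True
    then show ?thesis using M_add_aux assms False by blast
  next
    case notin: False
    then have "b / a \<in> B"
      using valuation[of "a / b"] by simp
    then show ?thesis
      using M_add_aux[of b a] assms False by (simp add: add.commute)
  qed
qed

lemma M_uminus: "a \<in> M \<Longrightarrow> - a \<in> M"
  using M_mult[of "- 1" a] is_subringD(5)[OF subring is_subringD(1)[OF subring]] by simp

lemma M_diff: "a \<in> M \<Longrightarrow> b \<in> M \<Longrightarrow> a - b \<in> M"
  using M_add[OF _ M_uminus] by force

lemma M_sum: "(\<And>i. i \<in> I \<Longrightarrow> f i \<in> M) \<Longrightarrow> sum f I \<in> M"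
  by (induction I rule: infinite_finite_induct) (auto intro: zero_in_M M_add)

lemma M_prime:
  assumes "a \<in> B" "b \<in> B" "a * b \<in> M"
  shows "a \<in> M \<or> b \<in> M"
proof (rule ccontr)
  assume "\<not> ?thesis"
  then have "a \<noteq> 0" "b \<noteq> 0" "inverse a \<in> B" "inverse b \<in> B"
    using assms(1,2) by (auto simp: M_def)
  then have "inverse (a * b) \<in> B" "a * b \<noteq> 0"
    using is_subringD(4)[OF subring] by auto
  then show False using assms(3) by (auto simp: M_def)
qed

lemma M_prime_prod:
  assumes "finite I" "\<And>i. i \<in> I \<Longrightarrow> f i \<in> B" "prod f I \<in> M"
  shows "\<exists>i\<in>I. f i \<in> M"
  using assms
proof (induction I rule: finite_induct)
  case empty
  then show ?case using one_notin_M by simp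
next
  case (insert i I)
  have "prod f I \<in> B"
    using ring_rel.prod[OF is_subring_ring_rel[OF subring], of I f f] insert.prems(1) by simp
  then have "f i \<in> M \<or> prod f I \<in> M"
    using M_prime[of "f i" "prod f I"] insert by simp
  then show ?case using insert by auto
qed

lemma of_int_in_M:
  assumes "int p dvd c"
  shows "of_int c \<in> M"
proof -
  obtain d where "c = d * int p" using assms by (metis dvdE mult.commute)
  then show ?thesis using M_mult[OF B_of_int[of d] p_in_M] by simp
qed

lemma coprime_notin_M:
  assumes "\<not> int p dvd c"
  shows "of_int c \<notin> M"
proof
  assume c: "of_int c \<in> M"
  have "coprime c (int p)"
    using assms prime prime_imp_coprime[of "int p" c] by (simp add: coprime_commute)
  then obtain u v where "u * c + v * int p = 1"
    by (metis coprime_iff_gcd_eq_1 bezout_int)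
  then have "(of_int (u * c + v * int p) :: 'a) = 1" by simp
  moreover have "of_int (u * c + v * int p) \<in> M"
    using M_add[OF M_mult[OF B_of_int[of u] c] M_mult[OF B_of_int[of v] p_in_M]] by simp
  ultimately show False using one_notin_M by simp
qed

text \<open>If \<open>x\<close> were outside \<open>B\<close>, its inverse would be in
  \<open>B\<close>. Dividing the monic equation by \<open>x ^ d\<close>, one less than the degree,
  writes \<open>x\<close> as a polynomial in that inverse.\<close>

lemma integral_in_B:
  assumes P: "\<And>i. coeff P i \<in> B" "lead_coeff P = 1" "poly P x = 0"
  shows "x \<in> B"
proof (rule ccontr)
  assume x: "x \<notin> B"
  then have w: "inverse x \<in> B" by (rule valuation)
  have x0: "x \<noteq> 0" using x is_subringD(2)[OF subring] by metis
  have "degree P \<noteq> 0"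
  proof
    assume "degree P = 0"
    then show False using P(2,3) by (elim degree_eq_zeroE) simp
  qed
  then obtain d where d: "degree P = Suc d" by (metis not0_implies_Suc)
  have "poly P x = (\<Sum>i\<le>Suc d. coeff P i * x ^ i)"
    by (rule poly_eq_sum_le) (simp add: d)
  then have "(\<Sum>i\<le>d. coeff P i * x ^ i) + x ^ Suc d = 0"
    using P(2,3) by (simp add: d)
  then have "inverse x ^ d * ((\<Sum>i\<le>d. coeff P i * x ^ i) + x ^ Suc d) = 0" by simp
  then have "(\<Sum>i\<le>d. inverse x ^ d * (coeff P i * x ^ i)) + inverse x ^ d * x ^ Suc d = 0"
    by (simp only: ring_distribs sum_distrib_left)
  moreover have "inverse x ^ d * x ^ Suc d = x"
    using x0 by (simp add: power_inverse)
  moreover have "(\<Sum>i\<le>d. inverse x ^ d * (coeff P i * x ^ i)) = (\<Sum>i\<le>d. coeff P i * inverse x ^ (d - i))"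
    using x0 by (intro sum.cong) (auto simp: power_diff field_simps)
  ultimately have "(\<Sum>i\<le>d. coeff P i * inverse x ^ (d - i)) + x = 0"
    by (simp only:)
  then have "x = - (\<Sum>i\<le>d. coeff P i * inverse x ^ (d - i))"
    by (simp only: eq_neg_iff_add_eq_0 add.commute)
  moreover have "(\<Sum>i\<le>d. coeff P i * inverse x ^ (d - i)) \<in> B"
    using ring_rel.sum[OF is_subring_ring_rel[OF subring],
        of "{..d}" "\<lambda>i. coeff P i * inverse x ^ (d - i)" "\<lambda>i. coeff P i * inverse x ^ (d - i)"]
      is_subringD(4)[OF subring] P(1) B_power[OF w] by simp
  ultimately show False
    using x is_subringD(5)[OF subring] by metis
qed

text \<open>The graph of the Frobenius endomorphism \<open>a \<mapsto> a ^ p\<close> of \<open>B\<close> modulo \<open>M\<close>.\<close>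

definition frob :: "'a \<Rightarrow> 'a \<Rightarrow> bool" where
  "frob a b \<longleftrightarrow> a \<in> B \<and> b \<in> B \<and> a ^ p - b \<in> M"

lemma frob_power: "a \<in> B \<Longrightarrow> frob a (a ^ p)"
  by (simp add: frob_def B_power zero_in_M)

lemma freshmans_dream_mod_M:
  assumes "a \<in> B" "c \<in> B"
  shows "(a + c) ^ p - (a ^ p + c ^ p) \<in> M"
proof -
  obtain q where q: "p = Suc q" using prime by (metis not_prime_0 not0_implies_Suc)
  let ?t = "\<lambda>k. of_nat (p choose k) * a ^ k * c ^ (p - k)"
  have "(a + c) ^ p = (\<Sum>k\<le>p. ?t k)"
    by (rule binomial_ring)
  also have "{..p} = insert 0 (insert p {1..<p})"
    using q by auto
  also have "(\<Sum>k\<in>insert 0 (insert p {1..<p}). ?t k) = c ^ p + (a ^ p + (\<Sum>k\<in>{1..<p}. ?t k))"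
    using q by simp
  finally have "(a + c) ^ p - (a ^ p + c ^ p) = (\<Sum>k\<in>{1..<p}. ?t k)"
    by (simp add: algebra_simps)
  also have "\<dots> \<in> M"
  proof -
    have "?t k \<in> M" if "k \<in> {1..<p}" for k
    proof -
      have "p dvd (p choose k)"
        using dvd_choose_prime[OF _ _ _ prime, of k] that by simp
      then have "of_int (int (p choose k)) \<in> M"
        by (intro of_int_in_M) (simp only: int_dvd_int_iff)
      then have "(a ^ k * c ^ (p - k)) * of_nat (p choose k) \<in> M"
        using assms by (intro M_mult is_subringD(4)[OF subring] B_power) simp_all
      then show ?thesis by (simp only: mult_ac)
    qed
    then show ?thesis
      by (intro M_sum)
  qed
  finally show ?thesis .
qed

lemma frob_ring_rel: "ring_rel frob"
proof
  have "p \<noteq> 0" using prime by (metis not_prime_0)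
  then show "frob 0 0" "frob 1 1"
    by (simp_all add: frob_def zero_in_M is_subringD[OF subring] zero_power)
next
  fix a b c d assume *: "frob a b" "frob c d"
  then have B: "a \<in> B" "b \<in> B" "c \<in> B" "d \<in> B" and M: "a ^ p - b \<in> M" "c ^ p - d \<in> M"
    by (simp_all add: frob_def)
  have "((a + c) ^ p - (a ^ p + c ^ p)) + ((a ^ p - b) + (c ^ p - d)) \<in> M"
    using freshmans_dream_mod_M[OF B(1,3)] M by (intro M_add)
  then have "(a + c) ^ p - (b + d) \<in> M"
    by (simp add: algebra_simps)
  then show "frob (a + c) (b + d)"
    using B is_subringD(6)[OF subring] by (simp add: frob_def)
  have "c ^ p * (a ^ p - b) + b * (c ^ p - d) \<in> M"
    using M B by (intro M_add M_mult B_power)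
  then have "(a * c) ^ p - b * d \<in> M"
    by (simp add: algebra_simps power_mult_distrib)
  then show "frob (a * c) (b * d)"
    using B is_subringD(4)[OF subring] by (simp add: frob_def)
next
  fix a b assume "frob a b"
  then have B: "a \<in> B" "b \<in> B" and M: "a ^ p - b \<in> M"
    by (simp_all add: frob_def)
  have "p \<noteq> 0" using prime by (metis not_prime_0)
  \<comment> \<open>The binomial congruence for \<open>a + (- a) = 0\<close> gives the sign rule
    without a case distinction on the parity of p.\<close>
  then have "- (a ^ p + (- a) ^ p) \<in> M"
    using freshmans_dream_mod_M[of a "- a"] B is_subringD(5)[OF subring] by (simp add: zero_power)
  then have "- (- (a ^ p + (- a) ^ p)) - (a ^ p - b) \<in> M"
    using M_diff[OF M_uminus M] by blast
  then have "(- a) ^ p - (- b) \<in> M" by simp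
  then show "frob (- a) (- b)"
    using B is_subringD(5)[OF subring] by (simp add: frob_def)
qed

text \<open>In lowest terms the denominator of \<open>y\<close> is prime to p, and Fermat's
  congruence for numerator and denominator passes to the quotient because \<open>M\<close> is
  prime.\<close>

lemma frob_Rats:
  assumes "y \<in> \<rat>" "y \<in> B"
  shows "frob y y"
proof -
  obtain a b where ab: "b > 0" "coprime a b" "y = of_int a / of_int b"
    using Rats_cases'[OF assms(1)] by blast
  have "\<not> int p dvd b"
  proof
    assume "int p dvd b"
    then obtain c where c: "b = int p * c" by (elim dvdE)
    have "coprime a (int p)" using ab(2) c by simp
    then obtain u v where uv: "u * a + v * int p = 1"
      by (metis coprime_iff_gcd_eq_1 bezout_int)
    have "c \<noteq> 0" using ab(1) c by auto
    \<comment> \<open>With \<open>b = p * c\<close>, the element \<open>c * y\<close> is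
      \<open>a / p\<close>; the Bezout relation turns it into an inverse of p inside
      \<open>B\<close>.\<close>
    then have "of_nat p * (of_int u * (of_int c * y) + of_int v) = (of_int (u * a + v * int p) :: 'a)"
      using p_nonzero by (simp add: ab(3) c field_simps)
    then have "inverse (of_nat p) = (of_int u * (of_int c * y) + of_int v :: 'a)"
      unfolding uv by (intro inverse_unique) simp
    moreover have "of_int u * (of_int c * y) + of_int v \<in> B"
      using assms(2) B_of_int is_subringD(4,6)[OF subring] by blast
    ultimately show False using inverse_p by simp
  qed
  then have b: "of_int b \<notin> M" by (rule coprime_notin_M)
  have by_a: "of_int b * y = of_int a" using ab(1,3) by simp
  have "frob (of_int b) (of_int b)" "frob (of_int a) (of_int a)"
    using ring_rel.of_int[OF frob_ring_rel] by blast+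
  then have M: "of_int b ^ p - of_int b \<in> M" "(of_int b * y) ^ p - of_int b * y \<in> M"
    by (simp_all add: frob_def by_a)
  have "((of_int b * y) ^ p - of_int b * y) - y ^ p * (of_int b ^ p - of_int b) \<in> M"
    by (rule M_diff[OF M(2) M_mult[OF B_power[OF assms(2)] M(1)]])
  then have "of_int b * (y ^ p - y) \<in> M"
    by (simp add: algebra_simps power_mult_distrib)
  moreover have "y ^ p - y \<in> B"
    using assms(2) B_power is_subringD(3)[OF subring] by blast
  ultimately have "y ^ p - y \<in> M"
    using M_prime[OF B_of_int] b by blast
  then show ?thesis using assms(2) by (simp add: frob_def)
qed

text \<open>Gauss's lemma: take the lowest coefficients of \<open>P\<close> and \<open>Q\<close>
  outside \<open>M\<close>. In the coefficient of their product at the sum of the two indices, every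
  other summand lies in \<open>M\<close>.\<close>

lemma M_poly_prime:
  assumes B: "\<And>i. coeff P i \<in> B" "\<And>i. coeff Q i \<in> B" and M: "\<And>i. coeff (P * Q) i \<in> M"
  shows "(\<forall>i. coeff P i \<in> M) \<or> (\<forall>i. coeff Q i \<in> M)"
proof (rule ccontr)
  assume "\<not> ?thesis"
  then have ex: "\<exists>i. coeff P i \<notin> M" "\<exists>j. coeff Q j \<notin> M" by simp_all
  define i where "i = (LEAST i. coeff P i \<notin> M)"
  define j where "j = (LEAST j. coeff Q j \<notin> M)"
  have i: "coeff P i \<notin> M" "\<And>k. k < i \<Longrightarrow> coeff P k \<in> M"
    using LeastI_ex[OF ex(1)] not_less_Least unfolding i_def by blast+
  have j: "coeff Q j \<notin> M" "\<And>k. k < j \<Longrightarrow> coeff Q k \<in> M"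
    using LeastI_ex[OF ex(2)] not_less_Least unfolding j_def by blast+
  have "coeff (P * Q) (i + j) = (\<Sum>k\<le>i + j. coeff P k * coeff Q (i + j - k))"
    by (simp add: coeff_mult)
  also have "\<dots> = coeff P i * coeff Q j + (\<Sum>k\<in>{..i + j} - {i}. coeff P k * coeff Q (i + j - k))"
    by (subst sum.remove[of _ i]) simp_all
  finally have eq: "coeff P i * coeff Q j =
      coeff (P * Q) (i + j) - (\<Sum>k\<in>{..i + j} - {i}. coeff P k * coeff Q (i + j - k))"
    by simp
  have "coeff P k * coeff Q (i + j - k) \<in> M" if "k \<in> {..i + j} - {i}" for k
  proof (cases "k < i")
    case True
    then show ?thesis
      using M_mult[OF B(2) i(2)] by (metis mult.commute)
  next
    case False
    then have "i + j - k < j" using that by auto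
    then show ?thesis using M_mult[OF B(1) j(2)] by blast
  qed
  then have "coeff P i * coeff Q j \<in> M"
    unfolding eq by (intro M_diff M M_sum)
  then show False using M_prime B i(1) j(1) by blast
qed

lemma M_poly_prime_prod:
  assumes "finite I" "\<And>s i. s \<in> I \<Longrightarrow> coeff (f s) i \<in> B" "\<And>i. coeff (prod f I) i \<in> M"
  shows "\<exists>s\<in>I. \<forall>i. coeff (f s) i \<in> M"
  using assms
proof (induction I rule: finite_induct)
  case empty
  from empty(2)[of 0] show ?case using one_notin_M by simp
next
  case (insert s I)
  have "coeff (prod f I) i \<in> B" for i
    using ring_rel.prod[OF ring_rel.ring_rel_rel_poly[OF is_subring_ring_rel[OF subring]], of I f f]
      insert.prems(1) by (simp add: rel_poly_subring_iff)
  then have "(\<forall>i. coeff (f s) i \<in> M) \<or> (\<forall>i. coeff (prod f I) i \<in> M)"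
    using insert.prems insert.hyps by (intro M_poly_prime) simp_all
  then show ?case using insert by auto
qed

end

section \<open>Lifting Frobenius to an automorphism\<close>

text \<open>The resolvent \<open>H = \<Prod>\<^sub>\<sigma> (S - \<Sum>\<^sub>x \<sigma>(x) T\<^bsup>ix x\<^esup>)\<close> over all permutations \<open>\<sigma>\<close> of \<open>X\<close> induced by
  automorphisms has rational coefficients, on which Frobenius is the identity modulo \<open>M\<close>. Hence
  Frobenius maps the root \<open>\<Sum>\<^sub>x x T\<^bsup>ix x\<^esup>\<close> of \<open>H\<close> to another root modulo \<open>M\<close>.\<close>

lemma frobenius_lift:
  fixes X :: "complex set"
  assumes "place p B" "finite X" and X_qbar: "X \<subseteq> qbar" and X_B: "X \<subseteq> B"
    and X_inv: "\<And>\<gamma> x. qbar_aut \<gamma> \<Longrightarrow> x \<in> X \<Longrightarrow> \<gamma> x \<in> X"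
  shows "\<exists>\<gamma>. qbar_aut \<gamma> \<and> (\<forall>x\<in>X. place.frob p B x (\<gamma> x))"
proof -
  interpret place p B by fact
  \<comment> \<open>Distinct exponents let each value \<open>\<sigma> x\<close> be read off as a
    coefficient, so one congruence of polynomials yields the congruences for all \<open>x\<close>
    with the same \<open>\<sigma>\<close>.\<close>
  obtain ix :: "complex \<Rightarrow> nat" where ix: "inj_on ix X"
    using finite_imp_inj_to_nat_seg[OF assms(2)] by blast
  define G where "G = {restrict \<gamma> X |\<gamma>. qbar_aut \<gamma>}"
  have G_sub: "G \<subseteq> X \<rightarrow>\<^sub>E X"
    unfolding G_def using X_inv by auto
  have fin_G: "finite G"
    using finite_subset[OF G_sub] finite_PiE[of X "\<lambda>_. X"] assms(2) by blast
  have id_G: "restrict id X \<in> G"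
    unfolding G_def by (rule CollectI, rule exI[of _ id]) (simp add: qbar_aut_def)
  define Y where "Y f = (\<Sum>x\<in>X. monom (f x) (ix x))" for f :: "complex \<Rightarrow> complex"
  have Y_rel: "rel_poly R (Y f) (Y g)" if "ring_rel R" "\<And>x. x \<in> X \<Longrightarrow> R (f x) (g x)" for R f g
    unfolding Y_def
    by (intro ring_rel.sum[OF ring_rel.ring_rel_rel_poly] ring_rel.rel_poly_monom that)
  have Y_coeff: "coeff (Y f) (ix x) = f x" if "x \<in> X" for f x
  proof -
    have "coeff (Y f) (ix x) = (\<Sum>x'\<in>X. if x' = x then f x' else 0)"
      unfolding Y_def coeff_sum using ix that by (intro sum.cong) (auto dest: inj_onD)
    then show ?thesis using that assms(2) by simp
  qed
  define H where "H = (\<Prod>\<sigma>\<in>G. [:- Y \<sigma>, 1:])"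
  have H_rel: "rel_poly (rel_poly R) H (\<Prod>\<sigma>\<in>G. [:- Y (g \<sigma>), 1:])"
    if R: "ring_rel R" and "\<And>\<sigma> x. \<sigma> \<in> G \<Longrightarrow> x \<in> X \<Longrightarrow> R (\<sigma> x) (g \<sigma> x)" for R g
  proof -
    interpret R: ring_rel R by fact
    interpret P: ring_rel "rel_poly R" by (rule R.ring_rel_rel_poly)
    interpret PP: ring_rel "rel_poly (rel_poly R)" by (rule P.ring_rel_rel_poly)
    show ?thesis
      unfolding H_def
      by (intro PP.prod P.rel_poly_pCons P.uminus P.one PP.zero Y_rel[OF R] that(2))
  qed
  have in_qbar: "\<sigma> x \<in> qbar" "\<sigma> x \<in> B" if "\<sigma> \<in> G" "x \<in> X" for \<sigma> x
    using G_sub that X_qbar X_B by (auto simp: PiE_def Pi_def)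
  have coeff_qbar: "coeff (coeff H i) j \<in> qbar" and coeff_B: "coeff (coeff H i) j \<in> B" for i j
  proof -
    have "rel_poly (rel_poly (\<lambda>a b. a = b \<and> a \<in> qbar)) H (\<Prod>\<sigma>\<in>G. [:- Y \<sigma>, 1:])"
      by (rule H_rel[OF qbar.ring_rel_axioms, where g = "\<lambda>\<sigma>. \<sigma>"]) (simp add: in_qbar)
    from rel_polyD[OF rel_polyD[OF this, of i], of j] show "coeff (coeff H i) j \<in> qbar" by (rule conjunct2)
    have "rel_poly (rel_poly (\<lambda>a b. a = b \<and> a \<in> B)) H (\<Prod>\<sigma>\<in>G. [:- Y \<sigma>, 1:])"
      by (rule H_rel[OF is_subring_ring_rel[OF subring], where g = "\<lambda>\<sigma>. \<sigma>"]) (simp add: in_qbar)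
    from rel_polyD[OF rel_polyD[OF this, of i], of j] show "coeff (coeff H i) j \<in> B" by (rule conjunct2)
  qed
  have "\<gamma> (coeff (coeff H i) j) = coeff (coeff H i) j" if \<gamma>: "qbar_aut \<gamma>" for \<gamma> i j
  proof -
    \<comment> \<open>Composition with \<open>\<gamma>\<close> permutes the finite set
      \<open>G\<close>, hence only reorders the factors of \<open>H\<close>.\<close>
    define g where "g \<sigma> = restrict (\<gamma> \<circ> \<sigma>) X" for \<sigma>
    have "inj_on g G"
    proof (rule inj_onI)
      fix \<sigma> \<tau> assume st: "\<sigma> \<in> G" "\<tau> \<in> G" "g \<sigma> = g \<tau>"
      show "\<sigma> = \<tau>"
      proof (rule PiE_ext)
        show "\<sigma> \<in> X \<rightarrow>\<^sub>E X" "\<tau> \<in> X \<rightarrow>\<^sub>E X" using G_sub st by auto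
        fix x assume x: "x \<in> X"
        then have "\<gamma> (\<sigma> x) = \<gamma> (\<tau> x)"
          using fun_cong[OF st(3), of x] by (simp add: g_def)
        then show "\<sigma> x = \<tau> x"
          using qbar_autD(4)[OF \<gamma>] in_qbar(1) st(1,2) x by blast
      qed
    qed
    moreover have "g ` G \<subseteq> G"
    proof (rule image_subsetI)
      fix \<sigma> assume "\<sigma> \<in> G"
      then obtain \<alpha> where \<alpha>: "qbar_aut \<alpha>" "\<sigma> = restrict \<alpha> X" unfolding G_def by blast
      have "g \<sigma> = restrict (\<gamma> \<circ> \<alpha>) X"
        unfolding g_def \<alpha>(2) by (simp add: restrict_def fun_eq_iff)
      then show "g \<sigma> \<in> G"
        unfolding G_def using qbar_aut_comp[OF \<gamma> \<alpha>(1)] by blast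
    qed
    ultimately have gG: "bij_betw g G G"
      unfolding bij_betw_def by (intro conjI endo_inj_surj[OF fin_G])
    have "rel_poly (rel_poly (\<lambda>a b. a \<in> qbar \<and> b = \<gamma> a)) H (\<Prod>\<sigma>\<in>G. [:- Y (g \<sigma>), 1:])"
      by (rule H_rel[OF field_rel.axioms(1)[OF qbar_aut_field_rel[OF \<gamma>]]]) (simp add: g_def in_qbar)
    also have "(\<Prod>\<sigma>\<in>G. [:- Y (g \<sigma>), 1:]) = H"
      unfolding H_def by (rule prod.reindex_bij_betw[OF gG])
    finally have "rel_poly (rel_poly (\<lambda>a b. a \<in> qbar \<and> b = \<gamma> a)) H H" .
    from rel_polyD[OF rel_polyD[OF this, of i], of j] show ?thesis
      by (rule conjunct2[THEN sym])
  qed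
  then have "coeff (coeff H i) j \<in> \<rat>" for i j
    by (intro fixed_field_Rats coeff_qbar)
  then have H_frob: "rel_poly (rel_poly frob) H H"
    unfolding rel_poly_def by (intro allI frob_Rats coeff_B)
  interpret F: ring_rel frob by (rule frob_ring_rel)
  interpret FP: ring_rel "rel_poly frob" by (rule F.ring_rel_rel_poly)
  \<comment> \<open>Here Frobenius acts on the coefficients and leaves the indeterminate alone, so
    \<open>Y\<close> of the identity goes to \<open>Y\<close> of the p-th powers.\<close>
  have "rel_poly frob (poly H (Y (restrict id X))) (poly H (Y (\<lambda>x. x ^ p)))"
    using H_frob by (rule FP.poly_rel) (rule Y_rel[OF frob_ring_rel], use X_B frob_power in \<open>simp add: subset_iff\<close>)
  moreover have "poly H (Y (restrict id X)) = 0"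
    unfolding H_def poly_prod using fin_G id_G by (intro prod_zero) auto
  ultimately have "rel_poly frob 0 (poly H (Y (\<lambda>x. x ^ p)))" by simp
  moreover have "poly H (Y (\<lambda>x. x ^ p)) = (\<Prod>\<sigma>\<in>G. Y (\<lambda>x. x ^ p) - Y \<sigma>)"
    unfolding H_def poly_prod by simp
  ultimately have "frob 0 (coeff (\<Prod>\<sigma>\<in>G. Y (\<lambda>x. x ^ p) - Y \<sigma>) i)" for i
    using rel_polyD[of frob 0 _ i] by simp
  then have coeff_M: "coeff (\<Prod>\<sigma>\<in>G. Y (\<lambda>x. x ^ p) - Y \<sigma>) i \<in> M" for i
    using M_uminus[of "- coeff (\<Prod>\<sigma>\<in>G. Y (\<lambda>x. x ^ p) - Y \<sigma>) i"] prime_gt_0_nat[OF prime]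
    by (simp add: frob_def zero_power)
  have "coeff (Y (\<lambda>x. x ^ p) - Y \<sigma>) i \<in> B" if "\<sigma> \<in> G" for \<sigma> i
  proof -
    have *: "rel_poly (\<lambda>a b. a = b \<and> a \<in> B) (Y f) (Y f)" if "\<And>x. x \<in> X \<Longrightarrow> f x \<in> B" for f
      by (rule Y_rel[OF is_subring_ring_rel[OF subring]]) (use that in auto)
    have "rel_poly (\<lambda>a b. a = b \<and> a \<in> B) (Y (\<lambda>x. x ^ p)) (Y (\<lambda>x. x ^ p))"
      "rel_poly (\<lambda>a b. a = b \<and> a \<in> B) (Y \<sigma>) (Y \<sigma>)"
      by (rule *, use X_B B_power in blast) (rule *, rule in_qbar(2)[OF that])
    then show ?thesis
      unfolding rel_poly_subring_iff using is_subringD(3)[OF subring] by simp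
  qed
  then have "\<exists>\<sigma>\<in>G. \<forall>i. coeff (Y (\<lambda>x. x ^ p) - Y \<sigma>) i \<in> M"
    by (rule M_poly_prime_prod[OF fin_G _ coeff_M])
  then obtain \<sigma> where \<sigma>: "\<sigma> \<in> G" "\<forall>i. coeff (Y (\<lambda>x. x ^ p) - Y \<sigma>) i \<in> M"
    by blast
  then obtain \<gamma> where \<gamma>: "qbar_aut \<gamma>" "\<sigma> = restrict \<gamma> X" unfolding G_def by blast
  have "frob x (\<gamma> x)" if "x \<in> X" for x
  proof -
    have "coeff (Y (\<lambda>x. x ^ p) - Y \<sigma>) (ix x) \<in> M"
      using \<sigma>(2) by blast
    then have "x ^ p - \<gamma> x \<in> M"
      using that by (simp add: Y_coeff \<gamma>(2))
    moreover have "x \<in> B" "\<gamma> x \<in> B"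
      using X_B that X_inv[OF \<gamma>(1) that] by blast+
    ultimately show ?thesis by (simp add: frob_def)
  qed
  then show ?thesis using \<gamma>(1) by blast
qed

section \<open>Automorphisms acting on five numbers\<close>

locale aut_action =
  fixes X :: "complex set"
  assumes X_qbar: "X \<subseteq> qbar"
    and X_inv: "\<And>\<gamma> x. qbar_aut \<gamma> \<Longrightarrow> x \<in> X \<Longrightarrow> \<gamma> x \<in> X"
    and card_X: "card X = 5"
begin

lemma aut_eq_iff: "qbar_aut \<gamma> \<Longrightarrow> x \<in> X \<Longrightarrow> y \<in> X \<Longrightarrow> \<gamma> x = \<gamma> y \<longleftrightarrow> x = y"
  using qbar_autD(4) X_qbar by blast

lemma finite_X: "finite X"
  using card_X by (metis card.infinite zero_neq_numeral)

lemma X_eq: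
  assumes "{a, b, d, e, g} \<subseteq> X" "distinct [a, b, d, e, g]"
  shows "X = {a, b, d, e, g}"
proof -
  have "card {a, b, d, e, g} = card X"
    using distinct_card[OF assms(2)] card_X by simp
  then show ?thesis
    using card_subset_eq[OF finite_X assms(1)] by simp
qed

lemma obtain_new:
  assumes "length xs < 5"
  obtains e where "e \<in> X" "e \<notin> set xs"
proof -
  have "\<not> X \<subseteq> set xs"
  proof
    assume "X \<subseteq> set xs"
    then have "card X \<le> card (set xs)" by (intro card_mono) simp_all
    then show False using card_length[of xs] card_X assms by simp
  qed
  then show thesis using that by blast
qed

text \<open>The transposition of \<open>u\<close> and \<open>v\<close> is induced by an
  automorphism; \<open>u = v\<close> is allowed, which makes this an equivalence relation on
  \<open>X\<close>.\<close>

definition swaps :: "complex \<Rightarrow> complex \<Rightarrow> bool" where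
  "swaps u v \<longleftrightarrow> (\<exists>\<gamma>. qbar_aut \<gamma> \<and> \<gamma> u = v \<and> \<gamma> v = u \<and> (\<forall>w\<in>X. w \<noteq> u \<longrightarrow> w \<noteq> v \<longrightarrow> \<gamma> w = w))"

lemma swaps_refl: "swaps u u"
  unfolding swaps_def by (intro exI[of _ id]) (simp add: qbar_aut_def)

text \<open>Conjugating the transposition (u v) by (v w) gives (u w).\<close>

lemma swaps_trans:
  assumes "swaps u v" "swaps v w" "u \<in> X" "v \<in> X" "w \<in> X"
  shows "swaps u w"
proof (cases "u = v \<or> v = w \<or> u = w")
  case True
  then show ?thesis using assms(1,2) swaps_refl by auto
next
  case False
  obtain \<alpha> where \<alpha>: "qbar_aut \<alpha>" "\<alpha> u = v" "\<alpha> v = u"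
    "\<And>x. x \<in> X \<Longrightarrow> x \<noteq> u \<Longrightarrow> x \<noteq> v \<Longrightarrow> \<alpha> x = x"
    using assms(1) unfolding swaps_def by blast
  obtain \<beta> where \<beta>: "qbar_aut \<beta>" "\<beta> v = w" "\<beta> w = v"
    "\<And>x. x \<in> X \<Longrightarrow> x \<noteq> v \<Longrightarrow> x \<noteq> w \<Longrightarrow> \<beta> x = x"
    using assms(2) unfolding swaps_def by blast
  have "qbar_aut (\<beta> \<circ> (\<alpha> \<circ> \<beta>))"
    by (intro qbar_aut_comp \<alpha>(1) \<beta>(1))
  moreover have "\<beta> (\<alpha> (\<beta> u)) = w" "\<beta> (\<alpha> (\<beta> w)) = u"
    using False assms(3-5) by (simp_all add: \<alpha>(2,3) \<beta>(2,3) \<beta>(4)[of u])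
  moreover have "\<beta> (\<alpha> (\<beta> x)) = x" if "x \<in> X" "x \<noteq> u" "x \<noteq> w" for x
  proof (cases "x = v")
    case True
    have "\<alpha> w = w"
      using False assms(5) by (intro \<alpha>(4)) auto
    then show ?thesis using True by (simp add: \<beta>(2,3))
  next
    case False
    then show ?thesis using that by (simp add: \<alpha>(4) \<beta>(4))
  qed
  ultimately show ?thesis
    unfolding swaps_def by (intro exI[of _ "\<beta> \<circ> (\<alpha> \<circ> \<beta>)"]) simp
qed

lemma swaps_image:
  assumes "qbar_aut \<gamma>" "swaps u v" "u \<in> X" "v \<in> X"
  shows "swaps (\<gamma> u) (\<gamma> v)"
proof -
  obtain \<alpha> where \<alpha>: "qbar_aut \<alpha>" "\<alpha> u = v" "\<alpha> v = u"
    "\<And>x. x \<in> X \<Longrightarrow> x \<noteq> u \<Longrightarrow> x \<noteq> v \<Longrightarrow> \<alpha> x = x"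
    using assms(2) unfolding swaps_def by blast
  define \<delta> where "\<delta> = inv_into qbar \<gamma>"
  have \<delta>: "qbar_aut \<delta>"
    unfolding \<delta>_def by (rule qbar_aut_inv[OF assms(1)])
  have bij: "bij_betw \<gamma> qbar qbar" using assms(1) by (simp add: qbar_aut_def)
  have inv: "\<delta> (\<gamma> x) = x" "\<gamma> (\<delta> x) = x" if "x \<in> X" for x
    using that X_qbar bij_betw_inv_into_left[OF bij] bij_betw_inv_into_right[OF bij]
    unfolding \<delta>_def by blast+
  have "qbar_aut (\<gamma> \<circ> (\<alpha> \<circ> \<delta>))"
    by (intro qbar_aut_comp \<alpha>(1) \<delta> assms(1))
  moreover have "\<gamma> (\<alpha> (\<delta> w)) = w" if "w \<in> X" "w \<noteq> \<gamma> u" "w \<noteq> \<gamma> v" for w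
  proof -
    have "\<delta> w \<noteq> u" "\<delta> w \<noteq> v" using that inv(2) by auto
    then have "\<alpha> (\<delta> w) = \<delta> w"
      using X_inv[OF \<delta> that(1)] by (intro \<alpha>(4))
    then show ?thesis using inv(2)[OF that(1)] by simp
  qed
  ultimately show ?thesis
    unfolding swaps_def using inv(1) assms(3,4) \<alpha>(2,3)
    by (intro exI[of _ "\<gamma> \<circ> (\<alpha> \<circ> \<delta>)"]) simp
qed

text \<open>Any cycle type on five points other than a single 5-cycle contains a cycle of length 1
  or 2: an orbit of length 3 leaves two points to be exchanged, one of length 4 leaves a fixed
  point.\<close>

lemma five_cycle:
  assumes c: "qbar_aut c" "\<And>x. x \<in> X \<Longrightarrow> c x \<noteq> x" "\<And>x. x \<in> X \<Longrightarrow> c (c x) \<noteq> x" and a: "a \<in> X"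
  shows "X = {a, c a, c (c a), c (c (c a)), c (c (c (c a)))}" "c (c (c (c (c a)))) = a"
proof -
  note eq = aut_eq_iff[OF c(1)]
  have X: "a \<in> X" "c a \<in> X" "c (c a) \<in> X" "c (c (c a)) \<in> X" "c (c (c (c a))) \<in> X"
    "c (c (c (c (c a)))) \<in> X"
    using X_inv[OF c(1)] a by simp_all
  have 3: "c (c (c a)) \<noteq> a"
  proof
    assume 3: "c (c (c a)) = a"
    obtain u where u: "u \<in> X" "u \<notin> set [a, c a, c (c a)]"
      using obtain_new[of "[a, c a, c (c a)]"] by auto
    obtain v where v: "v \<in> X" "v \<notin> set [a, c a, c (c a), u]"
      using obtain_new[of "[a, c a, c (c a), u]"] by auto
    have eqX: "X = {a, c a, c (c a), u, v}"
      using X u v c(2,3)[of a] c(2)[of "c a"] by (intro X_eq) auto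
    have cX: "c w \<in> {a, c a, c (c a), u, v}" if "w \<in> X" for w
      using X_inv[OF c(1) that] unfolding eqX .
    have "c w \<noteq> a" "c w \<noteq> c a" "c w \<noteq> c (c a)" if "w \<in> X" "w \<notin> {a, c a, c (c a)}" for w
      using that eq[of w a] eq[of w "c a"] eq[of w "c (c a)"] X 3 by auto
    then have "c u = v" "c v = u"
      using cX[of u] cX[of v] u v c(2)[of u] c(2)[of v] by auto
    then show False using c(3)[of u] u(1) by simp
  qed
  have 4: "c (c (c (c a))) \<noteq> a"
  proof
    assume 4: "c (c (c (c a))) = a"
    obtain u where u: "u \<in> X" "u \<notin> set [a, c a, c (c a), c (c (c a))]"
      using obtain_new[of "[a, c a, c (c a), c (c (c a))]"] by auto
    have eqX: "X = {a, c a, c (c a), c (c (c a)), u}"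
      using X u c(2,3)[of a] c(2,3)[of "c a"] c(2)[of "c (c a)"] 3 by (intro X_eq) auto
    have "c u \<in> {a, c a, c (c a), c (c (c a)), u}"
      using X_inv[OF c(1) u(1)] unfolding eqX .
    moreover have "c u \<noteq> a" "c u \<noteq> c a" "c u \<noteq> c (c a)" "c u \<noteq> c (c (c a))" "c u \<noteq> u"
      using u eq[of u a] eq[of u "c a"] eq[of u "c (c a)"] eq[of u "c (c (c a))"] X 4 c(2)[of u]
      by auto
    ultimately show False by blast
  qed
  have ne: "a \<noteq> c a" "a \<noteq> c (c a)" "a \<noteq> c (c (c a))" "a \<noteq> c (c (c (c a)))"
    using c(2,3)[OF a] 3 4 by metis+
  show eqX: "X = {a, c a, c (c a), c (c (c a)), c (c (c (c a)))}"
    using X ne by (intro X_eq) (auto simp: eq)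
  have "c (c (c (c (c a)))) \<in> {a, c a, c (c a), c (c (c a)), c (c (c (c a)))}"
    using X(6) unfolding eqX .
  then show "c (c (c (c (c a)))) = a"
    using X ne by (auto simp: eq)
qed

text \<open>Three points remain beside the 2-cycle, and a permutation of three points without fixed
  points is a 3-cycle.\<close>

lemma three_cycle_fixed_point_free:
  assumes t: "qbar_aut t" "\<And>x. x \<in> X \<Longrightarrow> t x \<noteq> x" and a: "a \<in> X" "t (t a) = a"
    and u: "u \<in> X" "u \<noteq> a" "u \<noteq> t a"
  shows "t (t (t u)) = u"
proof -
  note eq = aut_eq_iff[OF t(1)]
  have ta: "t a \<in> X" "t a \<noteq> a" using X_inv[OF t(1)] t(2) a by blast+
  obtain v where v: "v \<in> X" "v \<notin> set [a, t a, u]"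
    using obtain_new[of "[a, t a, u]"] by auto
  obtain w where w: "w \<in> X" "w \<notin> set [a, t a, u, v]"
    using obtain_new[of "[a, t a, u, v]"] by auto
  have eqX: "X = {a, t a, u, v, w}"
    using a ta u v w by (intro X_eq) auto
  have tX: "t x \<in> {u, v, w} - {x}" if "x \<in> {u, v, w}" for x
  proof -
    have x: "x \<in> X" "x \<noteq> a" "x \<noteq> t a" using that u v w by auto
    then have "t x \<noteq> t a" "t x \<noteq> a" "t x \<noteq> x"
      using eq[of x a] eq[of x "t a"] a ta t(2) by auto
    moreover have "t x \<in> {a, t a, u, v, w}"
      using X_inv[OF t(1) x(1)] unfolding eqX .
    ultimately show ?thesis by blast
  qed
  have "t u = v \<or> t u = w" "t v = u \<or> t v = w" "t w = u \<or> t w = v"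
    using tX[of u] tX[of v] tX[of w] by blast+
  moreover have "t u \<noteq> t v" "t u \<noteq> t w" "t v \<noteq> t w"
    using eq u(1) v w(1,2) by simp_all metis+
  ultimately show ?thesis by metis
qed

text \<open>The equivalence \<open>swaps\<close> is preserved by the 5-cycle \<open>c\<close>. As
  \<open>t a\<close> is the image of \<open>a\<close> under a nontrivial power of \<open>c\<close>
  and 5 is prime, translates of the pair \<open>a\<close>, \<open>t a\<close> connect all five
  points; the cases are the four powers.\<close>

lemma swaps_all:
  assumes c: "qbar_aut c" "\<And>x. x \<in> X \<Longrightarrow> c x \<noteq> x" "\<And>x. x \<in> X \<Longrightarrow> c (c x) \<noteq> x"
    and t: "qbar_aut t" "\<And>x. x \<in> X \<Longrightarrow> t x \<noteq> x" and a: "a \<in> X" "t (t a) = a"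
    and uv: "u \<in> X" "v \<in> X"
  shows "swaps u v"
proof -
  have "swaps a (t a)"
    unfolding swaps_def
  proof (intro exI conjI ballI impI)
    \<comment> \<open>Since \<open>t\<close> has cycle type 2 + 3, its cube is the transposition of
      \<open>a\<close> and \<open>t a\<close>.\<close>
    show "qbar_aut (t \<circ> (t \<circ> t))" by (intro qbar_aut_comp t(1))
  qed (use a(2) three_cycle_fixed_point_free[OF t a] in simp_all)
  moreover have "t a \<noteq> a" "t a \<in> X"
    using t a X_inv by blast+
  define x1 where "x1 = c a"
  define x2 where "x2 = c x1"
  define x3 where "x3 = c x2"
  define x4 where "x4 = c x3"
  note x_defs = x1_def x2_def x3_def x4_def
  have X: "X = {a, x1, x2, x3, x4}" and cx4: "c x4 = a"
    using five_cycle[OF c a(1)] unfolding x_defs by simp_all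
  have shift: "swaps (c y) (c z)" if "swaps y z" "y \<in> X" "z \<in> X" for y z
    using swaps_image[OF c(1)] that by blast
  have cx: "c a = x1" "c x1 = x2" "c x2 = x3" "c x3 = x4"
    by (simp_all add: x_defs)
  have in_X: "a \<in> X" "x1 \<in> X" "x2 \<in> X" "x3 \<in> X" "x4 \<in> X"
    unfolding X by simp_all
  have sym: "swaps z y" if "swaps y z" for y z
    using that unfolding swaps_def by blast
  have all: "swaps a y" if "y \<in> X" for y
  proof -
    consider "t a = x1" | "t a = x2" | "t a = x3" | "t a = x4"
      using \<open>t a \<in> X\<close> \<open>t a \<noteq> a\<close> X by blast
    then have "swaps a x1 \<and> swaps a x2 \<and> swaps a x3 \<and> swaps a x4"
    proof cases
      case 1
      then have s: "swaps a x1" using \<open>swaps a (t a)\<close> by simp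
      have s1: "swaps x1 x2" using shift[OF s] in_X cx by simp
      have s2: "swaps x2 x3" using shift[OF s1] in_X cx by simp
      have s3: "swaps x3 x4" using shift[OF s2] in_X cx by simp
      have r2: "swaps a x2" using swaps_trans[OF s s1] in_X by simp
      have r3: "swaps a x3" using swaps_trans[OF r2 s2] in_X by simp
      have r4: "swaps a x4" using swaps_trans[OF r3 s3] in_X by simp
      show ?thesis by (intro conjI s r2 r3 r4)
    next
      case 2
      then have s: "swaps a x2" using \<open>swaps a (t a)\<close> by simp
      have s1: "swaps x1 x3" using shift[OF s] in_X cx by simp
      have s2: "swaps x2 x4" using shift[OF s1] in_X cx by simp
      have s3: "swaps x3 a" using shift[OF s2] in_X cx cx4 by simp
      have r4: "swaps a x4" using swaps_trans[OF s s2] in_X by simp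
      have r1: "swaps a x1" using swaps_trans[OF sym[OF s3] sym[OF s1]] in_X by simp
      show ?thesis by (intro conjI s r1 r4 sym[OF s3])
    next
      case 3
      then have s: "swaps a x3" using \<open>swaps a (t a)\<close> by simp
      have s1: "swaps x1 x4" using shift[OF s] in_X cx by simp
      have s2: "swaps x2 a" using shift[OF s1] in_X cx cx4 by simp
      have s3: "swaps x3 x1" using shift[OF s2] in_X cx by simp
      have r1: "swaps a x1" using swaps_trans[OF s s3] in_X by simp
      have r4: "swaps a x4" using swaps_trans[OF r1 s1] in_X by simp
      show ?thesis by (intro conjI s r1 r4 sym[OF s2])
    next
      case 4
      then have s: "swaps a x4" using \<open>swaps a (t a)\<close> by simp
      have s1: "swaps x1 a" using shift[OF s] in_X cx cx4 by simp
      have s2: "swaps x2 x1" using shift[OF s1] in_X cx by simp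
      have s3: "swaps x3 x2" using shift[OF s2] in_X cx by simp
      have r2: "swaps a x2" using swaps_trans[OF sym[OF s1] sym[OF s2]] in_X by simp
      have r3: "swaps a x3" using swaps_trans[OF r2 sym[OF s3]] in_X by simp
      show ?thesis by (intro conjI s sym[OF s1] r2 r3)
    qed
    then show ?thesis using that swaps_refl X by blast
  qed
  show ?thesis
    using swaps_trans[OF sym[OF all[OF uv(1)]] all[OF uv(2)]] uv a(1) by blast
qed

definition three_cycle :: "(complex \<Rightarrow> complex) \<Rightarrow> complex \<Rightarrow> complex \<Rightarrow> complex \<Rightarrow> bool" where
  "three_cycle \<gamma> a b d \<longleftrightarrow> \<gamma> a = b \<and> \<gamma> b = d \<and> \<gamma> d = a \<and>
     (\<forall>w\<in>X. w \<noteq> a \<longrightarrow> w \<noteq> b \<longrightarrow> w \<noteq> d \<longrightarrow> \<gamma> w = w)"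

text \<open>The five elements make every 3-cycle a commutator of 3-cycles:
  \<open>(a b d) = [(a b e), (a d g)]\<close>.\<close>

lemma three_cycle_in_derived_auts:
  assumes swaps: "\<And>u v. u \<in> X \<Longrightarrow> v \<in> X \<Longrightarrow> swaps u v"
    and abd: "a \<in> X" "b \<in> X" "d \<in> X" "distinct [a, b, d]"
  shows "\<exists>\<kappa>\<in>derived_auts n. three_cycle \<kappa> a b d"
  using abd
proof (induction n arbitrary: a b d)
  case 0
  obtain \<alpha> where \<alpha>: "qbar_aut \<alpha>" "\<alpha> a = b" "\<alpha> b = a"
    "\<And>x. x \<in> X \<Longrightarrow> x \<noteq> a \<Longrightarrow> x \<noteq> b \<Longrightarrow> \<alpha> x = x"
    using swaps[OF 0(1,2)] unfolding swaps_def by blast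
  obtain \<beta> where \<beta>: "qbar_aut \<beta>" "\<beta> b = d" "\<beta> d = b"
    "\<And>x. x \<in> X \<Longrightarrow> x \<noteq> b \<Longrightarrow> x \<noteq> d \<Longrightarrow> \<beta> x = x"
    using swaps[OF 0(2,3)] unfolding swaps_def by blast
  have "three_cycle (\<alpha> \<circ> \<beta>) a b d"
    using 0 unfolding three_cycle_def by (auto simp: \<alpha> \<beta>)
  then show ?case
    using qbar_aut_comp[OF \<alpha>(1) \<beta>(1)] by (intro bexI[of _ "\<alpha> \<circ> \<beta>"]) (simp_all only: derived_auts.simps(1) mem_Collect_eq)
next
  case (Suc n)
  obtain e where e: "e \<in> X" "e \<notin> set [a, b, d]"
    using obtain_new[of "[a, b, d]"] by auto
  obtain g where g: "g \<in> X" "g \<notin> set [a, b, d, e]"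
    using obtain_new[of "[a, b, d, e]"] by auto
  have X: "X = {a, b, d, e, g}"
    using Suc.prems e g by (intro X_eq) auto
  obtain \<gamma> where \<gamma>: "\<gamma> \<in> derived_auts n" "three_cycle \<gamma> a b e"
    using Suc.IH[of a b e] Suc.prems e by auto
  obtain \<delta> where \<delta>: "\<delta> \<in> derived_auts n" "three_cycle \<delta> a d g"
    using Suc.IH[of a d g] Suc.prems g by auto
  note aut = derived_auts_qbar_aut[OF \<gamma>(1)] derived_auts_qbar_aut[OF \<delta>(1)]
  define \<kappa> where "\<kappa> = (\<gamma> \<circ> \<delta>) \<circ> inv_into qbar (\<delta> \<circ> \<gamma>)"
  have dg: "qbar_aut (\<delta> \<circ> \<gamma>)" by (intro qbar_aut_comp aut)
  then have bij: "bij_betw (\<delta> \<circ> \<gamma>) qbar qbar" by (simp add: qbar_aut_def)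
  have \<kappa>: "\<kappa> (\<delta> (\<gamma> x)) = \<gamma> (\<delta> x)" if "x \<in> qbar" for x
    using bij_betw_inv_into_left[OF bij that] by (simp add: \<kappa>_def)
  have "qbar_aut \<kappa>"
    unfolding \<kappa>_def by (intro qbar_aut_comp qbar_aut_inv dg aut)
  then have "\<kappa> \<in> derived_auts (Suc n)"
    unfolding derived_auts.simps(2) mem_Collect_eq
    by (intro conjI bexI[OF _ \<gamma>(1)] bexI[OF _ \<delta>(1)] ballI \<kappa>)
  moreover have "three_cycle \<kappa> a b d"
  proof -
    have \<gamma>': "\<gamma> a = b" "\<gamma> b = e" "\<gamma> e = a" "\<gamma> d = d" "\<gamma> g = g"
      using \<gamma>(2) Suc.prems e g unfolding three_cycle_def by auto
    have \<delta>': "\<delta> a = d" "\<delta> d = g" "\<delta> g = a" "\<delta> b = b" "\<delta> e = e"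
      using \<delta>(2) Suc.prems e g unfolding three_cycle_def by auto
    have in_qbar: "a \<in> qbar" "b \<in> qbar" "d \<in> qbar" "e \<in> qbar" "g \<in> qbar"
      using X_qbar unfolding X by simp_all
    have "\<kappa> a = b" "\<kappa> b = d" "\<kappa> d = a" "\<kappa> e = e" "\<kappa> g = g"
      using \<kappa>[OF in_qbar(5)] \<kappa>[OF in_qbar(1)] \<kappa>[OF in_qbar(4)] \<kappa>[OF in_qbar(2)] \<kappa>[OF in_qbar(3)]
      by (simp_all add: \<gamma>' \<delta>')
    moreover have "w = e \<or> w = g" if "w \<in> X" "w \<noteq> a" "w \<noteq> b" "w \<noteq> d" for w
      using that X by blast
    ultimately show ?thesis
      unfolding three_cycle_def by blast
  qed
  ultimately show ?case by blast
qed

lemma not_radical_number: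
  assumes swaps: "\<And>u v. u \<in> X \<Longrightarrow> v \<in> X \<Longrightarrow> swaps u v" and a: "a \<in> X"
  shows "\<not> radical_number a"
proof
  assume "radical_number a"
  then obtain n where n: "\<forall>\<kappa>\<in>derived_auts n. \<kappa> a = a"
    unfolding radical_number_def by blast
  obtain b where b: "b \<in> X" "b \<notin> set [a]"
    using obtain_new[of "[a]"] by auto
  obtain d where d: "d \<in> X" "d \<notin> set [a, b]"
    using obtain_new[of "[a, b]"] by auto
  have "distinct [a, b, d]" using b(2) d(2) by auto
  then obtain \<kappa> where \<kappa>: "\<kappa> \<in> derived_auts n" "three_cycle \<kappa> a b d"
    using three_cycle_in_derived_auts[OF swaps a b(1) d(1)] by blast
  have "\<kappa> a = a" using n \<kappa>(1) by blast
  moreover have "\<kappa> a = b" using \<kappa>(2) by (simp add: three_cycle_def)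
  ultimately show False using b(2) by simp
qed

end

section \<open>An unsolvable quintic\<close>

context place
begin

definition cong_M :: "'a \<Rightarrow> 'a \<Rightarrow> bool" where
  "cong_M a b \<longleftrightarrow> a \<in> B \<and> b \<in> B \<and> a - b \<in> M"

lemma cong_M_ring_rel: "ring_rel cong_M"
proof
  show "cong_M 0 0" "cong_M 1 1"
    by (simp_all add: cong_M_def zero_in_M is_subringD[OF subring])
next
  fix a b c d assume *: "cong_M a b" "cong_M c d"
  then have B: "a \<in> B" "b \<in> B" "c \<in> B" "d \<in> B" and M: "a - b \<in> M" "c - d \<in> M"
    by (simp_all add: cong_M_def)
  show "cong_M (a + c) (b + d)"
    using M_add[OF M] B is_subringD(6)[OF subring] by (simp add: cong_M_def algebra_simps)
  have "c * (a - b) + b * (c - d) \<in> M"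
    using M B by (intro M_add M_mult)
  then show "cong_M (a * c) (b * d)"
    using B is_subringD(4)[OF subring] by (simp add: cong_M_def algebra_simps)
next
  fix a b assume "cong_M a b"
  then show "cong_M (- a) (- b)"
    using M_uminus[of "a - b"] is_subringD(5)[OF subring] by (simp add: cong_M_def)
qed

lemma frob_imp_cong_M: "frob a b \<Longrightarrow> cong_M (a ^ p) b"
  by (simp add: frob_def cong_M_def B_power)

lemma cong_M_sym: "cong_M a b \<Longrightarrow> cong_M b a"
  using M_uminus[of "a - b"] by (simp add: cong_M_def)

lemma cong_M_trans: "cong_M a b \<Longrightarrow> cong_M b c \<Longrightarrow> cong_M a c"
  using M_add[of "a - b" "b - c"] by (simp add: cong_M_def)

lemma poly_of_int_in_B: "b \<in> B \<Longrightarrow> poly (map_poly of_int P) b \<in> B"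
  using ring_rel.poly_rel[OF is_subring_ring_rel[OF subring], of "map_poly of_int P" "map_poly of_int P" b b]
  by (simp add: rel_poly_subring_iff coeff_map_poly B_of_int)

lemma poly_of_int_cong_M: "cong_M a b \<Longrightarrow> cong_M (poly (map_poly of_int P) a) (poly (map_poly of_int P) b)"
  by (rule ring_rel.poly_rel[OF cong_M_ring_rel])
    (simp_all add: rel_poly_def coeff_map_poly ring_rel.of_int[OF cong_M_ring_rel])

text \<open>The identity expresses that \<open>F\<close> and \<open>G\<close> are coprime modulo p.
  Evaluated at \<open>b\<close>, it would put 1 into \<open>M\<close>.\<close>

lemma bezout_no_common_root:
  assumes "U * G + V * F = 1 + [:int p:] * W" "b \<in> B"
    and "poly (map_poly of_int F) b = 0" "poly (map_poly of_int G) b \<in> M"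
  shows False
proof -
  have hom: "map_poly of_int (U * G + V * F) = (map_poly of_int (1 + [:int p:] * W) :: 'a poly)"
    using assms(1) by simp
  have map_p: "map_poly of_int [:int p:] = ([:of_nat p:] :: 'a poly)"
    by (rule poly_eqI) (simp add: coeff_map_poly coeff_pCons split: nat.split)
  have "map_poly of_int U * map_poly of_int G + map_poly of_int V * map_poly of_int F =
      (1 + [:of_nat p:] * map_poly of_int W :: 'a poly)"
    using hom unfolding of_int_poly_hom.hom_add of_int_poly_hom.hom_mult of_int_poly_hom.hom_one map_p by assumption
  then have "poly (map_poly of_int U * map_poly of_int G + map_poly of_int V * map_poly of_int F) b =
      poly (1 + [:of_nat p:] * map_poly of_int W) b"
    by simp
  then have "1 = poly (map_poly of_int U) b * poly (map_poly of_int G) b -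
      poly (map_poly of_int W) b * of_nat p"
    using assms(3) by (simp add: algebra_simps)
  also have "\<dots> \<in> M"
    using assms(2,4) by (intro M_diff M_mult poly_of_int_in_B p_in_M)
  finally show False using one_notin_M by simp
qed

end

definition quintic :: "int poly" where
  "quintic = [:3, 9, 2, - 8, - 1, 1:]"

abbreviation cquintic :: "complex poly" where
  "cquintic \<equiv> map_poly of_int quintic"

lemma cquintic_eq: "cquintic = [:3, 9, 2, - 8, - 1, 1:]"
  by (simp add: quintic_def map_poly_pCons)

definition quintic_roots :: "complex set" where
  "quintic_roots = {y. poly cquintic y = 0}"

text \<open>The coefficients of the following identities come from the extended Euclidean algorithm modulo
  5 and 7. Modulo \<open>quintic\<close>, the fifth power is \<open>[:- 3, - 9, - 2, 8, 1:]\<close>, so that the composition in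
  the first identity stands for the 25th power.\<close>

lemma coprime_mod_5:
  "[:- 1, 0, - 1, 0, - 1:] * (pcompose [:- 3, - 9, - 2, 8, 1:] [:- 3, - 9, - 2, 8, 1:] - [:0, 1:]) +
   [:- 1, - 2, - 2, 1, 1, - 2, 1, - 2, - 1, 1, 2, - 1, 2, - 2, - 2, 1:] * quintic =
   1 + [:int 5:] * [:25, 197, 389, - 419, - 1884, - 310, 3477, 1964, - 2671, - 1291, 2364, 716,
     - 3382, - 2136, 2325, 1724, - 415, - 366, - 77, - 7:]"
  by (simp add: quintic_def pcompose_pCons one_pCons)

text \<open>No root in the field with seven elements, so a lift of Frobenius fixes no root of the
  quintic.\<close>

lemma coprime_mod_7:
  "[:- 1, - 2, - 1, - 3, - 1:] * [:0, - 1, 0, 0, 0, 0, 0, 1:] +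
   [:- 2, 1, 0, 3, - 1, - 3, 1:] * quintic =
   1 + [:int 7:] * [:- 1, - 2, 1, 4, 3, - 2, - 7, 1, 4, - 1, - 1:]"
  by (simp add: quintic_def one_pCons)

text \<open>Keeps distinct roots distinct modulo \<open>M\<close>, so that congruences between roots
  become equalities.\<close>

lemma separable_mod_7:
  "[:- 3, 0, 2, 2, - 3:] * pderiv quintic + [:0, - 3, 0, 1:] * quintic =
   1 + [:int 7:] * [:- 4, - 3, 9, 5, - 7, - 9, 9, 3, - 2:]"
  by (simp add: quintic_def pderiv_pCons one_pCons)

lemma quintic_factor_mod_7:
  "quintic = [:2, - 2, 1:] * [:- 2, - 1, 1, 1:] + [:int 7:] * [:1, 1, 0, - 1:]"
  by (simp add: quintic_def)

text \<open>The roots of the quadratic factor have sum 2; modulo 7, the seventh power sends a root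
  \<open>y\<close> to the other one, \<open>2 - y\<close>.\<close>

lemma power_7_mod_factor:
  "[:0, 0, 0, 0, 0, 0, 0, 1:] =
   [:2, - 2, 1:] * [:- 1, 3, 0, 2, 2, 1:] + [:2, - 1:] + [:int 7:] * [:0, - 1, 1, - 1:]"
  by simp

section \<open>Roots of the quintic and their automorphisms\<close>

lemma degree_cquintic: "degree cquintic = 5"
  by (simp add: cquintic_eq)

lemma quintic_roots_qbar: "quintic_roots \<subseteq> qbar"
proof
  fix y assume "y \<in> quintic_roots"
  show "y \<in> qbar"
  proof (rule qbar_root)
    show "cquintic \<noteq> 0" by (simp add: cquintic_eq)
    show "coeff cquintic i \<in> qbar" for i
      unfolding coeff_map_poly[of of_int, OF of_int_0] by (rule qbar.of_int[THEN conjunct2])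
    show "poly cquintic y = 0"
      using \<open>y \<in> quintic_roots\<close> unfolding quintic_roots_def by (rule CollectD)
  qed
qed

lemma quintic_roots_invariant:
  assumes "qbar_aut \<gamma>" "y \<in> quintic_roots"
  shows "\<gamma> y \<in> quintic_roots"
proof -
  interpret field_rel "\<lambda>a b. a \<in> qbar \<and> b = \<gamma> a"
    by (rule qbar_aut_field_rel[OF assms(1)])
  have "rel_poly (\<lambda>a b. a \<in> qbar \<and> b = \<gamma> a) cquintic cquintic"
    unfolding rel_poly_def coeff_map_poly[of of_int, OF of_int_0] by (intro allI of_int)
  moreover have "y \<in> qbar \<and> \<gamma> y = \<gamma> y"
    using quintic_roots_qbar assms(2) by blast
  ultimately have "poly cquintic y \<in> qbar \<and> poly cquintic (\<gamma> y) = \<gamma> (poly cquintic y)"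
    by (rule poly_rel)
  then have "poly cquintic (\<gamma> y) = \<gamma> (poly cquintic y)"
    by (rule conjunct2)
  moreover have "poly cquintic y = 0"
    using assms(2) unfolding quintic_roots_def by (rule CollectD)
  moreover have "\<gamma> 0 = 0" using qbar_aut_of_int[OF assms(1), of 0] by simp
  ultimately show ?thesis by (simp add: quintic_roots_def)
qed

lemma quintic_roots_subset_place:
  assumes "place p B"
  shows "quintic_roots \<subseteq> B"
proof
  interpret place p B by fact
  fix y assume "y \<in> quintic_roots"
  show "y \<in> B"
  proof (rule integral_in_B)
    show "coeff cquintic i \<in> B" for i
      unfolding coeff_map_poly[of of_int, OF of_int_0] by (rule B_of_int)
    show "lead_coeff cquintic = 1" by (simp add: cquintic_eq)
    show "poly cquintic y = 0"
      using \<open>y \<in> quintic_roots\<close> unfolding quintic_roots_def by (rule CollectD)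
  qed
qed

lemma prod_linear_factors_dvd:
  fixes P :: "'a::field poly"
  assumes "finite X" "\<And>x. x \<in> X \<Longrightarrow> poly P x = 0"
  shows "(\<Prod>x\<in>X. [:- x, 1:]) dvd P"
  using assms
proof (induction X rule: finite_induct)
  case (insert x X)
  then obtain Q where Q: "P = (\<Prod>x\<in>X. [:- x, 1:]) * Q"
    by (auto elim: dvdE)
  have "poly (\<Prod>x\<in>X. [:- x, 1:]) x \<noteq> 0"
    using insert.hyps by (auto simp: poly_prod)
  then have "poly Q x = 0"
    using insert.prems[of x] by (simp add: Q)
  then have "[:- x, 1:] dvd Q" by (simp add: poly_eq_0_iff_dvd)
  then have "(\<Prod>x\<in>X. [:- x, 1:]) * [:- x, 1:] dvd P"
    unfolding Q by (rule mult_dvd_mono[OF dvd_refl])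
  then show ?case using insert.hyps by (simp add: mult.commute)
qed simp

lemma degree_prod_linear_factors:
  "finite X \<Longrightarrow> degree (\<Prod>x\<in>X. [:- x, 1:]) = card (X :: 'a::field set)"
  by (subst degree_prod_sum_eq) simp_all

text \<open>The assumption is established by \<open>card_quintic_roots\<close>, where five real
  roots are located.\<close>

context
  assumes card_roots: "card quintic_roots = 5"
begin

lemma finite_quintic_roots: "finite quintic_roots"
  using card_roots by (metis card.infinite zero_neq_numeral)

lemma cquintic_factorization: "cquintic = (\<Prod>x\<in>quintic_roots. [:- x, 1:])"
proof -
  let ?P = "\<Prod>x\<in>quintic_roots. [:- x, 1:]"
  have "?P dvd cquintic"
    using finite_quintic_roots by (rule prod_linear_factors_dvd) (simp add: quintic_roots_def)
  then obtain Q where Q: "cquintic = ?P * Q" by (elim dvdE)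
  have "?P \<noteq> 0" using finite_quintic_roots by simp
  moreover have "Q \<noteq> 0" using Q degree_cquintic by auto
  ultimately have "degree cquintic = card quintic_roots + degree Q"
    unfolding Q by (simp add: degree_mult_eq degree_prod_linear_factors finite_quintic_roots)
  then have "degree Q = 0"
    using degree_cquintic card_roots by simp
  then obtain c where c: "Q = [:c:]" by (elim degree_eq_zeroE)
  have "lead_coeff cquintic = lead_coeff ?P * lead_coeff Q"
    unfolding Q by (rule lead_coeff_mult)
  moreover have "lead_coeff ?P = 1"
    by (simp add: lead_coeff_prod)
  moreover have "lead_coeff cquintic = 1"
    by (simp add: cquintic_eq)
  ultimately have "c = 1" by (simp add: c)
  then show ?thesis using Q c by (simp add: one_pCons)
qed

interpretation aut_action quintic_roots
  by unfold_locales (fact quintic_roots_qbar, fact quintic_roots_invariant, fact card_roots)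

lemma automorphism_without_short_cycles:
  obtains \<gamma> where "qbar_aut \<gamma>" "\<And>y. y \<in> quintic_roots \<Longrightarrow> \<gamma> y \<noteq> y"
    "\<And>y. y \<in> quintic_roots \<Longrightarrow> \<gamma> (\<gamma> y) \<noteq> y"
proof -
  have "prime (5 :: nat)" by simp
  then obtain B :: "complex set" where "place 5 B" by (rule place_exists)
  then interpret place 5 B .
  have "\<exists>\<gamma>. qbar_aut \<gamma> \<and> (\<forall>y\<in>quintic_roots. frob y (\<gamma> y))"
    by (rule frobenius_lift[OF \<open>place 5 B\<close> finite_quintic_roots quintic_roots_qbar
          quintic_roots_subset_place[OF \<open>place 5 B\<close>]]) (fact quintic_roots_invariant)
  then obtain \<gamma> where \<gamma>: "qbar_aut \<gamma>" "\<And>y. y \<in> quintic_roots \<Longrightarrow> frob y (\<gamma> y)"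
    by blast
  define R where "R = [:- 3, - 9, - 2, 8, 1 :: int:]"
  have R: "cong_M (\<gamma> y) (poly (map_poly of_int R) y)" if y: "y \<in> quintic_roots" for y
  proof -
    have "poly cquintic y = 0" using y by (simp add: quintic_roots_def)
    then have "y ^ 5 = poly (map_poly of_int R) y"
      unfolding cquintic_eq by (simp add: R_def map_poly_pCons algebra_simps numeral_eq_Suc)
    then have "cong_M (poly (map_poly of_int R) y) (\<gamma> y)"
      using \<gamma>(2)[OF y] B_power[of y 5] by (simp add: frob_def cong_M_def)
    then show ?thesis by (rule cong_M_sym)
  qed
  have two: "\<gamma> (\<gamma> y) \<noteq> y" if y: "y \<in> quintic_roots" for y
  proof
    assume eq: "\<gamma> (\<gamma> y) = y"
    let ?R = "poly (map_poly of_int R) :: complex \<Rightarrow> complex"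
    have "cong_M (?R (?R y)) y"
      using cong_M_trans[OF R[OF quintic_roots_invariant[OF \<gamma>(1) y]] poly_of_int_cong_M[OF R[OF y]]]
      unfolding eq by (rule cong_M_sym)
    then have "poly (map_poly of_int (pcompose R R - [:0, 1:])) y \<in> M"
      by (simp add: cong_M_def poly_pcompose hom_distribs map_poly_pCons)
    moreover have "y \<in> B" "poly (map_poly of_int quintic) y = 0"
      using y quintic_roots_subset_place[OF \<open>place 5 B\<close>] by (auto simp: quintic_roots_def)
    ultimately show False
      using bezout_no_common_root[OF coprime_mod_5[folded R_def]] by blast
  qed
  moreover have "\<gamma> y \<noteq> y" if "y \<in> quintic_roots" for y
    using two[OF that] by auto
  ultimately show thesis using that \<gamma>(1) by blast
qed

text \<open>A root of the quadratic factor is congruent to a genuine root \<open>y\<close> of the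
  quintic. Applying Frobenius twice brings \<open>y\<close> back modulo \<open>M\<close>, and
  separability makes this an equality.\<close>

lemma automorphism_with_2_cycle:
  obtains \<gamma> y where "qbar_aut \<gamma>" "\<And>y. y \<in> quintic_roots \<Longrightarrow> \<gamma> y \<noteq> y"
    "y \<in> quintic_roots" "\<gamma> (\<gamma> y) = y"
proof -
  have "prime (7 :: nat)" by simp
  then obtain B :: "complex set" where "place 7 B" by (rule place_exists)
  then interpret place 7 B .
  note X_B = quintic_roots_subset_place[OF \<open>place 7 B\<close>]
  have "\<exists>\<gamma>. qbar_aut \<gamma> \<and> (\<forall>y\<in>quintic_roots. frob y (\<gamma> y))"
    by (rule frobenius_lift[OF \<open>place 7 B\<close> finite_quintic_roots quintic_roots_qbar X_B])
      (fact quintic_roots_invariant)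
  then obtain \<gamma> where \<gamma>: "qbar_aut \<gamma>" "\<And>y. y \<in> quintic_roots \<Longrightarrow> frob y (\<gamma> y)"
    by blast
  have free: "\<gamma> y \<noteq> y" if y: "y \<in> quintic_roots" for y
  proof
    assume "\<gamma> y = y"
    then have "y ^ 7 - y \<in> M"
      using \<gamma>(2)[OF y] by (simp add: frob_def)
    then have "poly (map_poly of_int [:0, - 1, 0, 0, 0, 0, 0, 1:]) y \<in> M"
      by (simp add: map_poly_pCons algebra_simps numeral_eq_Suc)
    moreover have "y \<in> B" "poly (map_poly of_int quintic) y = 0"
      using y X_B by (auto simp: quintic_roots_def)
    ultimately show False
      using bezout_no_common_root[OF coprime_mod_7] by blast
  qed
  have separated: "u = v" if u: "u \<in> quintic_roots" and v: "v \<in> quintic_roots" and "u - v \<in> M" for u v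
  proof (rule ccontr)
    assume "u \<noteq> v"
    \<comment> \<open>The derivative at \<open>u\<close> is \<open>(u - v) * poly h u\<close>, so
      congruent distinct roots would make it vanish modulo \<open>M\<close>.\<close>
    define h where "h = (\<Prod>x\<in>quintic_roots - {u} - {v}. [:- x, 1:])"
    have "(\<Prod>x\<in>quintic_roots. [:- x, 1:]) = [:- u, 1:] * ([:- v, 1:] * h)"
      using u v \<open>u \<noteq> v\<close> finite_quintic_roots unfolding h_def
      by (simp add: prod.remove[of _ u] prod.remove[of _ v] del: mult_pCons_left)
    then have "cquintic = [:- u, 1:] * ([:- v, 1:] * h)"
      using cquintic_factorization by simp
    then have "poly (pderiv cquintic) u = (u - v) * poly h u"
      by (simp add: pderiv_mult pderiv_pCons del: mult_pCons_left)
    moreover have "poly h u \<in> B"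
      unfolding h_def poly_prod
      using ring_rel.prod[OF is_subring_ring_rel[OF subring], of "quintic_roots - {u} - {v}"
          "\<lambda>x. u - x" "\<lambda>x. u - x"] X_B u is_subringD(3)[OF subring] by auto
    ultimately have "poly (pderiv cquintic) u \<in> M"
      using M_mult[of "poly h u" "u - v"] \<open>u - v \<in> M\<close> by (simp add: mult.commute)
    moreover have "pderiv cquintic = map_poly of_int (pderiv quintic)"
      by (simp add: cquintic_eq, simp add: quintic_def pderiv_pCons map_poly_pCons)
    moreover have "u \<in> B" "poly (map_poly of_int quintic) u = 0"
      using u X_B by (auto simp: quintic_roots_def)
    ultimately show False
      using bezout_no_common_root[OF separable_mod_7] by simp
  qed
  define g where "g = [:2, - 2, 1 :: int:]"
  have "\<exists>\<alpha>. poly (map_poly of_int g) \<alpha> = (0 :: complex)"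
    by (rule fundamental_theorem_of_algebra_alt) (simp add: g_def map_poly_pCons)
  then obtain \<alpha> :: complex where \<alpha>: "poly (map_poly of_int g) \<alpha> = 0" ..
  have "\<alpha> \<in> B"
    by (rule integral_in_B[OF _ _ \<alpha>]) (simp add: coeff_map_poly B_of_int, simp add: g_def map_poly_pCons)
  note eval_int = of_int_poly_hom.hom_add of_int_poly_hom.hom_mult poly_add poly_mult
  have seven: "poly (map_poly of_int [:int 7:]) b = of_nat 7" for b :: complex
    by (simp add: map_poly_pCons)
  have "poly cquintic \<alpha> = poly (map_poly of_int [:1, 1, 0, - 1:]) \<alpha> * of_nat 7"
    using arg_cong[OF quintic_factor_mod_7[folded g_def], of "\<lambda>P. poly (map_poly of_int P) \<alpha>"]
    unfolding eval_int seven \<alpha> by (simp only: mult_zero_left add_0_left mult.commute)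
  moreover have "\<dots> \<in> M"
    by (rule M_mult[OF poly_of_int_in_B[OF \<open>\<alpha> \<in> B\<close>] p_in_M])
  ultimately have "poly cquintic \<alpha> \<in> M" by (simp only:)
  \<comment> \<open>\<open>\<alpha>\<close> is a root of the quintic modulo \<open>M\<close> only;
    primality of \<open>M\<close> singles out a true root congruent to it.\<close>
  then have "(\<Prod>x\<in>quintic_roots. \<alpha> - x) \<in> M"
    unfolding cquintic_factorization poly_prod by simp
  moreover have "\<alpha> - x \<in> B" if "x \<in> quintic_roots" for x
    using is_subringD(3)[OF subring \<open>\<alpha> \<in> B\<close>] X_B that by blast
  ultimately have "\<exists>x\<in>quintic_roots. \<alpha> - x \<in> M"
    by (intro M_prime_prod[OF finite_quintic_roots])
  then obtain y where y: "y \<in> quintic_roots" "\<alpha> - y \<in> M" by blast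
  have yB: "y \<in> B" "\<gamma> y \<in> B" "\<gamma> (\<gamma> y) \<in> B"
    using y(1) X_B quintic_roots_invariant[OF \<gamma>(1)] by blast+
  have "cong_M \<alpha> y" using y yB \<open>\<alpha> \<in> B\<close> by (simp add: cong_M_def)
  from poly_of_int_cong_M[OF cong_M_sym[OF this], of g]
  have gy: "poly (map_poly of_int g) y \<in> M"
    unfolding \<alpha> cong_M_def by simp
  have "poly (map_poly of_int [:0, 0, 0, 0, 0, 0, 0, 1:]) y = y ^ 7"
    "poly (map_poly of_int [:2, - 1:]) y = 2 - y"
    by (simp_all add: map_poly_pCons numeral_eq_Suc)
  then have "y ^ 7 = poly (map_poly of_int g) y * poly (map_poly of_int [:- 1, 3, 0, 2, 2, 1:]) y +
      (2 - y) + of_nat 7 * poly (map_poly of_int [:0, - 1, 1, - 1:]) y"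
    using arg_cong[OF power_7_mod_factor[folded g_def], of "\<lambda>P. poly (map_poly of_int P) y"]
    unfolding eval_int seven by (simp only:)
  then have "y ^ 7 - (2 - y) = poly (map_poly of_int [:- 1, 3, 0, 2, 2, 1:]) y * poly (map_poly of_int g) y +
      poly (map_poly of_int [:0, - 1, 1, - 1:]) y * of_nat 7"
    by (simp only: mult.commute) (simp only: diff_conv_add_uminus add_ac, simp)
  moreover have "\<dots> \<in> M"
    by (intro M_add M_mult[OF poly_of_int_in_B[OF yB(1)]] gy p_in_M)
  ultimately have "y ^ 7 - (2 - y) \<in> M" by (simp only:)
  moreover have "y ^ 7 - \<gamma> y \<in> M"
    using \<gamma>(2)[OF y(1)] by (simp add: frob_def)
  ultimately have "(y ^ 7 - (2 - y)) - (y ^ 7 - \<gamma> y) \<in> M" by (rule M_diff)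
  moreover have "(y ^ 7 - (2 - y)) - (y ^ 7 - \<gamma> y) = \<gamma> y - (2 - y)" by simp
  ultimately have "\<gamma> y - (2 - y) \<in> M" by (simp only:)
  then have gamma_y: "cong_M (\<gamma> y) (2 - y)"
    using yB B_of_int[of 2] is_subringD(3)[OF subring] unfolding cong_M_def by simp
  \<comment> \<open>Modulo \<open>M\<close>, \<open>\<gamma> (\<gamma> y)\<close> is the seventh
    power of \<open>\<gamma> y\<close>, hence of \<open>2 - y\<close>, which is
    \<open>2 - \<gamma> y\<close> and so \<open>y\<close>.\<close>
  have "frob 2 2"
    using ring_rel.of_int[OF frob_ring_rel, of 2] by simp
  then have "frob (2 - y) (2 - \<gamma> y)"
    using \<gamma>(2)[OF y(1)] by (rule ring_rel.diff[OF frob_ring_rel])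
  then have "cong_M ((2 - y) ^ 7) (2 - \<gamma> y)"
    by (rule frob_imp_cong_M)
  then have c1: "cong_M (\<gamma> y ^ 7) (2 - \<gamma> y)"
    by (rule cong_M_trans[OF ring_rel.power[OF cong_M_ring_rel gamma_y]])
  have c2: "cong_M (\<gamma> (\<gamma> y)) (\<gamma> y ^ 7)"
    by (rule cong_M_sym[OF frob_imp_cong_M[OF \<gamma>(2)[OF quintic_roots_invariant[OF \<gamma>(1) y(1)]]]])
  have c3: "cong_M (2 - \<gamma> y) (2 - (2 - y))"
    using ring_rel.diff[OF cong_M_ring_rel ring_rel.of_int[OF cong_M_ring_rel, of 2] gamma_y] by simp
  have "cong_M (\<gamma> (\<gamma> y)) (2 - (2 - y))"
    by (rule cong_M_trans[OF cong_M_trans[OF c2 c1] c3])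
  moreover have "2 - (2 - y) = y" by simp
  ultimately have "\<gamma> (\<gamma> y) - y \<in> M" unfolding cong_M_def by simp
  then have "\<gamma> (\<gamma> y) = y"
    using y(1) quintic_roots_invariant[OF \<gamma>(1)] by (intro separated) auto
  then show thesis
    using that[OF \<gamma>(1) free y(1)] by blast
qed

lemma quintic_root_not_radical:
  assumes "y \<in> quintic_roots"
  shows "\<not> radical_number y"
proof -
  obtain c where c: "qbar_aut c" "\<And>y. y \<in> quintic_roots \<Longrightarrow> c y \<noteq> y"
    "\<And>y. y \<in> quintic_roots \<Longrightarrow> c (c y) \<noteq> y"
    using automorphism_without_short_cycles by blast
  obtain t a where t: "qbar_aut t" "\<And>y. y \<in> quintic_roots \<Longrightarrow> t y \<noteq> y"
    "a \<in> quintic_roots" "t (t a) = a"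
    using automorphism_with_2_cycle by blast
  show ?thesis
    by (rule not_radical_number[OF swaps_all[OF c t] assms])
qed

end

section \<open>Classical multidimensional scaling\<close>

lemma orthonormal_rows:
  fixes V :: "nat \<Rightarrow> nat \<Rightarrow> real"
  assumes "\<And>i j. i < n \<Longrightarrow> j < n \<Longrightarrow> (\<Sum>k<n. V k i * V k j) = (if i = j then 1 else 0)"
    and "i < n" "j < n"
  shows "(\<Sum>k<n. V i k * V j k) = (if i = j then 1 else 0)"
proof -
  define A where "A = mat n n (\<lambda>(i, j). V i j)"
  have A: "A \<in> carrier_mat n n" by (simp add: A_def)
  have "transpose_mat A * A = 1\<^sub>m n"
    by (rule eq_matI) (use assms(1) in \<open>simp_all add: A_def scalar_prod_def atLeast0LessThan\<close>)
  then have "A * transpose_mat A = 1\<^sub>m n"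
    using A by (intro mat_mult_left_right_inverse[of "transpose_mat A" n A]) simp_all
  then have "(A * transpose_mat A) $$ (i, j) = 1\<^sub>m n $$ (i, j)" by simp
  then show ?thesis
    using assms(2,3) by (simp add: A_def scalar_prod_def atLeast0LessThan)
qed

lemma mds_eigendecomp_eigenvector:
  assumes "mds_eigendecomp n E V lam" "i < n" "k < n"
  shows "(\<Sum>j<n. mds_B n E i j * V j k) = lam k * V i k"
proof -
  have B: "mds_B n E i j = (\<Sum>l<n. V i l * lam l * V j l)" if "j < n" for j
    using assms(1,2) that by (simp add: mds_eigendecomp_def)
  have "(\<Sum>j<n. mds_B n E i j * V j k) = (\<Sum>j<n. \<Sum>l<n. V i l * lam l * (V j l * V j k))"
    by (intro sum.cong) (simp_all add: B sum_distrib_right mult.assoc)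
  also have "\<dots> = (\<Sum>l<n. V i l * lam l * (\<Sum>j<n. V j l * V j k))"
    by (subst sum.swap) (simp add: sum_distrib_left)
  also have "\<dots> = (\<Sum>l<n. if l = k then V i l * lam l else 0)"
    using assms by (intro sum.cong) (auto simp: mds_eigendecomp_def)
  also have "\<dots> = lam k * V i k"
    using assms(3) by simp
  finally show ?thesis .
qed

text \<open>Eigenvectors of a symmetric matrix for distinct eigenvalues are orthogonal, so the
  vectors \<open>W k\<close> only have to be normalized.\<close>

lemma mds_eigendecompI:
  fixes W :: "nat \<Rightarrow> nat \<Rightarrow> real"
  assumes sym: "\<And>i j. i < n \<Longrightarrow> j < n \<Longrightarrow> mds_B n E i j = mds_B n E j i"
    and eig: "\<And>k i. k < n \<Longrightarrow> i < n \<Longrightarrow> (\<Sum>j<n. mds_B n E i j * W k j) = lam k * W k i"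
    and nz: "\<And>k. k < n \<Longrightarrow> \<exists>i<n. W k i \<noteq> 0"
    and dec: "\<And>i j. i < j \<Longrightarrow> j < n \<Longrightarrow> lam j < lam i"
  obtains V where "mds_eigendecomp n E V lam"
proof -
  define s where "s k = (\<Sum>i<n. W k i * W k i)" for k
  define V where "V i k = W k i / sqrt (s k)" for i k
  have s_pos: "s k > 0" if "k < n" for k
  proof -
    from nz[OF that] obtain i where "i < n" "W k i \<noteq> 0" by blast
    then show ?thesis
      unfolding s_def by (intro sum_pos2[of _ i]) (auto simp: zero_less_mult_iff)
  qed
  have orth: "(\<Sum>i<n. W k i * W l i) = 0" if kl: "k < n" "l < n" "k \<noteq> l" for k l
  proof -
    have "lam k * (\<Sum>i<n. W k i * W l i) = (\<Sum>i<n. (\<Sum>j<n. mds_B n E i j * W k j) * W l i)"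
      using kl by (subst sum_distrib_left, intro sum.cong) (simp_all add: eig mult.assoc)
    also have "\<dots> = (\<Sum>i<n. \<Sum>j<n. mds_B n E i j * W k j * W l i)"
      by (simp add: sum_distrib_right)
    also have "\<dots> = (\<Sum>j<n. \<Sum>i<n. mds_B n E i j * W k j * W l i)"
      by (rule sum.swap)
    also have "\<dots> = (\<Sum>j<n. W k j * (\<Sum>i<n. mds_B n E j i * W l i))"
      unfolding sum_distrib_left by (intro sum.cong) (auto simp: sym mult_ac)
    also have "\<dots> = lam l * (\<Sum>i<n. W k i * W l i)"
      using kl by (subst (2) sum_distrib_left, intro sum.cong) (simp_all add: eig mult.left_commute)
    finally have "(lam k - lam l) * (\<Sum>i<n. W k i * W l i) = 0"
      by (simp add: left_diff_distrib)
    moreover have "lam k \<noteq> lam l"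
      using dec[of k l] dec[of l k] kl by (cases "k < l") auto
    ultimately show ?thesis by simp
  qed
  have V_orth: "(\<Sum>k<n. V k i * V k j) = (if i = j then 1 else 0)" if "i < n" "j < n" for i j
  proof -
    have "(\<Sum>k<n. V k i * V k j) = (\<Sum>k<n. W i k * W j k) / (sqrt (s i) * sqrt (s j))"
      by (simp add: V_def sum_divide_distrib)
    then show ?thesis
      using orth that s_pos[of i] by (auto simp: s_def[symmetric] simp flip: real_sqrt_mult)
  qed
  have V_eig: "(\<Sum>l<n. mds_B n E i l * V l k) = lam k * V i k" if "i < n" "k < n" for i k
    using eig[OF that(2,1)] by (simp add: V_def flip: sum_divide_distrib)
  have "mds_B n E i j = (\<Sum>k<n. V i k * lam k * V j k)" if ij: "i < n" "j < n" for i j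
  proof -
    have "(\<Sum>k<n. V i k * lam k * V j k) = (\<Sum>k<n. (\<Sum>l<n. mds_B n E i l * V l k) * V j k)"
      using ij by (intro sum.cong) (simp_all add: V_eig)
    also have "\<dots> = (\<Sum>k<n. \<Sum>l<n. mds_B n E i l * (V l k * V j k))"
      by (simp add: sum_distrib_right mult.assoc)
    also have "\<dots> = (\<Sum>l<n. \<Sum>k<n. mds_B n E i l * (V l k * V j k))"
      by (rule sum.swap)
    also have "\<dots> = (\<Sum>l<n. mds_B n E i l * (if l = j then 1 else 0))"
      using orthonormal_rows[OF V_orth] ij
      by (intro sum.cong) (simp_all flip: sum_distrib_left)
    also have "\<dots> = mds_B n E i j"
      using ij by (simp add: if_distrib cong: if_cong)
    finally show ?thesis by simp
  qed
  moreover have "lam j \<le> lam i" if "i \<le> j" "j < n" for i j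
    using dec[of i j] that by (cases "i = j") auto
  ultimately have "mds_eigendecomp n E V lam"
    using V_orth unfolding mds_eigendecomp_def by simp
  then show thesis by (rule that)
qed

text \<open>Carries knowledge of one decomposition over to an arbitrary one. If \<open>lam l\<close>
  differed from every \<open>mu k\<close>, column \<open>l\<close> of \<open>V\<close> would be
  orthogonal to the basis \<open>U\<close> and vanish.\<close>

lemma mds_eigendecomp_eigenvalue_mem:
  assumes sym: "\<And>i j. i < n \<Longrightarrow> j < n \<Longrightarrow> mds_B n E i j = mds_B n E j i"
    and U: "mds_eigendecomp n E U mu" and V: "mds_eigendecomp n E V lam" and l: "l < n"
  shows "\<exists>k<n. lam l = mu k"
proof (rule ccontr)
  assume none: "\<not> ?thesis"
  have U_orth: "\<And>i j. i < n \<Longrightarrow> j < n \<Longrightarrow> (\<Sum>k<n. U k i * U k j) = (if i = j then 1 else 0)"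
    using U by (simp add: mds_eigendecomp_def)
  have zero: "(\<Sum>i<n. U i k * V i l) = 0" if k: "k < n" for k
  proof -
    have "mu k * (\<Sum>i<n. U i k * V i l) = (\<Sum>i<n. (\<Sum>j<n. mds_B n E i j * U j k) * V i l)"
      using k by (subst sum_distrib_left, intro sum.cong)
        (simp_all add: mds_eigendecomp_eigenvector[OF U] mult.assoc)
    also have "\<dots> = (\<Sum>i<n. \<Sum>j<n. mds_B n E i j * U j k * V i l)"
      by (simp add: sum_distrib_right)
    also have "\<dots> = (\<Sum>j<n. \<Sum>i<n. mds_B n E i j * U j k * V i l)"
      by (rule sum.swap)
    also have "\<dots> = (\<Sum>j<n. U j k * (\<Sum>i<n. mds_B n E j i * V i l))"
      unfolding sum_distrib_left by (intro sum.cong) (auto simp: sym mult_ac)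
    also have "\<dots> = lam l * (\<Sum>i<n. U i k * V i l)"
      using l by (subst (2) sum_distrib_left, intro sum.cong)
        (simp_all add: mds_eigendecomp_eigenvector[OF V] mult.left_commute)
    finally have "(mu k - lam l) * (\<Sum>i<n. U i k * V i l) = 0"
      by (simp add: left_diff_distrib)
    then show ?thesis using none k by auto
  qed
  have "V i l = 0" if i: "i < n" for i
  proof -
    have "V i l = (\<Sum>j<n. if i = j then V j l else 0)"
      using i by simp
    also have "\<dots> = (\<Sum>j<n. (if i = j then 1 else 0) * V j l)"
      by (intro sum.cong) simp_all
    also have "\<dots> = (\<Sum>j<n. (\<Sum>k<n. U i k * U j k) * V j l)"
      using orthonormal_rows[OF U_orth i] by (intro sum.cong) simp_all
    also have "\<dots> = (\<Sum>j<n. \<Sum>k<n. U i k * (U j k * V j l))"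
      by (simp add: sum_distrib_right mult.assoc)
    also have "\<dots> = (\<Sum>k<n. \<Sum>j<n. U i k * (U j k * V j l))"
      by (rule sum.swap)
    also have "\<dots> = (\<Sum>k<n. U i k * (\<Sum>j<n. U j k * V j l))"
      by (simp add: sum_distrib_left)
    also have "\<dots> = 0" using zero by simp
    finally show ?thesis .
  qed
  then have "(\<Sum>i<n. V i l * V i l) = 0" by simp
  moreover have "(\<Sum>i<n. V i l * V i l) = 1"
    using V l by (simp add: mds_eigendecomp_def)
  ultimately show False by simp
qed

text \<open>Nonpositive eigenvalues would make the diagonal nonpositive. This keeps
  \<open>lam 0\<close> away from the rational eigenvalue 0 of the all-ones vector.\<close>

lemma mds_eigendecomp_top_positive:
  assumes V: "mds_eigendecomp n E V lam" and i: "i < n" and B: "mds_B n E i i > 0"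
  shows "lam 0 > 0"
proof (rule ccontr)
  assume "\<not> lam 0 > 0"
  moreover have "lam k \<le> lam 0" if "k < n" for k
    using V i that by (simp add: mds_eigendecomp_def)
  ultimately have lam: "lam k \<le> 0" if "k < n" for k
    using that by force
  have "(\<Sum>k<n. V i k * lam k * V i k) = (\<Sum>k<n. lam k * (V i k * V i k))"
    by (intro sum.cong) simp_all
  also have "\<dots> \<le> 0"
    using lam by (intro sum_nonpos mult_nonpos_nonneg) simp_all
  finally show False
    using V i B unfolding mds_eigendecomp_def by simp
qed

lemma mds_drawing_sum_squares:
  assumes V: "mds_eigendecomp n E V lam" and n: "0 < n"
  shows "(\<Sum>i<n. mds_coord V lam i 0 ^ 2) = complex_of_real (lam 0)"
proof -
  have "(\<Sum>i<n. mds_coord V lam i 0 ^ 2) = (\<Sum>i<n. complex_of_real (V i 0 * V i 0) * complex_of_real (lam 0))"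
    by (intro sum.cong) (simp_all add: mds_coord_def power_mult_distrib power2_eq_square[of "complex_of_real _"])
  also have "\<dots> = complex_of_real (\<Sum>i<n. V i 0 * V i 0) * complex_of_real (lam 0)"
    by (simp flip: sum_distrib_right)
  also have "(\<Sum>i<n. V i 0 * V i 0) = 1"
    using V n by (simp add: mds_eigendecomp_def)
  finally show ?thesis by simp
qed

lemma radical_number_sum: "(\<And>i. i \<in> I \<Longrightarrow> radical_number (f i)) \<Longrightarrow> radical_number (sum f I)"
  using radical_number_of_int[of 0]
  by (induction I rule: infinite_finite_induct) (simp_all add: radical_number_add)

lemma radical_drawing_eigenvalue:
  assumes V: "mds_eigendecomp n E V lam" and n: "0 < n"
    and rad: "\<forall>z\<in>set (mds_drawing n V lam). radical_number z"
  shows "radical_number (complex_of_real (lam 0))"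
proof -
  have "radical_number (mds_coord V lam i 0)" if "i < n" for i
  proof -
    have "mds_coord V lam i 0 \<in> set (mds_drawing n V lam)"
      using that unfolding mds_drawing_def by force
    then show ?thesis using rad by blast
  qed
  then have "radical_number (\<Sum>i<n. mds_coord V lam i 0 ^ 2)"
    by (intro radical_number_sum) (simp add: power2_eq_square radical_number_mult)
  then show ?thesis by (simp add: mds_drawing_sum_squares[OF V n])
qed

lemma radical_number_adj_input: "\<forall>z\<in>set (adj_input n E). radical_number z"
  using radical_number_of_int[of 0] radical_number_of_int[of 1] by (auto simp: adj_input_def)

section \<open>Double centering\<close>

lemma centering_commute: "centering n i j = centering n j i"
  by (simp add: centering_def)

lemma sum_centering_left:
  assumes "i < n"
  shows "(\<Sum>k<n. centering n i k * g k) = g i - (\<Sum>k<n. g k) / real n"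
proof -
  have "(\<Sum>k<n. centering n i k * g k) = (\<Sum>k<n. (if i = k then g k else 0) - g k / real n)"
    by (intro sum.cong) (simp_all add: centering_def left_diff_distrib)
  then show ?thesis
    using assms by (simp add: sum_subtractf sum_divide_distrib)
qed

text \<open>\<open>g\<close> is column \<open>j\<close> of the squared distance matrix centered on
  the right, so each centering is one use of \<open>sum_centering_left\<close>.\<close>

lemma mds_B_eq:
  fixes E :: "nat \<Rightarrow> nat \<Rightarrow> bool"
  assumes "i < n" "j < n"
  defines "g \<equiv> \<lambda>k. sqdist_matrix E k j - (\<Sum>l<n. sqdist_matrix E k l) / real n"
  shows "mds_B n E i j = - (1 / 2) * (g i - (\<Sum>k<n. g k) / real n)"
proof -
  have "(\<Sum>l<n. centering n i k * sqdist_matrix E k l * centering n l j) = centering n i k * g k" for k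
  proof -
    have "(\<Sum>l<n. centering n i k * sqdist_matrix E k l * centering n l j) =
        centering n i k * (\<Sum>l<n. centering n j l * sqdist_matrix E k l)"
      unfolding sum_distrib_left
      by (intro sum.cong) (simp_all add: centering_commute[of n _ j])
    then show ?thesis using sum_centering_left[OF assms(2)] by (simp add: g_def)
  qed
  then show ?thesis
    unfolding mds_B_def using sum_centering_left[OF assms(1), of g] by simp
qed

section \<open>Distances up to two\<close>

lemma gdist_2:
  assumes "u \<noteq> v" "\<not> E u v" "E u w" "E w v"
  shows "gdist E u v = 2"
  unfolding gdist_def
proof (rule Least_equality)
  show "walk E 2 u v" using assms(3,4) by (auto simp: numeral_2_eq_2)
next
  fix k assume "walk E k u v"
  then have "k \<noteq> 0" "k \<noteq> Suc 0" using assms(1,2) by (auto intro: Nat.gr0I)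
  then show "2 \<le> k" by simp
qed

lemma gdist_1: "u \<noteq> v \<Longrightarrow> E u v \<Longrightarrow> gdist E u v = 1"
  unfolding gdist_def by (rule Least_equality) (auto simp: Suc_le_eq intro!: Nat.gr0I)

lemma gdist_0: "gdist E u u = 0"
  unfolding gdist_def by (rule Least_equality) simp_all

section \<open>The graph\<close>

text \<open>A graph of diameter 2, so squared distances off the diagonal are 1 on edges and 4
  elsewhere.\<close>

definition mds_edges :: "(nat \<times> nat) list" where
  "mds_edges = [(0, 4), (0, 5), (1, 3), (1, 5), (2, 3), (2, 4), (2, 5), (3, 4), (4, 5)]"

definition mds_graph :: "nat \<Rightarrow> nat \<Rightarrow> bool" where
  "mds_graph u v \<longleftrightarrow> (u, v) \<in> set mds_edges \<or> (v, u) \<in> set mds_edges"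

lemma mds_graph_simple: "simple_graph 6 mds_graph"
  unfolding simple_graph_def mds_graph_def mds_edges_def by auto

lemma mds_graph_diameter_2_list:
  "\<forall>u\<in>set [0..<6]. \<forall>v\<in>set [0..<6]. u = v \<or> mds_graph u v \<or> (\<exists>w\<in>set [0..<6]. mds_graph u w \<and> mds_graph w v)"
  unfolding mds_graph_def by code_simp

lemma mds_graph_diameter_2:
  assumes "u < 6" "v < 6"
  shows "u = v \<or> mds_graph u v \<or> (\<exists>w. mds_graph u w \<and> mds_graph w v)"
proof -
  have "u \<in> set [0..<6]" "v \<in> set [0..<6]" using assms by simp_all
  then show ?thesis using mds_graph_diameter_2_list by blast
qed

lemma mds_graph_connected: "graph_connected 6 mds_graph"
  unfolding graph_connected_def
proof (intro allI impI)
  fix u v :: nat assume "u < 6" "v < 6"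
  then consider "u = v" | "mds_graph u v" | w where "mds_graph u w" "mds_graph w v"
    using mds_graph_diameter_2[of u v] by blast
  then show "\<exists>k. walk mds_graph k u v"
  proof cases
    case 1
    then show ?thesis by (intro exI[of _ 0]) simp
  next
    case 2
    then show ?thesis by (intro exI[of _ "Suc 0"]) simp
  next
    case 3
    then show ?thesis by (intro exI[of _ "Suc (Suc 0)"]) auto
  qed
qed

lemma sqdist_mds_graph:
  assumes "u < 6" "v < 6"
  shows "sqdist_matrix mds_graph u v = (if u = v then 0 else if mds_graph u v then 1 else 4)"
proof -
  consider "u = v" | "u \<noteq> v" "mds_graph u v"
    | w where "u \<noteq> v" "\<not> mds_graph u v" "mds_graph u w" "mds_graph w v"
    using mds_graph_diameter_2[OF assms] by blast
  then show ?thesis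
    by cases (simp_all add: sqdist_matrix_def gdist_0 gdist_1 gdist_2)
qed

text \<open>The matrix \<open>12 B\<close>.\<close>

definition mds_B12 :: "real list list" where
  "mds_B12 = [[17, - 7, - 10, - 10, 5, 5], [- 7, 17, - 10, 8, - 13, 5], [- 10, - 10, 11, 5, 2, 2],
     [- 10, 8, 5, 11, 2, - 16], [5, - 13, 2, 2, 5, - 1], [5, 5, 2, - 16, - 1, 5]]"

lemma less_6_cases: "(i :: nat) < 6 \<Longrightarrow> i = 0 \<or> i = 1 \<or> i = 2 \<or> i = 3 \<or> i = 4 \<or> i = 5"
  by auto

lemma sum_less_6: "(\<Sum>k<6. f k) = f 0 + f 1 + f 2 + f 3 + f 4 + f (5 :: nat)"
  by (simp add: eval_nat_numeral)

definition mds_D :: "real list list" where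
  "mds_D = [[0, 4, 4, 4, 1, 1], [4, 0, 4, 1, 4, 1], [4, 4, 0, 1, 1, 1],
     [4, 1, 1, 0, 1, 4], [1, 4, 1, 1, 0, 1], [1, 1, 1, 4, 1, 0]]"

lemma sqdist_mds_graph_nth:
  assumes "u < 6" "v < 6"
  shows "sqdist_matrix mds_graph u v = mds_D ! u ! v"
  unfolding sqdist_mds_graph[OF assms]
  using less_6_cases[OF assms(1)] less_6_cases[OF assms(2)]
  by (elim disjE) (simp_all add: mds_graph_def mds_edges_def mds_D_def)

lemma mds_B_mds_graph:
  assumes "i < 6" "j < 6"
  shows "mds_B 6 mds_graph i j = mds_B12 ! i ! j / 12"
proof -
  \<comment> \<open>Row sums of \<open>mds_D\<close>, equal to its column sums by symmetry; they add
    up to 66, whence the 11 below.\<close>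
  define rs :: "real list" where "rs = [14, 14, 11, 11, 8, 8]"
  have row: "(\<Sum>l<6. sqdist_matrix mds_graph k l) = rs ! k" if "k < 6" for k
    using less_6_cases[OF that] unfolding sum_less_6
    by (elim disjE) (simp_all add: sqdist_mds_graph_nth mds_D_def rs_def)
  have col: "(\<Sum>k<6. sqdist_matrix mds_graph k j) = rs ! j"
    using less_6_cases[OF assms(2)] unfolding sum_less_6
    by (elim disjE) (simp_all add: sqdist_mds_graph_nth mds_D_def rs_def)
  have "(\<Sum>k<6. sqdist_matrix mds_graph k j - (\<Sum>l<6. sqdist_matrix mds_graph k l) / real 6) =
      rs ! j - (\<Sum>k<6. rs ! k / 6)"
    unfolding sum_subtractf col using row by (intro arg_cong2[of _ _ _ _ "(-)"] sum.cong) simp_all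
  also have "(\<Sum>k<6. rs ! k / 6) = 11"
    unfolding sum_less_6 by (simp add: rs_def)
  finally have "mds_B 6 mds_graph i j =
      - (1 / 2) * (mds_D ! i ! j - rs ! i / 6 - (rs ! j - 11) / 6)"
    unfolding mds_B_eq[OF assms] using row[OF assms(1)] by (simp add: sqdist_mds_graph_nth assms)
  then show ?thesis
    using less_6_cases[OF assms(1)] less_6_cases[OF assms(2)]
    by (elim disjE) (simp_all add: mds_D_def rs_def mds_B12_def)
qed

text \<open>A rational substitution with rational inverse \<open>y = 3 / (2 * (lam - 2))\<close>, so
  it transfers radicality. In \<open>y\<close> the quintic is monic over the integers, which makes
  its roots integral at every place.\<close>

definition eigenvalue_of :: "real \<Rightarrow> real" where
  "eigenvalue_of y = 2 + 3 / (2 * y)"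

text \<open>Obtained by solving \<open>B v = (2 + 3 / (2 y)) v\<close> over \<open>\<rat>[y] / (f)\<close> with second coordinate 1.\<close>

definition eigenvector_of :: "real \<Rightarrow> real list" where
  "eigenvector_of y = [7 + 9 * y - 13 * y ^ 2 + y ^ 4, 1, 10 + 16 * y - 13 * y ^ 2 - 7 * y ^ 3 + 3 * y ^ 4,
     - 2 - 2 * y + y ^ 2 + 3 * y ^ 3 - y ^ 4, - 11 - 19 * y + 17 * y ^ 2 + 6 * y ^ 3 - 3 * y ^ 4,
     - 5 - 4 * y + 8 * y ^ 2 - 2 * y ^ 3]"

section \<open>Eigenvectors and real roots\<close>

abbreviation rquintic :: "real poly" where
  "rquintic \<equiv> map_poly of_int quintic"

lemma rquintic_eq: "rquintic = [:3, 9, 2, - 8, - 1, 1:]"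
  by (simp add: quintic_def map_poly_pCons)

lemma eigenvector_of:
  assumes y: "poly rquintic y = 0" "y \<noteq> 0" and i: "i < 6"
  shows "(\<Sum>j<6. mds_B 6 mds_graph i j * eigenvector_of y ! j) = eigenvalue_of y * eigenvector_of y ! i"
proof -
  have f: "3 + 9 * y + 2 * y ^ 2 - 8 * y ^ 3 - y ^ 4 + y ^ 5 = 0"
    using y(1) unfolding rquintic_eq by (simp add: algebra_simps numeral_eq_Suc)
  \<comment> \<open>\<open>24 * y + 18\<close> is \<open>12 * y\<close> times the eigenvalue. The
    defect has degree at most 5 in \<open>y\<close> and is a constant multiple of the quintic;
    comparing values at \<open>y = 0\<close> gives the factor, -6 times the constant terms of
    \<open>eigenvector_of\<close>.\<close>
  have "y * (\<Sum>j<6. mds_B12 ! i ! j * eigenvector_of y ! j) - (24 * y + 18) * eigenvector_of y ! i =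
      - 6 * [7, 1, 10, - 2, - 11, - 5] ! i * (3 + 9 * y + 2 * y ^ 2 - 8 * y ^ 3 - y ^ 4 + y ^ 5)"
    using less_6_cases[OF i] unfolding sum_less_6
    by (elim disjE) (simp_all add: mds_B12_def eigenvector_of_def algebra_simps eval_nat_numeral)
  then have "(\<Sum>j<6. mds_B12 ! i ! j * eigenvector_of y ! j) = (24 * y + 18) * eigenvector_of y ! i / y"
    unfolding f using y(2) by (simp add: eq_divide_eq mult.commute)
  moreover have "(\<Sum>j<6. mds_B 6 mds_graph i j * eigenvector_of y ! j) =
      (\<Sum>j<6. mds_B12 ! i ! j * eigenvector_of y ! j) / 12"
    unfolding sum_divide_distrib using i by (intro sum.cong) (simp_all add: mds_B_mds_graph)
  ultimately show ?thesis
    using y(2) by (simp only: eigenvalue_of_def) (simp add: field_simps)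
qed

text \<open>Besides showing sign changes, the endpoints order the eigenvalues:
  \<open>eigenvalue_of\<close> sends \<open>- 3 / 4\<close> to 0 and \<open>- 1 / 2\<close> to -1,
  and the first three intervals to disjoint positive ranges.\<close>

lemma rquintic_roots:
  obtains ya yb yc yd ye where
    "poly rquintic ya = 0" "1 < ya" "ya < 3 / 2"
    "poly rquintic yb = 0" "3 < yb" "yb < 7 / 2"
    "poly rquintic yc = 0" "- 5 / 2 < yc" "yc < - 2"
    "poly rquintic yd = 0" "- 3 / 4 < yd" "yd < - 1 / 2"
    "poly rquintic ye = 0" "- 1 / 2 < ye" "ye < 0"
proof -
  have "\<exists>y>1. y < 3 / 2 \<and> poly rquintic y = 0"
    unfolding rquintic_eq by (rule poly_IVT) simp_all
  moreover have "\<exists>y>3. y < 7 / 2 \<and> poly rquintic y = 0"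
    unfolding rquintic_eq by (rule poly_IVT) simp_all
  moreover have "\<exists>y>- 5 / 2. y < - 2 \<and> poly rquintic y = 0"
    unfolding rquintic_eq by (rule poly_IVT) simp_all
  moreover have "\<exists>y>- 3 / 4. y < - 1 / 2 \<and> poly rquintic y = 0"
    unfolding rquintic_eq by (rule poly_IVT) simp_all
  moreover have "\<exists>y>- 1 / 2. y < 0 \<and> poly rquintic y = 0"
    unfolding rquintic_eq by (rule poly_IVT) simp_all
  ultimately show thesis using that by blast
qed

lemma of_real_quintic_root:
  assumes "poly rquintic y = 0"
  shows "complex_of_real y \<in> quintic_roots"
proof -
  have "poly cquintic (complex_of_real y) = complex_of_real (poly rquintic y)"
    unfolding cquintic_eq rquintic_eq by simp
  then show ?thesis using assms by (simp add: quintic_roots_def)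
qed

lemma card_quintic_roots: "card quintic_roots = 5"
proof -
  obtain ya yb yc yd ye where y:
    "poly rquintic ya = 0" "1 < ya" "ya < 3 / 2"
    "poly rquintic yb = 0" "3 < yb" "yb < 7 / 2"
    "poly rquintic yc = 0" "- 5 / 2 < yc" "yc < - 2"
    "poly rquintic yd = 0" "- 3 / 4 < yd" "yd < - 1 / 2"
    "poly rquintic ye = 0" "- 1 / 2 < ye" "ye < 0"
    by (rule rquintic_roots)
  have nz: "cquintic \<noteq> 0" by (simp add: cquintic_eq)
  have "distinct [ya, yb, yc, yd, ye]" using y by auto
  then have "distinct (map complex_of_real [ya, yb, yc, yd, ye])"
    by (simp only: distinct_map) (auto simp: inj_on_def)
  then have "card (set (map complex_of_real [ya, yb, yc, yd, ye])) = 5"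
    by (simp only: distinct_card) simp
  moreover have "set (map complex_of_real [ya, yb, yc, yd, ye]) \<subseteq> quintic_roots"
    using y of_real_quintic_root by simp
  moreover have "finite quintic_roots"
    unfolding quintic_roots_def using nz by (rule poly_roots_finite)
  ultimately have "5 \<le> card quintic_roots"
    by (metis card_mono)
  moreover have "card quintic_roots \<le> 5"
    unfolding quintic_roots_def using poly_roots_degree[OF nz] unfolding degree_cquintic .
  ultimately show ?thesis by simp
qed

lemma eigenvalue_of_not_radical:
  assumes "poly rquintic y = 0" "y \<noteq> 0"
  shows "\<not> radical_number (complex_of_real (eigenvalue_of y))"
proof
  assume "radical_number (complex_of_real (eigenvalue_of y))"
  then have "radical_number (of_int 3 / (of_int 2 * (complex_of_real (eigenvalue_of y) - of_int 2)))"
    by (intro radical_number_divide radical_number_mult radical_number_diff radical_number_of_int)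
  moreover have "of_int 3 / (of_int 2 * (complex_of_real (eigenvalue_of y) - of_int 2)) = complex_of_real y"
    using assms(2) by (simp add: eigenvalue_of_def)
  ultimately show False
    using quintic_root_not_radical[OF card_quintic_roots of_real_quintic_root[OF assms(1)]] by simp
qed

text \<open>Positivity excludes the eigenvalue 0, the only one that does not come from a root of the
  quintic.\<close>

lemma mds_graph_eigendecomp:
  obtains V mu where "mds_eigendecomp 6 mds_graph V mu"
    "\<And>k. k < 6 \<Longrightarrow> mu k > 0 \<Longrightarrow> \<exists>y. y \<noteq> 0 \<and> poly rquintic y = 0 \<and> mu k = eigenvalue_of y"
proof -
  obtain ya yb yc yd ye where y:
    "poly rquintic ya = 0" "1 < ya" "ya < 3 / 2"
    "poly rquintic yb = 0" "3 < yb" "yb < 7 / 2"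
    "poly rquintic yc = 0" "- 5 / 2 < yc" "yc < - 2"
    "poly rquintic yd = 0" "- 3 / 4 < yd" "yd < - 1 / 2"
    "poly rquintic ye = 0" "- 1 / 2 < ye" "ye < 0"
    by (rule rquintic_roots)
  \<comment> \<open>Sorted by decreasing eigenvalue; the entry 0 belongs to the all-ones vector,
    which centering annihilates.\<close>
  define mu where "mu = (!) [eigenvalue_of ya, eigenvalue_of yb, eigenvalue_of yc, 0,
    eigenvalue_of yd, eigenvalue_of ye]"
  define W where "W k i = [eigenvector_of ya, eigenvector_of yb, eigenvector_of yc,
    [1, 1, 1, 1, 1, 1], eigenvector_of yd, eigenvector_of ye] ! k ! i" for k i
  have chain: "eigenvalue_of yb < eigenvalue_of ya" "eigenvalue_of yc < eigenvalue_of yb"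
    "0 < eigenvalue_of yc" "eigenvalue_of yd < 0" "eigenvalue_of ye < eigenvalue_of yd"
  proof -
    have "3 < eigenvalue_of ya" "eigenvalue_of yb < 3" "2 < eigenvalue_of yb"
      "eigenvalue_of yc < 2" "0 < eigenvalue_of yc" "eigenvalue_of yd < 0" "- 1 < eigenvalue_of yd"
      "eigenvalue_of ye < - 1"
      using y by (simp_all add: eigenvalue_of_def divide_simps)
    then show "eigenvalue_of yb < eigenvalue_of ya" "eigenvalue_of yc < eigenvalue_of yb"
      "0 < eigenvalue_of yc" "eigenvalue_of yd < 0" "eigenvalue_of ye < eigenvalue_of yd"
      by linarith+
  qed
  have zero: "(\<Sum>j<6. mds_B 6 mds_graph i j * 1) = 0" if "i < 6" for i
    using less_6_cases[OF that] unfolding sum_less_6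
    by (elim disjE) (simp_all add: mds_B_mds_graph mds_B12_def)
  have nz: "ya \<noteq> 0" "yb \<noteq> 0" "yc \<noteq> 0" "yd \<noteq> 0" "ye \<noteq> 0"
    using y by auto
  obtain V where V: "mds_eigendecomp 6 mds_graph V mu"
  proof (rule mds_eigendecompI[of 6 mds_graph W mu])
    show "mds_B 6 mds_graph i j = mds_B 6 mds_graph j i" if "i < 6" "j < 6" for i j
      using less_6_cases[OF that(1)] less_6_cases[OF that(2)]
      by (elim disjE) (simp_all add: mds_B_mds_graph mds_B12_def)
    show "(\<Sum>j<6. mds_B 6 mds_graph i j * W k j) = mu k * W k i" if "k < 6" "i < 6" for k i
    proof -
      have roots: ?thesis
        if "poly rquintic z = 0" "z \<noteq> 0" "W k = (!) (eigenvector_of z)" "mu k = eigenvalue_of z" for z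
        using eigenvector_of[OF that(1,2) \<open>i < 6\<close>] that(3,4) by simp
      show ?thesis
        using less_6_cases[OF that(1)]
      proof (elim disjE)
        assume k: "k = 3"
        have "W k j = 1" if "j < 6" for j
          using less_6_cases[OF that] by (elim disjE) (simp_all add: k W_def)
        then have "(\<Sum>j<6. mds_B 6 mds_graph i j * W k j) = (\<Sum>j<6. mds_B 6 mds_graph i j * 1)"
          by (intro sum.cong) simp_all
        moreover have "mu k = 0" by (simp add: k mu_def)
        ultimately show ?thesis using zero[OF that(2)] by simp
      next
        assume "k = 0"
        then show ?thesis using y nz by (intro roots[of ya]) (simp_all add: W_def[abs_def] mu_def)
      next
        assume "k = 1"
        then show ?thesis using y nz by (intro roots[of yb]) (simp_all add: W_def[abs_def] mu_def)
      next
        assume "k = 2"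
        then show ?thesis using y nz by (intro roots[of yc]) (simp_all add: W_def[abs_def] mu_def)
      next
        assume "k = 4"
        then show ?thesis using y nz by (intro roots[of yd]) (simp_all add: W_def[abs_def] mu_def)
      next
        assume "k = 5"
        then show ?thesis using y nz by (intro roots[of ye]) (simp_all add: W_def[abs_def] mu_def)
      qed
    qed
    \<comment> \<open>Coordinate 1 equals 1 in all six vectors.\<close>
    show "\<exists>i<6. W k i \<noteq> 0" if "k < 6" for k
      using less_6_cases[OF that] unfolding W_def
      by (intro exI[of _ 1]) (elim disjE; simp add: eigenvector_of_def)
    show "mu j < mu i" if "i < j" "j < 6" for i j
    proof -
      have "i < 6" using that by simp
      then show ?thesis
        using less_6_cases[OF that(2)] less_6_cases[of i] that(1) chain unfolding mu_def
        by (elim disjE) auto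
    qed
  qed
  moreover have "\<exists>y. y \<noteq> 0 \<and> poly rquintic y = 0 \<and> mu k = eigenvalue_of y" if "k < 6" "mu k > 0" for k
  proof -
    have ex: "\<exists>y. y \<noteq> 0 \<and> poly rquintic y = 0 \<and> eigenvalue_of z = eigenvalue_of y"
      if "poly rquintic z = 0" "z \<noteq> 0" for z
      using that by blast
    show ?thesis
      using less_6_cases[OF that(1)] that(2) unfolding mu_def
      by (elim disjE) (simp_all add: ex y nz)
  qed
  ultimately show thesis by (rule that)
qed

theorem theorem10:
  shows "\<exists>E. simple_graph 6 E \<and> graph_connected 6 E \<and>
           (\<exists>V lam. mds_eigendecomp 6 E V lam) \<and>
           (\<forall>T V lam out. mds_eigendecomp 6 E V lam \<longrightarrow> rexec T (adj_input 6 E) out \<longrightarrow>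
                out \<noteq> mds_drawing 6 V lam)"
proof -
  obtain U mu where U: "mds_eigendecomp 6 mds_graph U mu"
    "\<And>k. k < 6 \<Longrightarrow> mu k > 0 \<Longrightarrow> \<exists>y. y \<noteq> 0 \<and> poly rquintic y = 0 \<and> mu k = eigenvalue_of y"
    using mds_graph_eigendecomp by blast
  have "out \<noteq> mds_drawing 6 V lam"
    if V: "mds_eigendecomp 6 mds_graph V lam" and T: "rexec T (adj_input 6 mds_graph) out" for T V lam out
  proof
    assume "out = mds_drawing 6 V lam"
    then have "radical_number (complex_of_real (lam 0))"
      using rexec_radical_number[OF T radical_number_adj_input] radical_drawing_eigenvalue[OF V] by simp
    moreover have "mds_B 6 mds_graph i j = mds_B 6 mds_graph j i" if "i < 6" "j < 6" for i j
      using less_6_cases[OF that(1)] less_6_cases[OF that(2)]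
      by (elim disjE) (simp_all add: mds_B_mds_graph mds_B12_def)
    then obtain k where k: "k < 6" "lam 0 = mu k"
      using mds_eigendecomp_eigenvalue_mem[OF _ U(1) V, of 0] by auto
    \<comment> \<open>The diagonal entry at index 0 is 17/12.\<close>
    moreover have "lam 0 > 0"
      using V by (rule mds_eigendecomp_top_positive[of _ _ _ _ 0]) (simp_all add: mds_B_mds_graph mds_B12_def)
    ultimately show False
      using U(2)[OF k(1)] eigenvalue_of_not_radical by auto
  qed
  then show ?thesis
    using mds_graph_simple mds_graph_connected U(1) by blast
qed

end
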